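(* For a Cameron--Walker graph $G$, the following five conditions are equivalent: (1) $G$ is unmixed. (2) $G$ is Cohen--Macaulay. (3) $G$ is unmixed and shellable. (4) $G$ is unmixed and vertex decomposable. (5) $G$ consists of a connected bipartite graph with vertex partition $[n]\sqcup[m]$ such that there is exactly one leaf edge attached to each vertex $i\in[n]$ and exactly one pendant triangle attached to each vertex $j\in[m]$.
   Context: All graphs are finite and simple. A matching of $G$ is a set $M$ of pairwise disjoint edges; $m(G)$ is the maximum size of a matching. A matching $M$ is an induced matching if for distinct $e,e'\in M$ there is no edge $f\in E(G)$ with $f\cap e\neq\emptyset$ and $f\cap e'\neq\emptyset$; $im(G)$ is the maximum size of an induced matching. A star is a complete bipartite graph $K_{1,k}$ with $k\ge 0$ (a single vertex counts as a star). A star triangle is a graph obtained by joining some number ($\geq 1$) of triangles at one common vertex. A Cameron--Walker graph is a finite connected simple graph $G$ with $im(G)=m(G)$ that is neither a star nor a star triangle. A leaf is a vertex of degree $1$ and a leaf edge is an edge meeting a leaf. A pendant triangle is a triangle two of whose vertices have degree $2$ and whose remaining vertex has degree more than $2$. In (5), $[n]\sqcup[m]$ denotes the bipartition of the vertex set of the connected bipartite graph into parts with $n\geq1$ and $m\geq 1$ elements (every edge of the bipartite graph joins the two parts); $G$ is obtained from it by adding, for each $i\in[n]$, one new vertex adjacent only to $i$, and, for each $j\in[m]$, two new vertices adjacent exactly to each other and to $j$. Let $K$ be a field. For a graph $G$ with vertex set $V$, let $S=K[x_v : v\in V]$ and $I(G)=(x_ux_v : \{u,v\}\in E(G))\subset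 S$. $G$ is Cohen--Macaulay if $S/I(G)$ is Cohen--Macaulay. A vertex cover is a subset $C\subset V$ with $C\cap e\neq\emptyset$ for all $e\in E(G)$; it is minimal if no proper subset is a vertex cover. $G$ is unmixed if all minimal vertex covers have the same cardinality. $G$ is vertex decomposable (resp. shellable) if the clique complex $\Delta(\overline G)$ of the complementary graph (i.e. the simplicial complex of independent sets of $G$) is vertex decomposable (resp. shellable). For a simplicial complex $\Delta$ and a vertex $x$, put $\Delta\setminus x=\{\sigma\in\Delta : x\notin\sigma\}$ and $\mathrm{link}_\Delta(x)=\{\sigma\in\Delta : x\notin\sigma,\ \sigma\cup\{x\}\in\Delta\}$. $\Delta$ is vertex decomposable if $\Delta$ is a simplex, or if there is a vertex $x$ such that (i) $\Delta\setminus x$ and $\mathrm{link}_\Delta(x)$ are vertex decomposable and (ii) no face of $\mathrm{link}_\Delta(x)$ is a facet of $\Delta\setminus x$. $\Delta$ is shellable (not necessarily pure) if its facets can be listed as $F_1,\ldots,F_s$ so that $\left(\bigcup_{j=1}^{i-1}\langle F_j\rangle\right)\cap\langle F_i\rangle$ is a pure simplicial complex of dimension $\dim F_i-1$ for every $1<i\leq s$, where $\langle F\rangle=\{\sigma : \sigma\subset F\}$. *)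

theory Defs
  imports
    "HOL-Algebra.QuotRing"
    "HOL-Library.Poly_Mapping"
    "HOL-Library.Extended_Nat"
begin

section \<open>Graphs\<close>

text \<open>A graph is a pair \<open>V\<close>, \<open>E\<close> of a vertex set and a set of two-element subsets of \<open>V\<close>.\<close>

definition simple_graph :: "'a set \<Rightarrow> 'a set set \<Rightarrow> bool" where
  "simple_graph V E \<longleftrightarrow> finite V \<and> (\<forall>e\<in>E. e \<subseteq> V \<and> card e = 2)"

text \<open>The graph without vertices is not connected.\<close>

definition connected_graph :: "'a set \<Rightarrow> 'a set set \<Rightarrow> bool" where
  "connected_graph V E \<longleftrightarrow> V \<noteq> {} \<and> (\<forall>u\<in>V. \<forall>v\<in>V. (u, v) \<in> {(x, y). {x, y} \<in> E}\<^sup>*)"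

definition matching :: "'a set set \<Rightarrow> 'a set set \<Rightarrow> bool" where
  "matching E M \<longleftrightarrow> M \<subseteq> E \<and> (\<forall>e\<in>M. \<forall>e'\<in>M. e \<noteq> e' \<longrightarrow> e \<inter> e' = {})"

definition induced_matching :: "'a set set \<Rightarrow> 'a set set \<Rightarrow> bool" where
  "induced_matching E M \<longleftrightarrow> matching E M \<and>
     (\<forall>e\<in>M. \<forall>e'\<in>M. e \<noteq> e' \<longrightarrow> \<not> (\<exists>f\<in>E. f \<inter> e \<noteq> {} \<and> f \<inter> e' \<noteq> {}))"

definition matching_number :: "'a set set \<Rightarrow> nat" where
  "matching_number E = Max {card M | M. matching E M}"

definition induced_matching_number :: "'a set set \<Rightarrow> nat" where
  "induced_matching_number E = Max {card M | M. induced_matching E M}"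

definition star :: "'a set \<Rightarrow> 'a set set \<Rightarrow> bool" where
  "star V E \<longleftrightarrow> (\<exists>c\<in>V. E = {{c, v} | v. v \<in> V - {c}})"

text \<open>\<open>P\<close> is the set of those edges of the triangles that do not contain the common vertex \<open>c\<close>.\<close>

definition star_triangle :: "'a set \<Rightarrow> 'a set set \<Rightarrow> bool" where
  "star_triangle V E \<longleftrightarrow>
     (\<exists>c\<in>V. \<exists>P. P \<noteq> {} \<and> (\<forall>p\<in>P. card p = 2) \<and> (\<forall>p\<in>P. \<forall>q\<in>P. p \<noteq> q \<longrightarrow> p \<inter> q = {}) \<and>
        \<Union>P = V - {c} \<and> E = P \<union> {{c, v} | v. v \<in> V - {c}})"

definition cameron_walker :: "'a set \<Rightarrow> 'a set set \<Rightarrow> bool" where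
  "cameron_walker V E \<longleftrightarrow> simple_graph V E \<and> connected_graph V E \<and>
     induced_matching_number E = matching_number E \<and> \<not> star V E \<and> \<not> star_triangle V E"

definition vertex_cover :: "'a set \<Rightarrow> 'a set set \<Rightarrow> 'a set \<Rightarrow> bool" where
  "vertex_cover V E C \<longleftrightarrow> C \<subseteq> V \<and> (\<forall>e\<in>E. C \<inter> e \<noteq> {})"

definition minimal_vertex_cover :: "'a set \<Rightarrow> 'a set set \<Rightarrow> 'a set \<Rightarrow> bool" where
  "minimal_vertex_cover V E C \<longleftrightarrow> vertex_cover V E C \<and> \<not> (\<exists>D. D \<subset> C \<and> vertex_cover V E D)"

definition unmixed :: "'a set \<Rightarrow> 'a set set \<Rightarrow> bool" where
  "unmixed V E \<longleftrightarrow>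
     (\<forall>C D. minimal_vertex_cover V E C \<and> minimal_vertex_cover V E D \<longrightarrow> card C = card D)"

definition bipartite_graph :: "'a set \<Rightarrow> 'a set \<Rightarrow> 'a set set \<Rightarrow> bool" where
  "bipartite_graph A B F \<longleftrightarrow> A \<inter> B = {} \<and> (\<forall>e\<in>F. \<exists>a\<in>A. \<exists>b\<in>B. e = {a, b})"

text \<open>\<open>A\<close> and \<open>B\<close> are the parts \<open>[n]\<close> and \<open>[m]\<close> of the bipartite graph with edge set \<open>F\<close>;
  \<open>l i\<close> is the new vertex attached to \<open>i\<close>, and \<open>p j\<close>, \<open>q j\<close> are the new vertices attached
  to \<open>j\<close>.\<close>

definition bipartite_with_leaves_and_triangles :: "'a set \<Rightarrow> 'a set set \<Rightarrow> bool" where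
  "bipartite_with_leaves_and_triangles V E \<longleftrightarrow>
     (\<exists>A B F l p q.
        A \<noteq> {} \<and> B \<noteq> {} \<and> bipartite_graph A B F \<and> connected_graph (A \<union> B) F \<and>
        inj_on l A \<and> inj_on p B \<and> inj_on q B \<and>
        (A \<union> B) \<inter> (l ` A \<union> p ` B \<union> q ` B) = {} \<and>
        l ` A \<inter> (p ` B \<union> q ` B) = {} \<and> p ` B \<inter> q ` B = {} \<and>
        V = A \<union> B \<union> l ` A \<union> p ` B \<union> q ` B \<and>
        E = F \<union> (\<Union>i\<in>A. {{i, l i}}) \<union> (\<Union>j\<in>B. {{j, p j}, {j, q j}, {p j, q j}}))"


section \<open>Simplicial complexes\<close>

definition facets :: "'a set set \<Rightarrow> 'a set set" where
  "facets \<Delta> = {\<sigma> \<in> \<Delta>. \<not> (\<exists>\<tau>\<in>\<Delta>. \<sigma> \<subset> \<tau>)}"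

definition face_dim :: "'a set \<Rightarrow> int" where
  "face_dim \<sigma> = int (card \<sigma>) - 1"

definition pure_of_dim :: "'a set set \<Rightarrow> int \<Rightarrow> bool" where
  "pure_of_dim \<Delta> d \<longleftrightarrow> facets \<Delta> \<noteq> {} \<and> (\<forall>\<sigma>\<in>facets \<Delta>. face_dim \<sigma> = d)"

definition shellable :: "'a set set \<Rightarrow> bool" where
  "shellable \<Delta> \<longleftrightarrow>
     (\<exists>Fs. distinct Fs \<and> set Fs = facets \<Delta> \<and>
        (\<forall>i. 0 < i \<and> i < length Fs \<longrightarrow>
           pure_of_dim ((\<Union>j<i. Pow (Fs ! j)) \<inter> Pow (Fs ! i)) (face_dim (Fs ! i) - 1)))"

definition deletion :: "'a set set \<Rightarrow> 'a \<Rightarrow> 'a set set" where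
  "deletion \<Delta> x = {\<sigma> \<in> \<Delta>. x \<notin> \<sigma>}"

definition link :: "'a set set \<Rightarrow> 'a \<Rightarrow> 'a set set" where
  "link \<Delta> x = {\<sigma> \<in> \<Delta>. x \<notin> \<sigma> \<and> insert x \<sigma> \<in> \<Delta>}"

text \<open>The complex \<open>{{}}\<close> counts as a simplex, being the link of a vertex that is itself a facet.\<close>

inductive vertex_decomposable :: "'a set set \<Rightarrow> bool" where
  simplex: "finite F \<Longrightarrow> vertex_decomposable (Pow F)"
| shedding: "{x} \<in> \<Delta> \<Longrightarrow> vertex_decomposable (deletion \<Delta> x) \<Longrightarrow> vertex_decomposable (link \<Delta> x) \<Longrightarrow>
    (\<And>\<sigma>. \<sigma> \<in> link \<Delta> x \<Longrightarrow> \<sigma> \<notin> facets (deletion \<Delta> x)) \<Longrightarrow> vertex_decomposable \<Delta>"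

definition complement_edges :: "'a set \<Rightarrow> 'a set set \<Rightarrow> 'a set set" where
  "complement_edges V E = {{u, v} | u v. u \<in> V \<and> v \<in> V \<and> u \<noteq> v \<and> {u, v} \<notin> E}"

definition clique_complex :: "'a set \<Rightarrow> 'a set set \<Rightarrow> 'a set set" where
  "clique_complex V E = {\<sigma>. \<sigma> \<subseteq> V \<and> (\<forall>u\<in>\<sigma>. \<forall>v\<in>\<sigma>. u \<noteq> v \<longrightarrow> {u, v} \<in> E)}"

definition independence_complex :: "'a set \<Rightarrow> 'a set set \<Rightarrow> 'a set set" where
  "independence_complex V E = clique_complex V (complement_edges V E)"

definition vertex_decomposable_graph :: "'a set \<Rightarrow> 'a set set \<Rightarrow> bool" where
  "vertex_decomposable_graph V E \<longleftrightarrow> vertex_decomposable (independence_complex V E)"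

definition shellable_graph :: "'a set \<Rightarrow> 'a set set \<Rightarrow> bool" where
  "shellable_graph V E \<longleftrightarrow> shellable (independence_complex V E)"


section \<open>Krull dimension and depth\<close>

definition krull_dim :: "('b, 'c) ring_scheme \<Rightarrow> enat" where
  "krull_dim R = Sup {enat n | n.
     \<exists>P :: nat \<Rightarrow> 'b set. (\<forall>i\<le>n. primeideal (P i) R) \<and> (\<forall>i<n. P i \<subset> P (Suc i))}"

text \<open>Each \<open>f\<^sub>i\<close> is a non-zero-divisor on \<open>R / (f\<^sub>0, \<dots>, f\<^sub>i\<^sub>-\<^sub>1)\<close>, written out in \<open>R\<close>, and the
  whole sequence generates a proper ideal.\<close>

definition regular_sequence :: "('b, 'c) ring_scheme \<Rightarrow> 'b list \<Rightarrow> bool" where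
  "regular_sequence R fs \<longleftrightarrow> set fs \<subseteq> carrier R \<and>
     genideal R (set fs) \<noteq> carrier R \<and>
     (\<forall>i<length fs. \<forall>r\<in>carrier R.
        fs ! i \<otimes>\<^bsub>R\<^esub> r \<in> genideal R (set (take i fs)) \<longrightarrow> r \<in> genideal R (set (take i fs)))"

definition depth :: "('b, 'c) ring_scheme \<Rightarrow> 'b set \<Rightarrow> enat" where
  "depth R \<mm> = Sup {enat (length fs) | fs. set fs \<subseteq> \<mm> \<and> regular_sequence R fs}"


section \<open>Edge rings\<close>

text \<open>The type \<open>('a \<Rightarrow>\<^sub>0 nat) \<Rightarrow>\<^sub>0 'k\<close> consists of the polynomials over \<open>'k\<close> with variables in
  \<open>'a\<close>; \<open>poly_ring V\<close> is the subring of those in which only variables from \<open>V\<close> occur.\<close>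

definition poly_ring :: "'a set \<Rightarrow> (('a \<Rightarrow>\<^sub>0 nat) \<Rightarrow>\<^sub>0 'k::field) ring" where
  "poly_ring V = \<lparr>carrier = {f. \<forall>t\<in>Poly_Mapping.keys f. Poly_Mapping.keys t \<subseteq> V},
     mult = (*), one = 1, zero = 0, add = (+)\<rparr>"

definition var :: "'a \<Rightarrow> (('a \<Rightarrow>\<^sub>0 nat) \<Rightarrow>\<^sub>0 'k::field)" where
  "var v = Poly_Mapping.single (Poly_Mapping.single v 1) 1"

definition edge_ideal :: "'a set \<Rightarrow> 'a set set \<Rightarrow> (('a \<Rightarrow>\<^sub>0 nat) \<Rightarrow>\<^sub>0 'k::field) set" where
  "edge_ideal V E = genideal (poly_ring V) {var u * var v | u v. {u, v} \<in> E}"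

definition edge_ring :: "'a set \<Rightarrow> 'a set set \<Rightarrow> (('a \<Rightarrow>\<^sub>0 nat) \<Rightarrow>\<^sub>0 'k::field) set ring" where
  "edge_ring V E = poly_ring V Quot edge_ideal V E"

text \<open>The image in \<open>S / I(G)\<close> of the ideal of \<open>S\<close> generated by all variables.\<close>

definition graded_maximal_ideal ::
    "'a set \<Rightarrow> 'a set set \<Rightarrow> (('a \<Rightarrow>\<^sub>0 nat) \<Rightarrow>\<^sub>0 'k::field) set set" where
  "graded_maximal_ideal V E =
     (\<lambda>f. edge_ideal V E +>\<^bsub>poly_ring V\<^esub> f) ` genideal (poly_ring V) (var ` V)"

text \<open>Cohen-Macaulayness of the standard graded algebra \<open>S / I(G)\<close>, i.e. equality of its Krull
  dimension and its depth, the latter taken with respect to the graded maximal ideal.\<close>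

definition cohen_macaulay_graph :: "'k::field itself \<Rightarrow> 'a set \<Rightarrow> 'a set set \<Rightarrow> bool" where
  "cohen_macaulay_graph K V E \<longleftrightarrow>
     (let R = (edge_ring V E :: (('a \<Rightarrow>\<^sub>0 nat) \<Rightarrow>\<^sub>0 'k) set ring)
      in depth R (graded_maximal_ideal V E) = krull_dim R)"

end

theory Submission
  imports Defs
begin

text \<open>
  The theorem is governed by one class of graphs. Call a graph clique-whiskered if its vertices are
  coloured in such a way that every colour class is a clique and contains a vertex all of whose
  neighbours have the same colour. The graphs described in the combinatorial condition are of this
  kind: the colour classes are the leaf edges and the pendant triangles. If \<open>v\<close> differs
  from such a simplicial vertex of its colour, then both the graph without \<open>v\<close> and the graph
  without the neighbours of \<open>v\<close> are again clique-whiskered, and every clique-whiskered graph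
  without such a \<open>v\<close> has no edges. This single induction yields vertex decomposability
  (\<open>clique_whiskered_vertex_decomposable\<close>) and, with shellability following from vertex
  decomposability for every complex, the combinatorial conditions. On the algebraic side it shows
  that the sums of the variables of one colour form a regular sequence on \<open>S / I(G)\<close>, because
  regularity passes from \<open>S / (I : x\<^sub>v)\<close> and \<open>S / (I + (x\<^sub>v))\<close> to \<open>S / I\<close>
  (\<open>regular_colon_adjoin\<close>, \<open>regular_colour_sums\<close>). As a maximal independent set contains
  exactly one vertex of each colour, the length of this sequence is the Krull dimension, so
  \<open>S / I(G)\<close> is Cohen-Macaulay over any field.

  A Cohen-Macaulay graph is unmixed because the Krull dimension is at least the size of every
  independent set while the depth is at most the size of every maximal one. For the second bound
  (\<open>regular_length_le_facet\<close>) let \<open>F\<close> be a maximal independent set and \<open>P\<close> the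
  prime generated by the variables outside \<open>F\<close>. The product \<open>z\<close> of the variables in
  \<open>F\<close> is annihilated by \<open>P\<close>. More than \<open>|F|\<close> polynomials \<open>f\<^sub>i\<close> satisfy an
  algebraic relation modulo \<open>P\<close>, by counting monomials (\<open>ex_algebraic_relation\<close>), so this
  relation, evaluated at the \<open>f\<^sub>i\<close>, annihilates \<open>z\<close>. If the \<open>f\<^sub>i\<close> are a regular
  sequence, then they are quasi-regular (\<open>regular_imp_quasi_regular\<close>): the associated graded ring
  of the ideal \<open>J\<close> that they generate is a polynomial ring over \<open>S / (I + J)\<close>. There the
  initial form of \<open>z\<close>, which exists since the \<open>f\<^sub>i\<close> have no constant term, cannot be annihilated by the lowest form of the relation, whose
  coefficients are units (\<open>regular_sequence_independent\<close>). The argument covers inhomogeneous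
  sequences. The same algebraic relation bounds the lengths of chains of primes
  (\<open>krull_dim_le_independent_set\<close>).

  Finally, let \<open>G\<close> be an unmixed Cameron-Walker graph and \<open>M\<close> an induced matching that
  is at the same time a maximum matching. The vertices \<open>U\<close> missed by \<open>M\<close> are
  independent, distinct edges of \<open>M\<close> are not adjacent, and as there is no augmenting path, each
  edge of \<open>M\<close> is either a leaf edge or the base of a triangle over a vertex of \<open>U\<close>.
  Comparing the sizes of independent sets shows that there is exactly one triangle over each vertex
  of \<open>U\<close> (\<open>at_most_one_triangle\<close>, \<open>triangle_exists\<close>).
\<close>

section \<open>Independent sets and vertex covers\<close>

definition independent_sets :: "'a set \<Rightarrow> 'a set set \<Rightarrow> 'a set set" where
  "independent_sets W E = {\<sigma>. \<sigma> \<subseteq> W \<and> (\<forall>u\<in>\<sigma>. \<forall>v\<in>\<sigma>. {u, v} \<notin> E)}"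

lemma singleton_not_edge: "simple_graph V E \<Longrightarrow> {v} \<notin> E"
  unfolding simple_graph_def by fastforce

lemma independence_complex_eq:
  assumes "simple_graph V E"
  shows "independence_complex V E = independent_sets V E"
proof -
  have "{u, v} \<in> complement_edges V E \<longleftrightarrow> {u, v} \<notin> E" if "u \<in> V" "v \<in> V" "u \<noteq> v" for u v
    using that unfolding complement_edges_def by auto
  then show ?thesis
    using singleton_not_edge[OF assms]
    unfolding independence_complex_def clique_complex_def independent_sets_def
    by (auto simp: subset_iff) (metis insert_absorb2)
qed

lemma finite_independent_sets: "finite W \<Longrightarrow> finite (independent_sets W E)"
  unfolding independent_sets_def by (rule finite_subset[of _ "Pow W"]) auto

lemma independent_sets_subset: "\<tau> \<subseteq> \<sigma> \<Longrightarrow> \<sigma> \<in> independent_sets W E \<Longrightarrow> \<tau> \<in> independent_sets W E"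
  unfolding independent_sets_def by auto

lemma obtain_facet:
  assumes "finite \<Delta>" "\<sigma> \<in> \<Delta>"
  obtains F where "F \<in> facets \<Delta>" "\<sigma> \<subseteq> F"
proof -
  obtain F where "F \<in> {\<tau> \<in> \<Delta>. \<sigma> \<subseteq> \<tau>}" "\<forall>b\<in>{\<tau> \<in> \<Delta>. \<sigma> \<subseteq> \<tau>}. F \<subseteq> b \<longrightarrow> F = b"
    using finite_has_maximal[of "{\<tau> \<in> \<Delta>. \<sigma> \<subseteq> \<tau>}"] assms by auto
  then have "F \<in> facets \<Delta>" "\<sigma> \<subseteq> F"
    unfolding facets_def by auto
  then show ?thesis using that by blast
qed

lemma vertex_cover_compl:
  assumes "simple_graph V E" "C \<subseteq> V"
  shows "vertex_cover V E C \<longleftrightarrow> V - C \<in> independent_sets V E"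
proof
  assume "vertex_cover V E C"
  then show "V - C \<in> independent_sets V E"
    unfolding vertex_cover_def independent_sets_def by fastforce
next
  assume ind: "V - C \<in> independent_sets V E"
  have "C \<inter> e \<noteq> {}" if "e \<in> E" for e
  proof -
    obtain u v where "e = {u, v}" "u \<in> V" "v \<in> V"
      using assms(1) \<open>e \<in> E\<close> unfolding simple_graph_def by (metis card_2_iff insert_subset)
    moreover have "\<not> (u \<in> V - C \<and> v \<in> V - C)"
      using ind \<open>e \<in> E\<close> \<open>e = {u, v}\<close> unfolding independent_sets_def by blast
    ultimately show ?thesis by blast
  qed
  then show "vertex_cover V E C"
    using assms(2) unfolding vertex_cover_def by auto
qed

lemma minimal_vertex_cover_compl:
  assumes "simple_graph V E" "C \<subseteq> V"
  shows "minimal_vertex_cover V E C \<longleftrightarrow> V - C \<in> facets (independent_sets V E)"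
proof -
  have "(\<exists>D. D \<subset> C \<and> vertex_cover V E D) \<longleftrightarrow> (\<exists>\<tau>\<in>independent_sets V E. V - C \<subset> \<tau>)"
  proof
    assume "\<exists>D. D \<subset> C \<and> vertex_cover V E D"
    then obtain D where "D \<subset> C" "vertex_cover V E D" by blast
    then have "V - D \<in> independent_sets V E" "V - C \<subset> V - D"
      using vertex_cover_compl[OF assms(1)] assms(2) by blast+
    then show "\<exists>\<tau>\<in>independent_sets V E. V - C \<subset> \<tau>" by blast
  next
    assume "\<exists>\<tau>\<in>independent_sets V E. V - C \<subset> \<tau>"
    then obtain \<tau> where t: "\<tau> \<in> independent_sets V E" "V - C \<subset> \<tau>" by blast
    then have "\<tau> \<subseteq> V" unfolding independent_sets_def by auto
    then have "vertex_cover V E (V - \<tau>)" "V - \<tau> \<subset> C"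
      using vertex_cover_compl[OF assms(1), of "V - \<tau>"] t by (auto simp: double_diff)
    then show "\<exists>D. D \<subset> C \<and> vertex_cover V E D" by blast
  qed
  then show ?thesis
    unfolding minimal_vertex_cover_def facets_def using vertex_cover_compl[OF assms] by simp
qed

lemma unmixed_iff_facets:
  assumes "simple_graph V E"
  shows "unmixed V E \<longleftrightarrow>
    (\<forall>F\<in>facets (independent_sets V E). \<forall>G\<in>facets (independent_sets V E). card F = card G)"
    (is "_ \<longleftrightarrow> ?R")
proof -
  have fin: "finite V" using assms unfolding simple_graph_def by auto
  have sub: "F \<subseteq> V" if "F \<in> facets (independent_sets V E)" for F
    using that unfolding facets_def independent_sets_def by auto
  have subc: "C \<subseteq> V" if "minimal_vertex_cover V E C" for C
    using that unfolding minimal_vertex_cover_def vertex_cover_def by auto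
  have card_compl: "card A = card B \<longleftrightarrow> card (V - A) = card (V - B)"
    if "A \<subseteq> V" "B \<subseteq> V" for A B
  proof -
    have "card (V - A) = card V - card A" "card (V - B) = card V - card B"
      "card A \<le> card V" "card B \<le> card V"
      using that fin by (simp_all add: card_Diff_subset card_mono finite_subset)
    then show ?thesis by linarith
  qed
  show ?thesis
  proof
    assume u: "unmixed V E"
    show ?R
    proof (intro ballI)
      fix F G assume FG: "F \<in> facets (independent_sets V E)" "G \<in> facets (independent_sets V E)"
      have "minimal_vertex_cover V E (V - F)" "minimal_vertex_cover V E (V - G)"
        using minimal_vertex_cover_compl[OF assms] FG sub by (simp_all add: double_diff)
      then have "card (V - F) = card (V - G)" using u unfolding unmixed_def by blast
      then show "card F = card G"
        using card_compl[OF sub[OF FG(1)] sub[OF FG(2)]] by simp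
    qed
  next
    assume R: ?R
    show "unmixed V E"
      unfolding unmixed_def
    proof (intro allI impI, elim conjE)
      fix C D assume CD: "minimal_vertex_cover V E C" "minimal_vertex_cover V E D"
      have "V - C \<in> facets (independent_sets V E)" "V - D \<in> facets (independent_sets V E)"
        using minimal_vertex_cover_compl[OF assms] CD subc by blast+
      then have "card (V - C) = card (V - D)" using R by blast
      then show "card C = card D"
        using card_compl[OF subc[OF CD(1)] subc[OF CD(2)]] by simp
    qed
  qed
qed


section \<open>Vertex decomposable complexes are shellable\<close>

lemma pure_of_dimI:
  assumes fin: "finite \<Delta>" and ne: "\<Delta> \<noteq> {}"
    and ex: "\<And>\<sigma>. \<sigma> \<in> \<Delta> \<Longrightarrow> \<exists>\<tau>\<in>\<Delta>. \<sigma> \<subseteq> \<tau> \<and> face_dim \<tau> = d"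
  shows "pure_of_dim \<Delta> d"
proof -
  have "facets \<Delta> \<noteq> {}" using obtain_facet[OF fin] ne by blast
  moreover have "face_dim \<sigma> = d" if "\<sigma> \<in> facets \<Delta>" for \<sigma>
  proof -
    obtain \<tau> where "\<tau> \<in> \<Delta>" "\<sigma> \<subseteq> \<tau>" "face_dim \<tau> = d"
      using ex[of \<sigma>] \<open>\<sigma> \<in> facets \<Delta>\<close> unfolding facets_def by blast
    then show ?thesis using that unfolding facets_def by auto
  qed
  ultimately show ?thesis unfolding pure_of_dim_def by blast
qed

text \<open>Shellability in terms of pairs of facets: the intersection with an earlier facet is contained in
  a ridge shared with an earlier facet. In this form the condition is visibly preserved when a
  vertex is added to all facets.\<close>

definition shelling_order :: "'a set list \<Rightarrow> bool" where
  "shelling_order Fs \<longleftrightarrow> (\<forall>i<length Fs. \<forall>j<i. \<exists>k<i.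
     Fs ! j \<inter> Fs ! i \<subseteq> Fs ! k \<and> Suc (card (Fs ! k \<inter> Fs ! i)) = card (Fs ! i))"

lemma shellableI:
  assumes dist: "distinct Fs" and set: "set Fs = facets \<Delta>" and ord: "shelling_order Fs"
    and fin: "\<And>F. F \<in> \<Delta> \<Longrightarrow> finite F"
  shows "shellable \<Delta>"
  unfolding shellable_def
proof (intro exI conjI allI impI)
  show "distinct Fs" "set Fs = facets \<Delta>" by fact+
  fix i assume i: "0 < i \<and> i < length Fs"
  let ?D = "(\<Union>j<i. Pow (Fs ! j)) \<inter> Pow (Fs ! i)"
  have finF: "finite (Fs ! i)"
    using i set fin unfolding facets_def by (metis (no_types, lifting) mem_Collect_eq nth_mem)
  show "pure_of_dim ?D (face_dim (Fs ! i) - 1)"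
  proof (rule pure_of_dimI)
    show "finite ?D" using finF by simp
    have "{} \<in> ?D" using i by auto
    then show "?D \<noteq> {}" by blast
    fix \<sigma> assume "\<sigma> \<in> ?D"
    then obtain j where j: "j < i" "\<sigma> \<subseteq> Fs ! j" "\<sigma> \<subseteq> Fs ! i" by auto
    obtain k where k: "k < i" "Fs ! j \<inter> Fs ! i \<subseteq> Fs ! k" "Suc (card (Fs ! k \<inter> Fs ! i)) = card (Fs ! i)"
      using ord i j(1) unfolding shelling_order_def by blast
    have "Fs ! k \<inter> Fs ! i \<in> ?D" using k(1) by auto
    moreover have "\<sigma> \<subseteq> Fs ! k \<inter> Fs ! i" using j k by auto
    moreover have "face_dim (Fs ! k \<inter> Fs ! i) = face_dim (Fs ! i) - 1"
      using k(3) unfolding face_dim_def by linarith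
    ultimately show "\<exists>\<tau>\<in>?D. \<sigma> \<subseteq> \<tau> \<and> face_dim \<tau> = face_dim (Fs ! i) - 1" by blast
  qed
qed

definition simplicial_complex :: "'a set set \<Rightarrow> bool" where
  "simplicial_complex \<Delta> \<longleftrightarrow> finite \<Delta> \<and> (\<forall>\<sigma>\<in>\<Delta>. finite \<sigma> \<and> Pow \<sigma> \<subseteq> \<Delta>)"

text \<open>The shedding condition ensures that a facet \<open>F\<close> of the deletion stays maximal:
  \<open>insert x F\<close> could only be a face if \<open>F\<close> were a face of the link.\<close>

lemma facets_shedding:
  assumes sc: "simplicial_complex \<Delta>"
    and shed: "\<And>\<sigma>. \<sigma> \<in> link \<Delta> x \<Longrightarrow> \<sigma> \<notin> facets (deletion \<Delta> x)"
  shows "facets \<Delta> = facets (deletion \<Delta> x) \<union> insert x ` facets (link \<Delta> x)"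
proof (intro equalityI subsetI)
  fix F assume F: "F \<in> facets \<Delta>"
  show "F \<in> facets (deletion \<Delta> x) \<union> insert x ` facets (link \<Delta> x)"
  proof (cases "x \<in> F")
    case True
    then have ins: "insert x (F - {x}) = F" by auto
    then have "F - {x} \<in> link \<Delta> x"
      using F sc unfolding facets_def link_def simplicial_complex_def by auto
    moreover have False if "\<tau> \<in> link \<Delta> x" "F - {x} \<subset> \<tau>" for \<tau>
    proof -
      have "F \<subset> insert x \<tau>" "insert x \<tau> \<in> \<Delta>" using that True unfolding link_def by auto
      then show False using F unfolding facets_def by blast
    qed
    ultimately have "F - {x} \<in> facets (link \<Delta> x)" unfolding facets_def by blast
    then show ?thesis using ins by (metis UnI2 image_eqI)
  next
    case False
    then show ?thesis using F unfolding facets_def deletion_def by auto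
  qed
next
  fix F assume "F \<in> facets (deletion \<Delta> x) \<union> insert x ` facets (link \<Delta> x)"
  then show "F \<in> facets \<Delta>"
  proof
    assume F: "F \<in> facets (deletion \<Delta> x)"
    then have mem: "F \<in> \<Delta>" "x \<notin> F" unfolding facets_def deletion_def by auto
    have False if t: "\<tau> \<in> \<Delta>" "F \<subset> \<tau>" for \<tau>
    proof (cases "x \<in> \<tau>")
      case True
      then have "insert x F \<in> \<Delta>"
        using t sc unfolding simplicial_complex_def by (metis (no_types) PowI insert_subset psubset_imp_subset subsetD)
      then have "F \<in> link \<Delta> x" using mem unfolding link_def by auto
      then show False using shed F by blast
    next
      case False
      then show False using F t unfolding facets_def deletion_def by auto
    qed
    then show ?thesis using mem unfolding facets_def by blast
  next
    assume "F \<in> insert x ` facets (link \<Delta> x)"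
    then obtain \<tau> where t: "\<tau> \<in> facets (link \<Delta> x)" "F = insert x \<tau>" by blast
    then have mem: "F \<in> \<Delta>" "x \<notin> \<tau>" unfolding facets_def link_def by auto
    have False if r: "\<rho> \<in> \<Delta>" "F \<subset> \<rho>" for \<rho>
    proof -
      have "insert x (\<rho> - {x}) = \<rho>" using r t by auto
      moreover have "\<rho> - {x} \<in> \<Delta>" using r sc unfolding simplicial_complex_def by blast
      ultimately have "\<rho> - {x} \<in> link \<Delta> x"
        using r unfolding link_def by auto
      moreover have "\<tau> \<subset> \<rho> - {x}" using r t mem by auto
      ultimately show False using t unfolding facets_def by blast
    qed
    then show ?thesis using mem unfolding facets_def by blast
  qed
qed

text \<open>A facet \<open>insert x F\<close> of the cone meets the facets without \<open>x\<close> in subsets of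
  \<open>F\<close>, and \<open>F\<close> itself is such an intersection because it extends to a facet without
  \<open>x\<close>; the intersections within the cone are cones over those for \<open>L2\<close>.\<close>

lemma shelling_order_append_cone:
  assumes o1: "shelling_order L1" and o2: "shelling_order L2"
    and x1: "\<And>F. F \<in> set L1 \<Longrightarrow> x \<notin> F" and x2: "\<And>F. F \<in> set L2 \<Longrightarrow> x \<notin> F \<and> finite F"
    and below: "\<And>F. F \<in> set L2 \<Longrightarrow> \<exists>G\<in>set L1. F \<subseteq> G"
  shows "shelling_order (L1 @ map (insert x) L2)"
  unfolding shelling_order_def
proof (intro allI impI)
  let ?L = "L1 @ map (insert x) L2"
  fix i j assume i: "i < length ?L" and j: "j < i"
  show "\<exists>k<i. ?L ! j \<inter> ?L ! i \<subseteq> ?L ! k \<and> Suc (card (?L ! k \<inter> ?L ! i)) = card (?L ! i)"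
  proof (cases "i < length L1")
    case True
    then obtain k where "k < i" "L1 ! j \<inter> L1 ! i \<subseteq> L1 ! k" "Suc (card (L1 ! k \<inter> L1 ! i)) = card (L1 ! i)"
      using o1 j unfolding shelling_order_def by blast
    then show ?thesis
      using True j by (intro exI[of _ k]) (auto simp: nth_append)
  next
    case False
    define i' where "i' = i - length L1"
    have i': "i' < length L2" "?L ! i = insert x (L2 ! i')"
      using i False by (auto simp: i'_def nth_append)
    then have F: "L2 ! i' \<in> set L2" by simp
    show ?thesis
    proof (cases "j < length L1")
      case True
      obtain G where "G \<in> set L1" "L2 ! i' \<subseteq> G" using below[OF F] by blast
      then obtain k where k: "k < length L1" "L2 ! i' \<subseteq> L1 ! k" by (metis in_set_conv_nth)
      have xk: "x \<notin> L1 ! k" using x1 k by auto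
      have Lk: "?L ! k = L1 ! k" using k by (simp add: nth_append)
      have eq: "?L ! k \<inter> ?L ! i = L2 ! i'" using k(2) xk i' Lk by auto
      have "?L ! j \<inter> ?L ! i \<subseteq> L2 ! i'" using True i' x1 by (auto simp: nth_append)
      moreover have "Suc (card (L2 ! i')) = card (?L ! i)" using i' x2[OF F] by simp
      ultimately show ?thesis
        using eq k(1) False by (intro exI[of _ k]) auto
    next
      case jF: False
      define j' where "j' = j - length L1"
      have j': "j' < i'" "?L ! j = insert x (L2 ! j')"
        using jF j i False by (auto simp: j'_def i'_def nth_append)
      then obtain k where k: "k < i'" "L2 ! j' \<inter> L2 ! i' \<subseteq> L2 ! k"
        "Suc (card (L2 ! k \<inter> L2 ! i')) = card (L2 ! i')"
        using o2 i' unfolding shelling_order_def by blast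
      have Lk: "?L ! (length L1 + k) = insert x (L2 ! k)" using k i' by (simp add: nth_append)
      have xk: "x \<notin> L2 ! k" using x2 k i' by auto
      have "card (insert x (L2 ! k) \<inter> insert x (L2 ! i')) = Suc (card (L2 ! k \<inter> L2 ! i'))"
        using x2[OF F] xk by (simp add: Int_insert_right Int_insert_left)
      then have "Suc (card (?L ! (length L1 + k) \<inter> ?L ! i)) = card (?L ! i)"
        unfolding Lk i'(2) using k(3) x2[OF F] by simp
      moreover have "?L ! j \<inter> ?L ! i \<subseteq> ?L ! (length L1 + k)"
        unfolding Lk i'(2) j'(2) using k(2) by auto
      moreover have "length L1 + k < i" using k(1) False unfolding i'_def by simp
      ultimately show ?thesis by blast
    qed
  qed
qed

lemma vertex_decomposable_imp_shelling_order:
  assumes "vertex_decomposable \<Delta>" "simplicial_complex \<Delta>"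
  shows "\<exists>Fs. distinct Fs \<and> set Fs = facets \<Delta> \<and> shelling_order Fs"
  using assms
proof induction
  case (simplex F)
  have "facets (Pow F) = {F}" unfolding facets_def by auto
  then show ?case by (intro exI[of _ "[F]"]) (auto simp: shelling_order_def)
next
  case (shedding x \<Delta>)
  have sd: "simplicial_complex (deletion \<Delta> x)"
    using shedding.prems unfolding simplicial_complex_def deletion_def by auto
  have "Pow \<sigma> \<subseteq> link \<Delta> x" if "\<sigma> \<in> link \<Delta> x" for \<sigma>
  proof
    fix \<tau> assume "\<tau> \<in> Pow \<sigma>"
    then have "insert x \<tau> \<in> Pow (insert x \<sigma>)" by auto
    then show "\<tau> \<in> link \<Delta> x"
      using that \<open>\<tau> \<in> Pow \<sigma>\<close> shedding.prems unfolding simplicial_complex_def link_def by blast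
  qed
  then have sl: "simplicial_complex (link \<Delta> x)"
    using shedding.prems unfolding simplicial_complex_def link_def by auto
  obtain L1 where L1: "distinct L1" "set L1 = facets (deletion \<Delta> x)" "shelling_order L1"
    using shedding.IH(1)[OF sd] by blast
  obtain L2 where L2: "distinct L2" "set L2 = facets (link \<Delta> x)" "shelling_order L2"
    using shedding.IH(2)[OF sl] by blast
  have x1: "x \<notin> F" if "F \<in> set L1" for F using that L1 unfolding facets_def deletion_def by auto
  have x2: "x \<notin> F \<and> finite F" if "F \<in> set L2" for F
    using that L2 sl unfolding facets_def link_def simplicial_complex_def by auto
  have below: "\<exists>G\<in>set L1. F \<subseteq> G" if "F \<in> set L2" for F
  proof -
    have "F \<in> deletion \<Delta> x" using that L2 unfolding facets_def link_def deletion_def by auto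
    then show ?thesis using obtain_facet sd L1(2) unfolding simplicial_complex_def by metis
  qed
  let ?L = "L1 @ map (insert x) L2"
  have "inj_on (insert x) (set L2)" using x2 by (metis inj_onI insert_ident)
  then have "distinct ?L" using L1(1) L2(1) x1 by (auto simp: distinct_map)
  moreover have "set ?L = facets \<Delta>"
    using facets_shedding[OF shedding.prems shedding.hyps(4)] L1(2) L2(2) by auto
  moreover have "shelling_order ?L"
    by (rule shelling_order_append_cone) (use L1 L2 x1 x2 below in auto)
  ultimately show ?case by blast
qed

lemma vertex_decomposable_imp_shellable:
  assumes "vertex_decomposable \<Delta>" "simplicial_complex \<Delta>"
  shows "shellable \<Delta>"
  using vertex_decomposable_imp_shelling_order[OF assms] shellableI assms(2)
  unfolding simplicial_complex_def by metis


section \<open>Graphs covered by cliques with a simplicial vertex\<close>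

text \<open>Attaching a new vertex to every member of a partition of a graph into cliques produces such a
  graph; the new vertices are the vertices \<open>d\<close>. Only the classes that meet \<open>W\<close> count,
  so that the notion is inherited by the vertex sets of links.\<close>

definition clique_whiskered :: "('a \<Rightarrow> 'c) \<Rightarrow> 'a set \<Rightarrow> 'a set set \<Rightarrow> bool" where
  "clique_whiskered col W E \<longleftrightarrow>
     (\<forall>u\<in>W. \<forall>v\<in>W. u \<noteq> v \<and> col u = col v \<longrightarrow> {u, v} \<in> E) \<and>
     (\<forall>v\<in>W. \<exists>d\<in>W. col d = col v \<and> (\<forall>u\<in>W. {u, d} \<in> E \<longrightarrow> col u = col v))"

lemma clique_whiskered_delete:
  assumes "clique_whiskered col W E" "d \<in> W" "d \<noteq> v" "col d = col v"
    "\<forall>u\<in>W. {u, d} \<in> E \<longrightarrow> col u = col v"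
  shows "clique_whiskered col (W - {v}) E"
  unfolding clique_whiskered_def
proof (intro conjI ballI)
  fix w assume w: "w \<in> W - {v}"
  show "\<exists>d'\<in>W - {v}. col d' = col w \<and> (\<forall>u\<in>W - {v}. {u, d'} \<in> E \<longrightarrow> col u = col w)"
  proof (cases "col w = col v")
    case True
    then show ?thesis using assms by (intro bexI[of _ d]) auto
  next
    case False
    then show ?thesis using assms(1) w unfolding clique_whiskered_def by (metis DiffE DiffI singletonD)
  qed
next
  fix u w assume "u \<in> W - {v}" "w \<in> W - {v}"
  then show "u \<noteq> w \<and> col u = col w \<longrightarrow> {u, w} \<in> E"
    using assms(1) unfolding clique_whiskered_def by blast
qed

text \<open>The colour of \<open>v\<close> disappears, and the simplicial vertex of any other colour is not
  adjacent to \<open>v\<close>.\<close>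

lemma clique_whiskered_link:
  assumes cw: "clique_whiskered col W E" and "v \<in> W"
  shows "clique_whiskered col {u\<in>W. u \<noteq> v \<and> {u, v} \<notin> E} E" (is "clique_whiskered _ ?W _")
  unfolding clique_whiskered_def
proof (intro conjI ballI)
  fix w assume w: "w \<in> ?W"
  have neq: "col w \<noteq> col v" using cw w \<open>v \<in> W\<close> unfolding clique_whiskered_def by auto
  obtain d where d: "d \<in> W" "col d = col w" "\<forall>u\<in>W. {u, d} \<in> E \<longrightarrow> col u = col w"
    using cw w unfolding clique_whiskered_def by blast
  have "{d, v} \<notin> E" using d(3) \<open>v \<in> W\<close> neq by (metis insert_commute)
  then have "d \<in> ?W" using d neq by auto
  then show "\<exists>d'\<in>?W. col d' = col w \<and> (\<forall>u\<in>?W. {u, d'} \<in> E \<longrightarrow> col u = col w)"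
    using d by blast
next
  fix u w assume "u \<in> ?W" "w \<in> ?W"
  then show "u \<noteq> w \<and> col u = col w \<longrightarrow> {u, w} \<in> E"
    using cw unfolding clique_whiskered_def by blast
qed

text \<open>This dichotomy drives the inductions on the number of vertices. If no two vertices share a
  colour, then every vertex is the simplicial vertex of its colour and hence isolated.\<close>

lemma clique_whiskered_cases:
  assumes cw: "clique_whiskered col W E" and loop: "\<And>v. {v} \<notin> E"
  obtains (no_edges) "inj_on col W" "independent_sets W E = Pow W"
  | (remove) v d where "v \<in> W" "d \<in> W" "d \<noteq> v" "col d = col v"
      "\<forall>u\<in>W. {u, d} \<in> E \<longrightarrow> col u = col v"
proof (cases "inj_on col W")
  case True
  have "{u, v} \<notin> E" if uv: "u \<in> W" "v \<in> W" for u v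
  proof
    assume e: "{u, v} \<in> E"
    obtain d where d: "d \<in> W" "col d = col v" "\<forall>u\<in>W. {u, d} \<in> E \<longrightarrow> col u = col v"
      using cw uv unfolding clique_whiskered_def by blast
    then have "d = v" using True uv by (meson inj_onD)
    then have "col u = col v" using d(3) uv e by blast
    then have "u = v" using True uv by (meson inj_onD)
    then show False using e loop by simp
  qed
  then have "independent_sets W E = Pow W" unfolding independent_sets_def by blast
  then show ?thesis using True no_edges by blast
next
  case False
  then obtain a b where ab: "a \<in> W" "b \<in> W" "a \<noteq> b" "col a = col b" unfolding inj_on_def by blast
  obtain d where d: "d \<in> W" "col d = col a" "\<forall>u\<in>W. {u, d} \<in> E \<longrightarrow> col u = col a"
    using cw ab unfolding clique_whiskered_def by blast
  show ?thesis
  proof (cases "d = a")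
    case True
    then show ?thesis using remove[of b d] ab d by auto
  next
    case False
    then show ?thesis using remove[of a d] ab d by auto
  qed
qed

lemma deletion_independent_sets: "deletion (independent_sets W E) v = independent_sets (W - {v}) E"
  unfolding deletion_def independent_sets_def by auto

lemma link_independent_sets:
  assumes "v \<in> W" "{v} \<notin> E"
  shows "link (independent_sets W E) v = independent_sets {u\<in>W. u \<noteq> v \<and> {u, v} \<notin> E} E"
proof -
  have sym: "{v, u} \<in> E \<longleftrightarrow> {u, v} \<in> E" for u by (simp add: insert_commute)
  show ?thesis
  proof (intro equalityI subsetI)
    fix \<sigma> assume s: "\<sigma> \<in> link (independent_sets W E) v"
    then have "\<forall>a\<in>\<sigma>. {a, v} \<notin> E" unfolding link_def independent_sets_def by blast
    then show "\<sigma> \<in> independent_sets {u\<in>W. u \<noteq> v \<and> {u, v} \<notin> E} E"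
      using s unfolding link_def independent_sets_def by blast
  next
    fix \<sigma> assume s: "\<sigma> \<in> independent_sets {u\<in>W. u \<noteq> v \<and> {u, v} \<notin> E} E"
    then have "\<forall>a\<in>insert v \<sigma>. \<forall>b\<in>insert v \<sigma>. {a, b} \<notin> E"
      using sym assms unfolding independent_sets_def by simp blast
    then show "\<sigma> \<in> link (independent_sets W E) v"
      using s assms unfolding link_def independent_sets_def by blast
  qed
qed

text \<open>A vertex \<open>v\<close> with a simplicial vertex \<open>d \<noteq> v\<close> of its colour is a shedding vertex: a
  face of the link of \<open>v\<close> contains no vertex of that colour, so it can be enlarged by
  \<open>d\<close> inside the deletion.\<close>

lemma clique_whiskered_vertex_decomposable:
  assumes "finite W" "clique_whiskered col W E" and loop: "\<And>v. {v} \<notin> E"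
  shows "vertex_decomposable (independent_sets W E)"
  using assms(1,2)
proof (induction "card W" arbitrary: W rule: less_induct)
  case less
  from less.prems(2) loop show ?case
  proof (cases rule: clique_whiskered_cases)
    case no_edges
    then show ?thesis using less.prems(1) by (simp add: vertex_decomposable.simplex)
  next
    case (remove v d)
    let ?L = "{u\<in>W. u \<noteq> v \<and> {u, v} \<notin> E}"
    have link: "link (independent_sets W E) v = independent_sets ?L E"
      by (rule link_independent_sets[OF remove(1) loop])
    show ?thesis
    proof (rule vertex_decomposable.shedding[of v])
      show "{v} \<in> independent_sets W E" using remove loop unfolding independent_sets_def by auto
      show "vertex_decomposable (deletion (independent_sets W E) v)"
        unfolding deletion_independent_sets
      proof (rule less.hyps)
        show "card (W - {v}) < card W" using less.prems(1) remove(1) by (simp only: card_Diff1_less)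
      qed (use less.prems(1) clique_whiskered_delete[OF less.prems(2) remove(2-5)] in simp_all)
      have "card ?L < card W"
      proof (rule psubset_card_mono[OF less.prems(1)])
        show "?L \<subset> W" using remove(1) by blast
      qed
      then show "vertex_decomposable (link (independent_sets W E) v)"
        unfolding link using clique_whiskered_link[OF less.prems(2) remove(1)] less.prems(1)
        by (intro less.hyps) simp_all
      fix \<sigma> assume "\<sigma> \<in> link (independent_sets W E) v"
      then have s: "\<sigma> \<in> independent_sets ?L E" unfolding link .
      have ds: "u \<noteq> d \<and> {u, d} \<notin> E" if "u \<in> \<sigma>" for u
      proof -
        have u: "u \<in> W" "u \<noteq> v" "{u, v} \<notin> E" using s that unfolding independent_sets_def by blast+
        then have "col u \<noteq> col v"
          using less.prems(2) remove(1) unfolding clique_whiskered_def by blast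
        then show ?thesis using remove(4,5) u(1) by metis
      qed
      have ds': "{d, u} \<notin> E" if "u \<in> \<sigma>" for u using ds[OF that] by (simp add: insert_commute)
      have sub: "\<sigma> \<subseteq> W - {v}" and ind: "\<forall>u\<in>\<sigma>. \<forall>w\<in>\<sigma>. {u, w} \<notin> E"
        using s unfolding independent_sets_def by blast+
      have "insert d \<sigma> \<in> deletion (independent_sets W E) v"
        unfolding deletion_independent_sets unfolding independent_sets_def
        using sub ind ds ds' remove(2,3) loop by simp
      then show "\<sigma> \<notin> facets (deletion (independent_sets W E) v)"
        using ds unfolding facets_def by blast
    qed
  qed
qed

text \<open>A maximal independent set that misses a colour could be enlarged by the simplicial vertex of
  that colour.\<close>

lemma clique_whiskered_facet_card:
  assumes cw: "clique_whiskered col W E" and loop: "\<And>v. {v} \<notin> E"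
    and F: "F \<in> facets (independent_sets W E)"
  shows "card F = card (col ` W)"
proof -
  have FW: "F \<subseteq> W" and ind: "\<And>u w. u \<in> F \<Longrightarrow> w \<in> F \<Longrightarrow> {u, w} \<notin> E"
    using F unfolding facets_def independent_sets_def by auto
  have inj: "inj_on col F"
    using cw FW ind unfolding clique_whiskered_def inj_on_def by blast
  have "\<exists>u\<in>F. col u = col v" if v: "v \<in> W" for v
  proof (rule ccontr)
    assume none: "\<not> (\<exists>u\<in>F. col u = col v)"
    obtain d where d: "d \<in> W" "col d = col v" "\<forall>u\<in>W. {u, d} \<in> E \<longrightarrow> col u = col v"
      using cw v unfolding clique_whiskered_def by blast
    have "{u, d} \<notin> E \<and> {d, u} \<notin> E" if "u \<in> F" for u
      using d FW that none by (metis insert_commute subsetD)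
    then have "insert d F \<in> independent_sets W E"
      using FW d(1) ind loop unfolding independent_sets_def by auto
    moreover have "F \<subset> insert d F" using none d by auto
    ultimately show False using F unfolding facets_def by blast
  qed
  then have "col ` W \<subseteq> col ` F" by (metis image_eqI image_subsetI)
  then have "col ` F = col ` W" using FW by blast
  then show ?thesis using inj by (metis card_image)
qed

section \<open>Graphs with a maximum matching that is induced\<close>

lemma obtain_induced_maximum_matching:
  assumes "simple_graph V E" "induced_matching_number E = matching_number E"
  obtains M where "induced_matching E M" "\<And>M'. matching E M' \<Longrightarrow> card M' \<le> card M"
proof -
  have "finite E"
    using assms(1) finite_subset[of E "Pow V"] unfolding simple_graph_def by auto
  then have fin: "finite {card M | M. P M}" if "\<And>M. P M \<Longrightarrow> M \<subseteq> E" for P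
    using that finite_subset[of "{card M | M. P M}" "card ` Pow E"] by blast
  have "induced_matching E {}" unfolding induced_matching_def matching_def by auto
  then have "{card M | M. induced_matching E M} \<noteq> {}" by blast
  moreover have "finite {card M | M. induced_matching E M}"
    by (rule fin) (simp add: induced_matching_def matching_def)
  ultimately have "induced_matching_number E \<in> {card M | M. induced_matching E M}"
    unfolding induced_matching_number_def by (rule Max_in[rotated])
  then obtain M where M: "induced_matching E M" "card M = induced_matching_number E" by auto
  have "finite {card M | M. matching E M}"
    by (rule fin) (simp add: matching_def)
  then have "card M' \<le> card M" if "matching E M'" for M'
    unfolding M(2) assms(2) matching_number_def using that by (intro Max_ge) blast+
  then show ?thesis using M(1) that by blast
qed

lemma connected_graph_closed_subset:
  assumes "connected_graph V E" "S \<subseteq> V" "S \<noteq> {}"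
    and closed: "\<And>x y. x \<in> S \<Longrightarrow> {x, y} \<in> E \<Longrightarrow> y \<in> S"
  shows "S = V"
proof -
  obtain s where s: "s \<in> S" using assms(3) by blast
  have "v \<in> S" if "v \<in> V" for v
  proof -
    have "(s, v) \<in> {(x, y). {x, y} \<in> E}\<^sup>*"
      using assms(1,2) s that unfolding connected_graph_def by blast
    then show ?thesis using s by induction (auto intro: closed)
  qed
  then show ?thesis using assms(2) by blast
qed

locale graph_induced_maximum_matching =
  fixes V :: "'a set" and E M :: "'a set set"
  assumes simple: "simple_graph V E"
    and induced: "induced_matching E M"
    and maximum: "\<And>M'. matching E M' \<Longrightarrow> card M' \<le> card M"
begin

text \<open>The matching edges with exactly one end adjacent to \<open>U\<close> turn out to be leaf edges, and
  \<open>A\<close> collects their inner ends. The other matching edges are bases of triangles, and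
  \<open>T u\<close> collects the ends of those over the apex \<open>u\<close>.\<close>

definition "U = V - \<Union>M"
definition "mate x = (THE y. {x, y} \<in> M)"
definition "outer x \<longleftrightarrow> (\<exists>u\<in>U. {x, u} \<in> E)"
definition "A = {x \<in> \<Union>M. outer x \<and> \<not> outer (mate x)}"
definition "T u = {x \<in> \<Union>M. outer (mate x) \<and> {x, u} \<in> E}"

lemma ME: "M \<subseteq> E" and matching: "matching E M"
  using induced unfolding induced_matching_def matching_def by auto

lemma edgeD: "{x, y} \<in> E \<Longrightarrow> x \<in> V \<and> y \<in> V \<and> x \<noteq> y"
  using simple unfolding simple_graph_def by fastforce

lemma edge_sym: "{x, y} \<in> E \<Longrightarrow> {y, x} \<in> E"
  by (simp add: insert_commute)

lemma finite_V: "finite V"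
  using simple unfolding simple_graph_def by blast

lemma finite_M: "finite M"
proof (rule finite_subset)
  show "M \<subseteq> Pow V" using ME simple unfolding simple_graph_def by blast
qed (simp add: finite_V)

lemma matching_disjoint: "e \<in> M \<Longrightarrow> e' \<in> M \<Longrightarrow> x \<in> e \<Longrightarrow> x \<in> e' \<Longrightarrow> e = e'"
  using matching unfolding matching_def by blast

lemma mate:
  assumes "x \<in> \<Union>M"
  shows "{x, mate x} \<in> M" "mate x \<noteq> x"
proof -
  obtain e where e: "e \<in> M" "x \<in> e" using assms by blast
  then have "card e = 2" using ME simple unfolding simple_graph_def by blast
  then obtain y where y: "e = {x, y}" "y \<noteq> x"
    using e(2) by (auto simp: card_2_iff)
  have "z = y" if "{x, z} \<in> M" for z
  proof -
    have "{x, z} = {x, y}" using matching_disjoint[OF that e(1), of x] y(1) by simp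
    then show ?thesis using y(2) by (auto simp: doubleton_eq_iff)
  qed
  moreover have "{x, y} \<in> M" using e(1) y(1) by simp
  ultimately have "mate x = y" unfolding mate_def by (rule the_equality[rotated])
  then show "{x, mate x} \<in> M" "mate x \<noteq> x" using e(1) y by simp_all
qed

lemma mate_in: "x \<in> \<Union>M \<Longrightarrow> mate x \<in> \<Union>M"
  using mate(1) by blast

lemma mate_unique:
  assumes "{x, y} \<in> M"
  shows "y = mate x"
proof -
  have x: "x \<in> \<Union>M" using assms by blast
  have "{x, y} = {x, mate x}"
    by (rule matching_disjoint[OF assms mate(1)[OF x], of x]) simp_all
  moreover have "y \<noteq> x" using edgeD ME assms by blast
  ultimately show ?thesis by (auto simp: doubleton_eq_iff)
qed

lemma mate_mate: "x \<in> \<Union>M \<Longrightarrow> mate (mate x) = x"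
  using mate(1)[of x] mate_unique[of "mate x" x] by (simp add: insert_commute)

lemma mate_edge: "x \<in> \<Union>M \<Longrightarrow> {x, mate x} \<in> E"
  using mate(1) ME by blast

text \<open>An edge between two edges of \<open>M\<close> is excluded since \<open>M\<close> is induced.\<close>

lemma inner_edge:
  assumes "x \<in> \<Union>M" "y \<in> \<Union>M" "{x, y} \<in> E"
  shows "y = mate x"
proof -
  have "{x, mate x} = {y, mate y}"
  proof (rule ccontr)
    assume "{x, mate x} \<noteq> {y, mate y}"
    then have "\<not> (\<exists>f\<in>E. f \<inter> {x, mate x} \<noteq> {} \<and> f \<inter> {y, mate y} \<noteq> {})"
      using induced mate(1)[OF assms(1)] mate(1)[OF assms(2)] unfolding induced_matching_def by metis
    moreover have "{x, y} \<inter> {x, mate x} \<noteq> {}" "{x, y} \<inter> {y, mate y} \<noteq> {}" by auto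
    ultimately show False using assms(3) by metis
  qed
  then show ?thesis using edgeD[OF assms(3)] by (auto simp: doubleton_eq_iff)
qed

lemma U_disjoint: "u \<in> U \<Longrightarrow> u \<notin> \<Union>M" and U_subset: "U \<subseteq> V" and V_cases: "x \<in> V \<Longrightarrow> x \<in> U \<or> x \<in> \<Union>M"
  unfolding U_def by auto

lemma M_subset: "\<Union>M \<subseteq> V"
  using ME simple unfolding simple_graph_def by blast

lemma U_independent:
  assumes "u \<in> U" "v \<in> U"
  shows "{u, v} \<notin> E"
proof
  assume e: "{u, v} \<in> E"
  have "{u, v} \<inter> e' = {}" "e' \<inter> {u, v} = {}" if "e' \<in> M" for e'
    using that U_disjoint[OF assms(1)] U_disjoint[OF assms(2)] by blast+
  then have "matching E (insert {u, v} M)"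
    using matching e unfolding matching_def by simp
  then have "card (insert {u, v} M) \<le> card M" by (rule maximum)
  moreover have "{u, v} \<notin> M" using U_disjoint[OF assms(1)] by auto
  ultimately show False using finite_M by simp
qed

text \<open>Otherwise \<open>u, x, mate x, v\<close> would be an augmenting path and its two outer edges could
  replace the matching edge in the middle.\<close>

lemma no_augmenting_path:
  assumes x: "x \<in> \<Union>M" and "u \<in> U" "v \<in> U" "{x, u} \<in> E" "{mate x, v} \<in> E"
  shows "u = v"
proof (rule ccontr)
  assume "u \<noteq> v"
  let ?e = "{x, mate x}" and ?f = "{x, u}" and ?g = "{mate x, v}"
  let ?M = "insert ?f (insert ?g (M - {?e}))"
  have e: "?e \<in> M" "mate x \<noteq> x" using mate[OF x] by auto
  have u: "u \<notin> \<Union>M" "v \<notin> \<Union>M" using U_disjoint assms by auto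
  have disj: "e' \<inter> ?f = {}" "e' \<inter> ?g = {}" if "e' \<in> M - {?e}" for e'
    using matching_disjoint[OF e(1), of e'] that u by auto
  have fg: "?f \<inter> ?g = {}" using e(2) u x mate_in[OF x] \<open>u \<noteq> v\<close> by auto
  have "matching E ?M"
    unfolding matching_def
  proof (intro conjI ballI impI)
    show "?M \<subseteq> E" using ME assms by auto
    fix e1 e2 assume "e1 \<in> ?M" "e2 \<in> ?M" "e1 \<noteq> e2"
    then show "e1 \<inter> e2 = {}"
      using disj fg matching unfolding matching_def by (elim insertE) (simp_all add: Int_commute)
  qed
  then have "card ?M \<le> card M" by (rule maximum)
  moreover have "?f \<notin> M" "?g \<notin> M" "?f \<noteq> ?g" using u fg by auto
  then have "card ?M = Suc (Suc (card (M - {?e})))" using finite_M by simp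
  then have "card ?M = Suc (card M)" using card_Suc_Diff1[OF finite_M e(1)] by simp
  ultimately show False by simp
qed

lemma outer_mate_unique:
  assumes "x \<in> \<Union>M" "outer (mate x)" "u \<in> U" "v \<in> U" "{x, u} \<in> E" "{x, v} \<in> E"
  shows "u = v"
  using assms no_augmenting_path[of x] unfolding outer_def by metis

lemma A_props:
  assumes "a \<in> A"
  shows "a \<in> \<Union>M" "mate a \<in> \<Union>M" "\<not> outer (mate a)" "a \<notin> U" "mate a \<notin> U"
    "mate a \<notin> A" "mate (mate a) = a"
  using assms U_disjoint[of a] U_disjoint[of "mate a"] mate_in[of a] mate_mate[of a]
  unfolding A_def by auto

lemma A_mate_inj: "inj_on mate A"
  using A_props(7) by (metis inj_onI)

lemma finite_parts: "finite U" "finite A"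
proof -
  have "A \<subseteq> V" using A_props(1) M_subset by blast
  then show "finite U" "finite A" using finite_V U_subset finite_subset by blast+
qed

text \<open>By the absence of augmenting paths both ends of such a matching edge see the same vertex of
  \<open>U\<close>, so the three vertices form a triangle.\<close>

lemma T_props:
  assumes "u \<in> U" "x \<in> T u"
  shows "x \<in> \<Union>M" "mate x \<in> T u" "{x, u} \<in> E" "x \<notin> U" "x \<notin> A" "mate x \<notin> A"
proof -
  show x: "x \<in> \<Union>M" "{x, u} \<in> E" using assms unfolding T_def by auto
  show "x \<notin> U" using U_disjoint x by auto
  have ox: "outer x" "outer (mate x)" using assms unfolding T_def outer_def by auto
  then obtain v where v: "v \<in> U" "{mate x, v} \<in> E" unfolding outer_def by blast
  then have "u = v" using no_augmenting_path[OF x(1) assms(1) v(1) x(2) v(2)] by simp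
  then show "mate x \<in> T u" using x mate_in mate_mate v ox unfolding T_def by simp
  show "x \<notin> A" "mate x \<notin> A" using ox mate_mate[OF x(1)] unfolding A_def by auto
qed

lemma T_unique: "u \<in> U \<Longrightarrow> v \<in> U \<Longrightarrow> x \<in> T u \<Longrightarrow> x \<in> T v \<Longrightarrow> u = v"
  using outer_mate_unique unfolding T_def by blast

lemma mate_A_edge:
  assumes "a \<in> A" "{mate a, y} \<in> E"
  shows "y = a"
proof -
  have "y \<in> V" using edgeD assms by blast
  moreover have "y \<notin> U" using A_props(3)[OF assms(1)] assms(2) unfolding outer_def by blast
  ultimately have "y \<in> \<Union>M" using V_cases by blast
  then have "y = mate (mate a)" using inner_edge assms A_props(2) by blast
  then show ?thesis using A_props(7) assms by simp
qed

lemma U_leaves_independent: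
  assumes "x \<in> U \<union> mate ` A" "y \<in> U \<union> mate ` A"
  shows "{x, y} \<notin> E"
proof
  assume e: "{x, y} \<in> E"
  have no: False if "x \<in> mate ` A" "y \<in> U \<union> mate ` A" "{x, y} \<in> E" for x y
  proof -
    obtain a where a: "a \<in> A" "x = mate a" using \<open>x \<in> mate ` A\<close> by blast
    then have "y = a" using mate_A_edge that(3) by blast
    then show False using that(2) a(1) A_props(4)[OF a(1)] A_props(6) by blast
  qed
  show False
    using assms no[of x y] no[of y x] e edge_sym[OF e] U_independent[of x y] by blast
qed

lemma T_edge:
  assumes "u \<in> U" "x \<in> T u" "{x, y} \<in> E"
  shows "y = u \<or> y = mate x"
proof (cases "y \<in> U")
  case True
  then show ?thesis
    using outer_mate_unique[of x u y] assms unfolding T_def by blast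
next
  case False
  then have "y \<in> \<Union>M" using V_cases edgeD assms by blast
  then show ?thesis using inner_edge assms T_props(1) by blast
qed

lemma U_edge:
  assumes "u \<in> U" "{x, u} \<in> E"
  shows "x \<in> A \<or> x \<in> T u"
proof -
  have "x \<in> V" "x \<notin> U" using assms edgeD U_independent by blast+
  then have "x \<in> \<Union>M" using V_cases by blast
  then show ?thesis using assms unfolding A_def T_def outer_def by blast
qed

end

section \<open>The structure of unmixed Cameron-Walker graphs\<close>

locale unmixed_cameron_walker = graph_induced_maximum_matching +
  assumes connected: "connected_graph V E" and not_star: "\<not> star V E"
    and not_star_triangle: "\<not> star_triangle V E" and unmixed: "unmixed V E"
begin

text \<open>Otherwise this matching edge would be a connected component, and the graph would be the star
  \<open>K\<^sub>1\<^sub>,\<^sub>1\<close>.\<close>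

lemma not_both_inner:
  assumes x: "x \<in> \<Union>M"
  shows "outer x \<or> outer (mate x)"
proof (rule ccontr)
  assume no: "\<not> (outer x \<or> outer (mate x))"
  have closed: "z \<in> {x, mate x}" if "y \<in> {x, mate x}" "{y, z} \<in> E" for y z
  proof -
    have y: "y \<in> \<Union>M" "\<not> outer y" using that x mate_in no by auto
    then have "z \<in> \<Union>M" using that V_cases edgeD unfolding outer_def by blast
    then have "z = mate y" using inner_edge y that by blast
    then show ?thesis using that x mate_mate by auto
  qed
  have "{x, mate x} = V"
    by (rule connected_graph_closed_subset[OF connected])
      (use M_subset x mate_in closed in blast)+
  moreover have "E = {{x, mate x}}"
  proof (intro equalityI subsetI)
    fix e assume "e \<in> E"
    then have "e \<subseteq> V" "card e = 2" using simple unfolding simple_graph_def by auto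
    moreover have "card {x, mate x} = 2" using mate(2)[OF x] by auto
    ultimately show "e \<in> {{x, mate x}}"
      using \<open>{x, mate x} = V\<close> card_subset_eq[of "{x, mate x}" e] by auto
  qed (use mate_edge x in auto)
  ultimately have "star V E"
    unfolding star_def using mate(2)[OF x] by (intro bexI[of _ x]) auto
  then show False using not_star by simp
qed

lemma V_eq: "V = A \<union> mate ` A \<union> U \<union> (\<Union>u\<in>U. T u)"
proof (intro equalityI subsetI)
  fix x assume "x \<in> V"
  show "x \<in> A \<union> mate ` A \<union> U \<union> (\<Union>u\<in>U. T u)"
  proof (cases "x \<in> U")
    case False
    then have x: "x \<in> \<Union>M" using V_cases \<open>x \<in> V\<close> by blast
    consider "outer x" "\<not> outer (mate x)" | "\<not> outer x" "outer (mate x)" | "outer x" "outer (mate x)"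
      using not_both_inner[OF x] by blast
    then show ?thesis
    proof cases
      case 1
      then show ?thesis using x unfolding A_def by blast
    next
      case 2
      then have "mate x \<in> A" using x mate_in mate_mate unfolding A_def by simp
      then show ?thesis using mate_mate[OF x] by force
    next
      case 3
      then show ?thesis using x unfolding T_def outer_def by blast
    qed
  qed simp
qed (use A_props T_props(1) M_subset U_subset in blast)

lemma V_elim:
  assumes "x \<in> V"
  obtains (core) "x \<in> A \<union> U" | (leaf) a where "a \<in> A" "x = mate a"
  | (triangle) u where "u \<in> U" "x \<in> T u"
  using assms V_eq by blast

text \<open>The vertices of \<open>U\<close> together with all leaves are one maximal independent set, and
  unmixedness transfers its size to all others.\<close>

lemma facet_card:
  assumes "F \<in> facets (independent_sets V E)"
  shows "card F = card A + card U"
proof -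
  let ?G = "U \<union> mate ` A"
  have ind: "{x, y} \<notin> E" if "x \<in> ?G" "y \<in> ?G" for x y
    by (rule U_leaves_independent[OF that])
  have "?G \<subseteq> V" using V_eq by blast
  then have G: "?G \<in> independent_sets V E"
    using ind unfolding independent_sets_def by simp
  have "?G \<in> facets (independent_sets V E)"
    unfolding facets_def
  proof (intro CollectI conjI G notI)
    assume "\<exists>\<tau>\<in>independent_sets V E. ?G \<subset> \<tau>"
    then obtain \<tau> x where t: "\<tau> \<in> independent_sets V E" "?G \<subset> \<tau>" "x \<in> \<tau>" "x \<notin> ?G" by blast
    then have "x \<in> V" unfolding independent_sets_def by auto
    then have "x \<in> A \<or> (\<exists>u\<in>U. x \<in> T u)" using V_eq t(4) by blast
    then obtain y where y: "y \<in> ?G" "{x, y} \<in> E"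
    proof
      assume "x \<in> A"
      then show thesis using that[of "mate x"] mate_edge[OF A_props(1)] by simp
    next
      assume "\<exists>u\<in>U. x \<in> T u"
      then obtain u where "u \<in> U" "x \<in> T u" by blast
      then show thesis using that[of u] T_props(3)[of u x] by simp
    qed
    have "{x, y} \<notin> E" using t y(1) unfolding independent_sets_def by blast
    then show False using y(2) by simp
  qed
  then have "card F = card ?G"
    using unmixed[unfolded unmixed_iff_facets[OF simple]] assms by blast
  also have "\<dots> = card U + card (mate ` A)"
    using finite_parts A_props(5) by (intro card_Un_disjoint) auto
  also have "card (mate ` A) = card A" using A_mate_inj by (rule card_image)
  finally show ?thesis by simp
qed

lemma independent_card_le:
  assumes "\<sigma> \<in> independent_sets V E"
  shows "card \<sigma> \<le> card A + card U"
proof -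
  obtain F where F: "F \<in> facets (independent_sets V E)" "\<sigma> \<subseteq> F"
    using obtain_facet[OF finite_independent_sets[OF finite_V] assms] by blast
  moreover have "finite F"
    using F finite_V finite_subset unfolding facets_def independent_sets_def by blast
  ultimately show ?thesis using facet_card card_mono by metis
qed

text \<open>With two triangles over \<open>u\<close>, trading \<open>u\<close> for one base vertex of each would give an
  independent set that is too large.\<close>

lemma at_most_one_triangle:
  assumes u: "u \<in> U" and x: "x \<in> T u" and y: "y \<in> T u"
  shows "y = x \<or> y = mate x"
proof (rule ccontr)
  assume no: "\<not> (y = x \<or> y = mate x)"
  let ?G = "(U - {u}) \<union> mate ` A \<union> {x, y}"
  have xy: "{x, y} \<notin> E" 
    using inner_edge[OF T_props(1)[OF u x] T_props(1)[OF u y]] no by blast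
  have TU: "{z, w} \<notin> E" if zw: "z \<in> {x, y}" "w \<in> U - {u} \<union> mate ` A" for z w
  proof
    assume e: "{z, w} \<in> E"
    have z: "z \<in> T u" using zw(1) x y by blast
    then have w: "w = u \<or> w = mate z" using T_edge[OF u z e] by simp
    show False
    proof (cases "w \<in> U")
      case True
      then have "w \<noteq> mate z" using T_props(4)[OF u T_props(2)[OF u z]] by auto
      then have "w = u" using w by simp
      then show ?thesis using zw(2) A_props(5) u by blast
    next
      case False
      then obtain a where "a \<in> A" "w = mate a" using zw(2) by blast
      then have "z = a" using mate_A_edge edge_sym[OF e] by blast
      then show ?thesis using T_props(5)[OF u z] \<open>a \<in> A\<close> by simp
    qed
  qed
  have GG: "{v, w} \<notin> E" if "v \<in> U - {u} \<union> mate ` A" "w \<in> U - {u} \<union> mate ` A" for v w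
    by (rule U_leaves_independent) (use that in blast)+
  have "{v, w} \<notin> E" if "v \<in> ?G" "w \<in> ?G" for v w
    using that
  proof (elim UnE)
    assume "v \<in> {x, y}" "w \<in> {x, y}"
    then show ?thesis using xy edge_sym edgeD by blast
  next
    assume "v \<in> {x, y}" "w \<in> U - {u}"
    then show ?thesis using TU by blast
  next
    assume "v \<in> {x, y}" "w \<in> mate ` A"
    then show ?thesis using TU by blast
  next
    assume "v \<in> U - {u}" "w \<in> {x, y}"
    then show ?thesis using TU[of w v] edge_sym[of v w] by blast
  next
    assume "v \<in> mate ` A" "w \<in> {x, y}"
    then show ?thesis using TU[of w v] edge_sym[of v w] by blast
  qed (use GG in blast)+
  moreover have "?G \<subseteq> V" using V_eq u x y by blast
  ultimately have "?G \<in> independent_sets V E"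
    unfolding independent_sets_def by simp
  then have "card ?G \<le> card A + card U" by (rule independent_card_le)
  moreover have "card ?G = card (U - {u} \<union> mate ` A) + card {x, y}"
  proof (rule card_Un_disjoint)
    show "(U - {u} \<union> mate ` A) \<inter> {x, y} = {}"
      using T_props(4,6)[OF u x] T_props(4,6)[OF u y] A_props(7) by auto
  qed (use finite_parts in auto)
  moreover have "card (U - {u} \<union> mate ` A) = card (U - {u}) + card (mate ` A)"
    using finite_parts A_props(5) by (intro card_Un_disjoint) auto
  moreover have "card (mate ` A) = card A" using A_mate_inj by (rule card_image)
  moreover have "card {x, y} = 2" using no by auto
  moreover have "Suc (card (U - {u})) = card U" using card_Suc_Diff1[OF finite_parts(1) u] .
  ultimately show False by simp
qed

text \<open>The retraction onto the bipartite part that collapses leaves and triangles. Its fibres are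
  cliques, which bounds independent sets, and it maps edges to edges or points, which shows that
  the bipartite part is connected.\<close>

definition "center x = (if x \<in> A \<union> U then x else if mate x \<in> A then mate x else THE u. u \<in> U \<and> x \<in> T u)"

lemma center_simps:
  "x \<in> A \<union> U \<Longrightarrow> center x = x" "a \<in> A \<Longrightarrow> center (mate a) = a"
  "u \<in> U \<Longrightarrow> x \<in> T u \<Longrightarrow> center x = u"
proof -
  show "x \<in> A \<union> U \<Longrightarrow> center x = x" unfolding center_def by simp
  show "a \<in> A \<Longrightarrow> center (mate a) = a" using A_props unfolding center_def by auto
  show "center x = u" if "u \<in> U" "x \<in> T u"
  proof -
    have "(THE u. u \<in> U \<and> x \<in> T u) = u"
      using that T_unique by blast
    then show ?thesis using T_props[OF that] unfolding center_def by auto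
  qed
qed

lemma center_in:
  assumes "x \<in> V"
  shows "center x \<in> A \<union> U"
  using assms by (cases rule: V_elim) (simp_all add: center_simps)

lemma center_fibre:
  assumes "x \<in> V"
  shows "(x = center x \<or> x = mate (center x)) \<and> center x \<in> A \<or>
    (x = center x \<or> x \<in> T (center x)) \<and> center x \<in> U"
  using assms by (cases rule: V_elim) (auto simp add: center_simps)

lemma same_center_adjacent:
  assumes "x \<in> V" "y \<in> V" "center x = center y" "x \<noteq> y"
  shows "{x, y} \<in> E"
proof -
  have AU: "A \<inter> U = {}" using A_props(4) by blast
  let ?c = "center x"
  consider "?c \<in> A" | "?c \<in> U" using center_in assms by blast
  then show ?thesis
  proof cases
    case 1
    then have "x = ?c \<or> x = mate ?c" "y = ?c \<or> y = mate ?c"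
      using center_fibre[OF assms(1)] center_fibre[OF assms(2)] assms(3) AU by force+
    then have "{x, y} = {?c, mate ?c}" using assms(4) by auto
    then show ?thesis using mate_edge A_props(1) 1 by simp
  next
    case 2
    then have *: "x = ?c \<or> x \<in> T ?c" "y = ?c \<or> y \<in> T ?c"
      using center_fibre[OF assms(1)] center_fibre[OF assms(2)] assms(3) AU by force+
    then consider "x = ?c" "y \<in> T ?c" | "y = ?c" "x \<in> T ?c" | "x \<in> T ?c" "y \<in> T ?c"
      using assms(4) by blast
    then show ?thesis
    proof cases
      case 1
      then show ?thesis using T_props(3) 2 edge_sym by metis
    next
      case c2: 2
      then show ?thesis using T_props(3) 2 by metis
    next
      case 3
      then have "y = mate x" using at_most_one_triangle 2 assms(4) by blast
      then show ?thesis using mate_edge T_props(1) 2 3 by blast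
    qed
  qed
qed

text \<open>A vertex \<open>u\<close> of \<open>U\<close> without triangle has a neighbour \<open>x \<in> A\<close>. A maximal
  independent set containing \<open>x\<close> misses \<open>u\<close>, which is a whole fibre of \<open>center\<close>,
  and is therefore too small.\<close>

lemma triangle_exists:
  assumes u: "u \<in> U"
  shows "T u \<noteq> {}"
proof
  assume none: "T u = {}"
  have "{u} \<noteq> V"
  proof
    assume V: "{u} = V"
    have "e \<notin> E" for e
    proof
      assume "e \<in> E"
      then have "e \<subseteq> {u}" "card e = 2" using simple V unfolding simple_graph_def by auto
      then show False using card_mono[of "{u}" e] by simp
    qed
    then have "E = {{u, v} | v. v \<in> V - {u}}" using V by blast
    then show False using not_star V unfolding star_def by blast
  qed
  then obtain x where "{u, x} \<in> E"
    using connected_graph_closed_subset[OF connected, of "{u}"] u U_subset by blast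
  then have xA: "{x, u} \<in> E" "x \<in> A" using U_edge[OF u] none edge_sym by blast+
  then have "{x} \<subseteq> V" "{x, x} \<notin> E" using edgeD by blast+
  then have "{x} \<in> independent_sets V E"
    unfolding independent_sets_def by simp
  then obtain F where F: "F \<in> facets (independent_sets V E)" "{x} \<subseteq> F"
    using obtain_facet[OF finite_independent_sets[OF finite_V]] by blast
  have FV: "F \<subseteq> V" "\<And>v w. v \<in> F \<Longrightarrow> w \<in> F \<Longrightarrow> {v, w} \<notin> E"
    using F unfolding facets_def independent_sets_def by auto
  have "inj_on center F"
    using same_center_adjacent FV unfolding inj_on_def by blast
  moreover have "center ` F \<subseteq> A \<union> (U - {u})"
  proof
    fix c assume "c \<in> center ` F"
    then obtain v where v: "v \<in> F" "c = center v" by blast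
    have "c \<in> A \<union> U" using v FV center_in by blast
    moreover have "c \<noteq> u"
    proof
      assume "c = u"
      then have "v = u"
        using center_fibre[of v] v FV(1) none A_props(4) u by auto
      then show False using FV(2)[of x v] F(2) v xA by blast
    qed
    ultimately show "c \<in> A \<union> (U - {u})" by blast
  qed
  ultimately have "card F \<le> card (A \<union> (U - {u}))"
    using finite_parts card_inj_on_le[of center F] by blast
  also have "\<dots> \<le> card A + card (U - {u})" by (rule card_Un_le)
  also have "\<dots> < card A + card U" using card_Suc_Diff1[OF finite_parts(1) u] by simp
  finally show False using facet_card[OF F(1)] by simp
qed

lemma U_nonempty: "U \<noteq> {}"
proof
  assume "U = {}"
  then have "V = {}" using V_eq unfolding A_def outer_def by blast
  then show False using connected unfolding connected_graph_def by simp
qed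

text \<open>Otherwise connectedness leaves nothing but the one triangle over a vertex of \<open>U\<close>, which is
  a star triangle.\<close>

lemma A_nonempty: "A \<noteq> {}"
proof
  assume A: "A = {}"
  obtain u where u: "u \<in> U" using U_nonempty by blast
  obtain x where x: "x \<in> T u" using triangle_exists[OF u] by blast
  let ?y = "mate x"
  have y: "?y \<in> T u" using T_props u x by blast
  have Tu: "T u = {x, ?y}" using at_most_one_triangle[OF u x] x y by blast
  have mm: "mate ?y = x" using mate_mate T_props(1) u x by blast
  have V: "{u, x, ?y} = V"
  proof (rule connected_graph_closed_subset[OF connected])
    show "{u, x, ?y} \<subseteq> V" using V_eq u x y by blast
    fix v w assume "v \<in> {u, x, ?y}" "{v, w} \<in> E"
    then show "w \<in> {u, x, ?y}"
      using U_edge[OF u, of w] A Tu T_edge[OF u x, of w] T_edge[OF u y, of w] mm edge_sym by blast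
  qed simp
  have ux: "u \<noteq> x" "u \<noteq> ?y" "x \<noteq> ?y" using T_props(4) u x y mate(2) T_props(1) by metis+
  have e: "{x, ?y} \<in> E" "{u, x} \<in> E" "{u, ?y} \<in> E"
    using mate_edge T_props(1,3) u x y edge_sym by blast+
  have "E = {{x, ?y}, {u, x}, {u, ?y}}"
  proof (intro equalityI subsetI)
    fix f assume f: "f \<in> E"
    then obtain a b where ab: "f = {a, b}" "a \<noteq> b"
      using simple unfolding simple_graph_def by (metis card_2_iff)
    then have "a \<in> {u, x, ?y}" "b \<in> {u, x, ?y}" using edgeD f V by blast+
    then show "f \<in> {{x, ?y}, {u, x}, {u, ?y}}" using ab by auto
  qed (use e in auto)
  then have "star_triangle V E"
    unfolding star_triangle_def using V ux
    by (intro bexI[of _ u] exI[of _ "{{x, ?y}}"]) auto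
  then show False using not_star_triangle by simp
qed

text \<open>The witnesses are the leaf edges for \<open>l = mate\<close> and, for each \<open>u \<in> U\<close>, the two
  vertices of \<open>T u\<close>.\<close>

lemma bipartite_structure: "bipartite_with_leaves_and_triangles V E"
proof -
  define p where "p u = (SOME x. x \<in> T u)" for u
  define q where "q u = mate (p u)" for u
  define F where "F = {{a, u} | a u. a \<in> A \<and> u \<in> U \<and> {a, u} \<in> E}"
  have pT: "p u \<in> T u" if "u \<in> U" for u
    using triangle_exists[OF that] unfolding p_def by (simp add: some_in_eq)
  then have qT: "q u \<in> T u" if "u \<in> U" for u
    using T_props(2) that unfolding q_def by blast
  have Tpq: "T u = {p u, q u}" if "u \<in> U" for u
    using at_most_one_triangle[OF that pT[OF that]] pT qT that unfolding q_def by blast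
  have V: "V = A \<union> U \<union> mate ` A \<union> p ` U \<union> q ` U"
    using V_eq Tpq by auto
  have FE: "F \<subseteq> E" unfolding F_def by blast
  have con: "connected_graph (A \<union> U) F"
    unfolding connected_graph_def
  proof (intro conjI ballI)
    show "A \<union> U \<noteq> {}" using U_nonempty by blast
    \<comment> \<open>the retraction turns walks of the whole graph into walks of the bipartite part\<close>
    have step: "(center x, center y) \<in> {(x, y). {x, y} \<in> F}\<^sup>*" if e: "{x, y} \<in> E" for x y
    proof (cases "x \<in> A \<union> U \<and> y \<in> A \<union> U")
      case True
      have "\<not> (x \<in> A \<and> y \<in> A)" using inner_edge[OF _ _ e] A_props(1,6) by blast
      then have "x \<in> A \<and> y \<in> U \<or> x \<in> U \<and> y \<in> A" using True U_independent e by blast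
      then have "{x, y} \<in> F"
      proof
        assume "x \<in> U \<and> y \<in> A"
        then have "{y, x} \<in> F" unfolding F_def using edge_sym[OF e] by blast
        then show ?thesis by (simp add: insert_commute)
      qed (use e in \<open>auto simp: F_def\<close>)
      then show ?thesis using center_simps(1) True by auto
    next
      case False
      have "center x = center y" if e: "{x, y} \<in> E" and x: "x \<notin> A \<union> U" for x y
      proof -
        have "x \<in> mate ` A \<or> (\<exists>u\<in>U. x \<in> T u)" using V_eq edgeD[OF e] x by blast
        then show ?thesis
        proof
          assume "x \<in> mate ` A"
          then obtain a where "a \<in> A" "x = mate a" by blast
          then show ?thesis using mate_A_edge e center_simps by (metis UnI1)
        next
          assume "\<exists>u\<in>U. x \<in> T u"
          then obtain u where u: "u \<in> U" "x \<in> T u" by blast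
          then have "y = u \<or> y \<in> T u" using T_edge[OF u e] T_props(2)[OF u] by blast
          then show ?thesis using u center_simps by (metis UnI2)
        qed
      qed
      then have "center x = center y" using False e edge_sym by metis
      then show ?thesis by simp
    qed
    have path: "(center x, center y) \<in> {(x, y). {x, y} \<in> F}\<^sup>*"
      if "(x, y) \<in> {(x, y). {x, y} \<in> E}\<^sup>*" for x y
      using that
    proof induction
      case (step y z)
      then show ?case using \<open>\<And>x y. {x, y} \<in> E \<Longrightarrow> (center x, center y) \<in> _\<close> by (auto intro: rtrancl_trans)
    qed simp
    fix x y assume xy: "x \<in> A \<union> U" "y \<in> A \<union> U"
    then have "(x, y) \<in> {(x, y). {x, y} \<in> E}\<^sup>*"
      using connected V_eq unfolding connected_graph_def by blast
    then show "(x, y) \<in> {(x, y). {x, y} \<in> F}\<^sup>*"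
      using path center_simps(1) xy by metis
  qed
  have E: "E = F \<union> (\<Union>i\<in>A. {{i, mate i}}) \<union> (\<Union>j\<in>U. {{j, p j}, {j, q j}, {p j, q j}})" (is "_ = ?E")
  proof (intro equalityI subsetI)
    fix e assume e: "e \<in> E"
    then obtain x y where xy: "e = {x, y}"
      using simple unfolding simple_graph_def by (metis card_2_iff)
    have T: "{x, y} \<in> ?E" if "u \<in> U" "x \<in> T u" "{x, y} \<in> E" for u x y
    proof -
      have "mate (q u) = p u" using mate_mate T_props(1) pT that(1) unfolding q_def by blast
      then have "y = u \<or> x = p u \<and> y = q u \<or> x = q u \<and> y = p u"
        using T_edge[OF that] Tpq[OF that(1)] that(2) unfolding q_def by auto
      then have "{x, y} \<in> {{u, p u}, {u, q u}, {p u, q u}}"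
        using Tpq[OF that(1)] that(2) by (auto simp: insert_commute)
      then show ?thesis using that(1) by blast
    qed
    have L: "{x, y} \<in> ?E" if "x \<in> mate ` A" "{x, y} \<in> E" for x y
    proof -
      obtain a where a: "a \<in> A" "x = mate a" using \<open>x \<in> mate ` A\<close> by blast
      then have "{x, y} = {a, mate a}" using mate_A_edge that by blast
      then show ?thesis using a(1) by blast
    qed
    have B: "{x, y} \<in> ?E" if "x \<in> A" "{x, y} \<in> E" "y \<notin> mate ` A" for x y
    proof -
      have "y \<notin> \<Union>M" using inner_edge[OF _ _ that(2)] A_props(1) that by blast
      then have "y \<in> U" using V_cases edgeD[OF that(2)] by blast
      then show ?thesis unfolding F_def using that by blast
    qed
    have comm: "{y, x} = {x, y}" by auto
    have xV: "x \<in> V" "y \<in> V" "{x, y} \<in> E" "{y, x} \<in> E" using edgeD e xy comm by auto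
    show "e \<in> ?E"
    proof (cases "x \<in> mate ` A \<or> y \<in> mate ` A \<or> (\<exists>u\<in>U. x \<in> T u) \<or> (\<exists>u\<in>U. y \<in> T u)")
      case True
      then have "{x, y} \<in> ?E \<or> {y, x} \<in> ?E" using T L xV(3,4) by meson
      then show ?thesis unfolding xy comm by simp
    next
      case False
      then have "x \<in> A \<union> U" "y \<in> A \<union> U" using V_eq xV by blast+
      then have "x \<in> A \<or> y \<in> A" using U_independent xV by blast
      then show ?thesis using B[of x y] B[of y x] xV False unfolding xy comm by blast
    qed
  next
    fix e assume "e \<in> ?E"
    then consider "e \<in> F" | i where "i \<in> A" "e = {i, mate i}" |
      j where "j \<in> U" "e = {j, p j} \<or> e = {j, q j} \<or> e = {p j, q j}" by blast
    then show "e \<in> E"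
    proof cases
      case 3
      have "{j, p j} \<in> E" "{j, q j} \<in> E"
        using T_props(3)[OF 3(1) pT[OF 3(1)]] T_props(3)[OF 3(1) qT[OF 3(1)]] edge_sym by blast+
      moreover have "{p j, q j} \<in> E"
        using mate_edge T_props(1)[OF 3(1) pT[OF 3(1)]] unfolding q_def by blast
      ultimately show ?thesis using 3(2) by blast
    qed (use FE mate_edge A_props(1) in blast)+
  qed
  have inj: "inj_on p U" "inj_on q U"
    using T_unique pT qT unfolding inj_on_def by metis+
  have pq: "p u \<noteq> q v" if "u \<in> U" "v \<in> U" for u v
  proof
    assume eq: "p u = q v"
    then have "u = v" using T_unique pT qT that by metis
    then show False using eq mate(2) T_props(1) pT that unfolding q_def by metis
  qed
  have TA: "x \<notin> A \<union> U \<union> mate ` A" if "u \<in> U" "x \<in> T u" for u x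
    using T_props(4,5,6)[OF that] A_props(7) by auto
  show ?thesis
    unfolding bipartite_with_leaves_and_triangles_def
  proof (rule exI[of _ A], rule exI[of _ U], rule exI[of _ F], rule exI[of _ mate],
      rule exI[of _ p], rule exI[of _ q], intro conjI)
    show "A \<noteq> {}" "U \<noteq> {}" by (rule A_nonempty U_nonempty)+
    show "bipartite_graph A U F" unfolding bipartite_graph_def F_def using A_props(4) by blast
    have new: "x \<notin> A \<union> U \<union> mate ` A" if x: "x \<in> p ` U \<union> q ` U" for x
    proof -
      obtain u where "u \<in> U" "x = p u \<or> x = q u" using x by blast
      then show ?thesis using TA[OF _ pT] TA[OF _ qT] by metis
    qed
    have "x \<notin> A \<union> U" if "x \<in> mate ` A" for x using that A_props(5,6) by blast
    then show "(A \<union> U) \<inter> (mate ` A \<union> p ` U \<union> q ` U) = {}"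
      using new by blast
    show "mate ` A \<inter> (p ` U \<union> q ` U) = {}" using new by blast
    show "p ` U \<inter> q ` U = {}" using pq by blast
  qed (rule con inj A_mate_inj V E)+
qed

end

lemma unmixed_cameron_walker_bipartite_structure:
  assumes "cameron_walker V E" "unmixed V E"
  shows "bipartite_with_leaves_and_triangles V E"
proof -
  have cw: "simple_graph V E" "connected_graph V E" "induced_matching_number E = matching_number E"
    "\<not> star V E" "\<not> star_triangle V E"
    using assms(1) unfolding cameron_walker_def by auto
  obtain M where "induced_matching E M" "\<And>M'. matching E M' \<Longrightarrow> card M' \<le> card M"
    using obtain_induced_maximum_matching[OF cw(1,3)] by blast
  then interpret unmixed_cameron_walker V E M
    using cw assms(2) by unfold_locales auto
  show ?thesis by (rule bipartite_structure)
qed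

section \<open>Exponent vectors\<close>

text \<open>The lexicographically largest elements of \<open>A\<close> and \<open>B\<close> have this property. It
  replaces the use of leading terms: the corresponding coefficient of a product of two polynomials
  is a product of coefficients.\<close>

lemma sums_with_unique_representation:
  fixes A B :: "('i \<Rightarrow> nat) set"
  assumes "finite U" "finite A" "finite B" "A \<noteq> {}" "B \<noteq> {}"
    and "\<And>a a' i. a \<in> A \<Longrightarrow> a' \<in> A \<Longrightarrow> i \<notin> U \<Longrightarrow> a i = a' i"
    and "\<And>b b' i. b \<in> B \<Longrightarrow> b' \<in> B \<Longrightarrow> i \<notin> U \<Longrightarrow> b i = b' i"
  shows "\<exists>a\<in>A. \<exists>b\<in>B. \<forall>a'\<in>A. \<forall>b'\<in>B. (\<forall>i. a' i + b' i = a i + b i) \<longrightarrow> a' = a \<and> b' = b"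
  using assms
proof (induction U arbitrary: A B rule: finite_induct)
  case empty
  then have "\<And>a a'. a \<in> A \<Longrightarrow> a' \<in> A \<Longrightarrow> a = a'" "\<And>b b'. b \<in> B \<Longrightarrow> b' \<in> B \<Longrightarrow> b = b'"
    by (auto intro!: ext)
  then show ?case using empty.prems(3,4) by blast
next
  case (insert u U)
  define p where "p = Max ((\<lambda>a. a u) ` A)"
  define q where "q = Max ((\<lambda>b. b u) ` B)"
  let ?A = "{a \<in> A. a u = p}" and ?B = "{b \<in> B. b u = q}"
  have p: "p \<in> (\<lambda>a. a u) ` A" "\<And>a. a \<in> A \<Longrightarrow> a u \<le> p"
    unfolding p_def using insert.prems by (auto intro!: Max_in)
  have q: "q \<in> (\<lambda>b. b u) ` B" "\<And>b. b \<in> B \<Longrightarrow> b u \<le> q"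
    unfolding q_def using insert.prems by (auto intro!: Max_in)
  have "\<exists>a\<in>?A. \<exists>b\<in>?B. \<forall>a'\<in>?A. \<forall>b'\<in>?B. (\<forall>i. a' i + b' i = a i + b i) \<longrightarrow> a' = a \<and> b' = b"
  proof (rule insert.IH)
    show "finite ?A" "finite ?B" using insert.prems by auto
    show "?A \<noteq> {}" "?B \<noteq> {}" using p(1) q(1) by auto
    show "a i = a' i" if "a \<in> ?A" "a' \<in> ?A" "i \<notin> U" for a a' i
      using that insert.prems(5)[of a a' i] by (cases "i = u") auto
    show "b i = b' i" if "b \<in> ?B" "b' \<in> ?B" "i \<notin> U" for b b' i
      using that insert.prems(6)[of b b' i] by (cases "i = u") auto
  qed
  then obtain a b where ab: "a \<in> ?A" "b \<in> ?B"
    "\<forall>a'\<in>?A. \<forall>b'\<in>?B. (\<forall>i. a' i + b' i = a i + b i) \<longrightarrow> a' = a \<and> b' = b" by blast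
  have "a' = a \<and> b' = b" if "a' \<in> A" "b' \<in> B" and eq: "\<forall>i. a' i + b' i = a i + b i" for a' b'
  proof -
    have "a' u + b' u = p + q" using eq ab(1,2) by simp
    then have "a' u = p" "b' u = q" using p(2)[OF that(1)] q(2)[OF that(2)] by auto
    then show ?thesis using ab(3) that by blast
  qed
  then show ?case using ab(1,2) by blast
qed

definition exponents :: "nat \<Rightarrow> nat \<Rightarrow> (nat \<Rightarrow> nat) set" where
  "exponents r k = {a. (\<forall>i\<ge>r. a i = 0) \<and> sum a {..<r} = k}"

definition monomial :: "(nat \<Rightarrow> 'b::comm_ring_1) \<Rightarrow> nat \<Rightarrow> (nat \<Rightarrow> nat) \<Rightarrow> 'b" where
  "monomial f r a = (\<Prod>i<r. f i ^ a i)"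

lemma finite_exponents: "finite (exponents r k)"
proof (rule finite_subset)
  show "exponents r k \<subseteq> {a. \<forall>i. (i \<in> {..<r} \<longrightarrow> a i \<in> {..k}) \<and> (i \<notin> {..<r} \<longrightarrow> a i = 0)}"
  proof
    fix a assume a: "a \<in> exponents r k"
    have "a i \<le> k" if "i < r" for i
      using a member_le_sum[of i "{..<r}" a] that unfolding exponents_def by auto
    then show "a \<in> {a. \<forall>i. (i \<in> {..<r} \<longrightarrow> a i \<in> {..k}) \<and> (i \<notin> {..<r} \<longrightarrow> a i = 0)}"
      using a unfolding exponents_def by auto
  qed
  show "finite {a. \<forall>i. (i \<in> {..<r} \<longrightarrow> a i \<in> {..k}) \<and> (i \<notin> {..<r} \<longrightarrow> a i = (0::nat))}"
    by (rule finite_set_of_finite_funs) auto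
qed

lemma exponents_zero: "exponents r 0 = {\<lambda>_. 0}"
  unfolding exponents_def by (auto intro!: ext) (metis lessThan_iff not_le)

lemma monomial_add: "monomial f r (\<lambda>i. a i + b i) = monomial f r a * monomial f r b"
  unfolding monomial_def by (simp add: power_add prod.distrib)

lemma monomial_zero [simp]: "monomial f r (\<lambda>_. 0) = 1"
  unfolding monomial_def by simp

lemma monomial_incr: "i < r \<Longrightarrow> monomial f r (a(i := Suc (a i))) = f i * monomial f r a"
proof -
  assume i: "i < r"
  have "(\<lambda>j. a j + (if j = i then 1 else 0)) = a(i := Suc (a i))" by auto
  then have "monomial f r (a(i := Suc (a i))) = monomial f r a * monomial f r (\<lambda>j. if j = i then 1 else 0)"
    using monomial_add[of f r a "\<lambda>j. if j = i then 1 else 0"] by (simp only:)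
  also have "monomial f r (\<lambda>j. if j = i then 1 else 0) = (\<Prod>j<r. if j = i then f i else 1)"
    unfolding monomial_def by (rule prod.cong) auto
  also have "\<dots> = f i" using i by (simp add: prod.delta)
  finally show ?thesis by (simp only: mult.commute)
qed

lemma exponents_incr: "i < r \<Longrightarrow> a \<in> exponents r k \<Longrightarrow> a(i := Suc (a i)) \<in> exponents r (Suc k)"
proof -
  assume i: "i < r" and a: "a \<in> exponents r k"
  have "sum (a(i := Suc (a i))) {..<r} = Suc (a i) + sum (a(i := Suc (a i))) ({..<r} - {i})"
    using i by (subst sum.remove[of _ i]) auto
  also have "sum (a(i := Suc (a i))) ({..<r} - {i}) = sum a ({..<r} - {i})"
    by (rule sum.cong) auto
  also have "Suc (a i) + \<dots> = Suc (sum a {..<r})"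
    using i by (subst sum.remove[of "{..<r}" i a]) auto
  finally show ?thesis using a i unfolding exponents_def by auto
qed

lemma exponents_Suc_decr:
  assumes "a \<in> exponents r (Suc k)"
  obtains i b where "i < r" "b \<in> exponents r k" "a = b(i := Suc (b i))"
proof -
  have "sum a {..<r} \<noteq> 0" using assms unfolding exponents_def by auto
  then obtain i where i: "i < r" "a i \<noteq> 0" by (metis lessThan_iff sum.neutral)
  let ?b = "a(i := a i - 1)"
  have "sum ?b {..<r} = (a i - 1) + sum ?b ({..<r} - {i})"
    using i by (subst sum.remove[of _ i]) auto
  moreover have "sum ?b ({..<r} - {i}) = sum a ({..<r} - {i})"
    by (rule sum.cong) auto
  moreover have "sum a {..<r} = a i + sum a ({..<r} - {i})"
    using i by (subst sum.remove[of _ i]) auto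
  ultimately have "?b \<in> exponents r k" using assms i unfolding exponents_def by auto
  moreover have "a = ?b(i := Suc (?b i))" using i by auto
  ultimately show ?thesis using i(1) that by blast
qed

lemma exponents_add: "a \<in> exponents r k \<Longrightarrow> b \<in> exponents r l \<Longrightarrow> (\<lambda>i. a i + b i) \<in> exponents r (k + l)"
  unfolding exponents_def by (auto simp: sum.distrib)

lemma exponents_Suc_Suc:
  "exponents (Suc r) (Suc k) =
    exponents r (Suc k) \<union> (\<lambda>b. b(r := Suc (b r))) ` exponents (Suc r) k"
proof (intro equalityI subsetI)
  fix a assume a: "a \<in> exponents (Suc r) (Suc k)"
  show "a \<in> exponents r (Suc k) \<union> (\<lambda>b. b(r := Suc (b r))) ` exponents (Suc r) k"
  proof (cases "a r = 0")
    case True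
    then have "a \<in> exponents r (Suc k)"
      using a unfolding exponents_def by (auto simp: le_less) (metis Suc_lessI)
    then show ?thesis by simp
  next
    case False
    let ?b = "a(r := a r - 1)"
    have "sum ?b {..<r} = sum a {..<r}" by (rule sum.cong) auto
    then have "?b \<in> exponents (Suc r) k"
      using a False unfolding exponents_def by auto
    moreover have "a = ?b(r := Suc (?b r))" using False by auto
    ultimately show ?thesis by blast
  qed
next
  fix a assume "a \<in> exponents r (Suc k) \<union> (\<lambda>b. b(r := Suc (b r))) ` exponents (Suc r) k"
  then show "a \<in> exponents (Suc r) (Suc k)"
  proof
    assume "a \<in> (\<lambda>b. b(r := Suc (b r))) ` exponents (Suc r) k"
    then show ?thesis using exponents_incr[of r "Suc r"] by auto
  qed (auto simp: exponents_def)
qed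

text \<open>A form in \<open>r + 1\<close> unknowns is the sum of a form in the first \<open>r\<close> of them and a
  multiple of the last one.\<close>

lemma sum_exponents_Suc_Suc:
  "(\<Sum>a\<in>exponents (Suc r) (Suc k). g a * monomial f (Suc r) a) =
    (\<Sum>a\<in>exponents r (Suc k). g a * monomial f r a) +
    f r * (\<Sum>b\<in>exponents (Suc r) k. g (b(r := Suc (b r))) * monomial f (Suc r) b)"
proof -
  let ?inc = "\<lambda>b::nat \<Rightarrow> nat. b(r := Suc (b r))"
  have inj: "inj_on ?inc (exponents (Suc r) k)"
  proof (rule inj_onI)
    fix b c assume eq: "?inc b = ?inc c"
    have "b i = c i" for i using fun_cong[OF eq, of i] by (cases "i = r") auto
    then show "b = c" by blast
  qed
  have disj: "exponents r (Suc k) \<inter> ?inc ` exponents (Suc r) k = {}"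
    unfolding exponents_def by (auto dest: spec[of _ r])
  have "(\<Sum>a\<in>exponents (Suc r) (Suc k). g a * monomial f (Suc r) a) =
    (\<Sum>a\<in>exponents r (Suc k). g a * monomial f (Suc r) a) +
    (\<Sum>a\<in>?inc ` exponents (Suc r) k. g a * monomial f (Suc r) a)"
    unfolding exponents_Suc_Suc by (rule sum.union_disjoint) (use disj finite_exponents in auto)
  also have "(\<Sum>a\<in>exponents r (Suc k). g a * monomial f (Suc r) a) =
      (\<Sum>a\<in>exponents r (Suc k). g a * monomial f r a)"
    by (rule sum.cong) (auto simp: monomial_def exponents_def)
  also have "(\<Sum>a\<in>?inc ` exponents (Suc r) k. g a * monomial f (Suc r) a) =
      (\<Sum>b\<in>exponents (Suc r) k. g (?inc b) * monomial f (Suc r) (?inc b))"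
    using sum.reindex[OF inj] by simp
  also have "\<dots> = f r * (\<Sum>b\<in>exponents (Suc r) k. g (?inc b) * monomial f (Suc r) b)"
    unfolding sum_distrib_left by (rule sum.cong) (simp_all add: monomial_incr mult.left_commute)
  finally show ?thesis .
qed


section \<open>Ideals and regular sequences\<close>

text \<open>The polynomials in the variables from \<open>V\<close> are a subring of a type of class
  \<open>comm_ring_1\<close>. Treating ideals of such a subring as plain subsets keeps the algebra of the
  type class, sums in particular, available.\<close>

locale subring_of =
  fixes C :: "'b::comm_ring_1 set"
  assumes zero_closed: "0 \<in> C" and one_closed: "1 \<in> C" and minus_one_closed: "-1 \<in> C"
    and add_closed: "\<And>x y. x \<in> C \<Longrightarrow> y \<in> C \<Longrightarrow> x + y \<in> C"
    and mult_closed: "\<And>x y. x \<in> C \<Longrightarrow> y \<in> C \<Longrightarrow> x * y \<in> C"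
begin

lemma sum_closed: "(\<And>i. i \<in> T \<Longrightarrow> g i \<in> C) \<Longrightarrow> sum g T \<in> C"
  by (induction T rule: infinite_finite_induct) (auto intro: zero_closed add_closed)

lemma power_closed: "x \<in> C \<Longrightarrow> x ^ n \<in> C"
  by (induction n) (auto intro: one_closed mult_closed)

lemma prod_closed: "(\<And>i. i \<in> T \<Longrightarrow> g i \<in> C) \<Longrightarrow> prod g T \<in> C"
  by (induction T rule: infinite_finite_induct) (auto intro: one_closed mult_closed)

lemma monomial_closed: "(\<And>i. f i \<in> C) \<Longrightarrow> monomial f r a \<in> C"
  unfolding monomial_def by (intro prod_closed power_closed)

definition is_ideal :: "'b set \<Rightarrow> bool" where
  "is_ideal I \<longleftrightarrow> I \<subseteq> C \<and> 0 \<in> I \<and> (\<forall>x\<in>I. \<forall>y\<in>I. x + y \<in> I) \<and> (\<forall>c\<in>C. \<forall>x\<in>I. c * x \<in> I)"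

lemma ideal_closed: "is_ideal I \<Longrightarrow> x \<in> I \<Longrightarrow> x \<in> C"
  and ideal_zero: "is_ideal I \<Longrightarrow> 0 \<in> I"
  and ideal_add: "is_ideal I \<Longrightarrow> x \<in> I \<Longrightarrow> y \<in> I \<Longrightarrow> x + y \<in> I"
  and ideal_mult: "is_ideal I \<Longrightarrow> c \<in> C \<Longrightarrow> x \<in> I \<Longrightarrow> c * x \<in> I"
  unfolding is_ideal_def by auto

lemma ideal_mult': "is_ideal I \<Longrightarrow> c \<in> C \<Longrightarrow> x \<in> I \<Longrightarrow> x * c \<in> I"
  using ideal_mult[of I c x] by (simp add: mult.commute)

lemma ideal_uminus: "is_ideal I \<Longrightarrow> x \<in> I \<Longrightarrow> - x \<in> I"
  using ideal_mult[of I "-1" x] minus_one_closed by simp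

lemma ideal_diff: "is_ideal I \<Longrightarrow> x \<in> I \<Longrightarrow> y \<in> I \<Longrightarrow> x - y \<in> I"
  using ideal_add[of I x "-y"] ideal_uminus[of I y] by simp

lemma ideal_sum: "is_ideal I \<Longrightarrow> (\<And>i. i \<in> T \<Longrightarrow> g i \<in> I) \<Longrightarrow> sum g T \<in> I"
  by (induction T rule: infinite_finite_induct) (auto intro: ideal_zero ideal_add)

lemma ideal_add_cancel: "is_ideal I \<Longrightarrow> y \<in> I \<Longrightarrow> x + y \<in> I \<Longrightarrow> x \<in> I"
  using ideal_diff[of I "x + y" y] by simp

lemma uminus_closed: "x \<in> C \<Longrightarrow> - x \<in> C"
  using mult_closed[OF minus_one_closed, of x] by simp

lemma diff_closed: "x \<in> C \<Longrightarrow> y \<in> C \<Longrightarrow> x - y \<in> C"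
  using add_closed[of x "-y"] uminus_closed[of y] by simp

lemma is_ideal_carrier: "is_ideal C"
  unfolding is_ideal_def by (auto intro: zero_closed add_closed mult_closed)

definition adjoin :: "'b set \<Rightarrow> 'b \<Rightarrow> 'b set" where
  "adjoin I f = {j + f * c | j c. j \<in> I \<and> c \<in> C}"

definition colon :: "'b set \<Rightarrow> 'b \<Rightarrow> 'b set" where
  "colon I x = {r \<in> C. x * r \<in> I}"

lemma is_ideal_adjoin:
  assumes I: "is_ideal I" and f: "f \<in> C"
  shows "is_ideal (adjoin I f)"
  unfolding is_ideal_def
proof (intro conjI ballI subsetI)
  fix x assume "x \<in> adjoin I f"
  then show "x \<in> C" using ideal_closed[OF I] f unfolding adjoin_def by (auto intro: add_closed mult_closed)
next
  show "0 \<in> adjoin I f" using ideal_zero[OF I] zero_closed unfolding adjoin_def by force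
next
  fix x y assume "x \<in> adjoin I f" "y \<in> adjoin I f"
  then obtain j c j' c' where "j \<in> I" "c \<in> C" "j' \<in> I" "c' \<in> C" "x = j + f * c" "y = j' + f * c'"
    unfolding adjoin_def by blast
  then have "x + y = (j + j') + f * (c + c')" "j + j' \<in> I" "c + c' \<in> C"
    using ideal_add[OF I] add_closed by (simp_all add: algebra_simps)
  then show "x + y \<in> adjoin I f" unfolding adjoin_def by blast
next
  fix d x assume "d \<in> C" "x \<in> adjoin I f"
  then obtain j c where "j \<in> I" "c \<in> C" "x = j + f * c"
    unfolding adjoin_def by blast
  then have "d * x = d * j + f * (d * c)" "d * j \<in> I" "d * c \<in> C"
    using ideal_mult[OF I] mult_closed \<open>d \<in> C\<close> by (simp_all add: algebra_simps)
  then show "d * x \<in> adjoin I f" unfolding adjoin_def by blast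
qed

lemma adjoin_superset: "is_ideal I \<Longrightarrow> I \<subseteq> adjoin I f"
  using zero_closed unfolding adjoin_def by force

lemma adjoin_mem: "is_ideal I \<Longrightarrow> c \<in> C \<Longrightarrow> f * c \<in> adjoin I f"
  using ideal_zero unfolding adjoin_def by force

lemma adjoin_minimal: "is_ideal I \<Longrightarrow> is_ideal J \<Longrightarrow> I \<subseteq> J \<Longrightarrow> f \<in> J \<Longrightarrow> adjoin I f \<subseteq> J"
  unfolding adjoin_def by (auto intro: ideal_add ideal_mult')

lemma adjoin_commute: "adjoin (adjoin I f) g = adjoin (adjoin I g) f"
proof -
  have "adjoin (adjoin I f) g \<subseteq> adjoin (adjoin I g) f" for f g
  proof
    fix x assume "x \<in> adjoin (adjoin I f) g"
    then obtain j c d where "j \<in> I" "c \<in> C" "d \<in> C" "x = j + f * c + g * d" unfolding adjoin_def by blast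
    then have "x = (j + g * d) + f * c" "j + g * d \<in> adjoin I g" unfolding adjoin_def by auto
    then show "x \<in> adjoin (adjoin I g) f" using \<open>c \<in> C\<close> unfolding adjoin_def by blast
  qed
  then show ?thesis by blast
qed

lemma is_ideal_colon:
  assumes I: "is_ideal I" and x: "x \<in> C"
  shows "is_ideal (colon I x)"
  unfolding is_ideal_def
proof (intro conjI ballI)
  show "colon I x \<subseteq> C" "0 \<in> colon I x"
    using ideal_zero[OF I] zero_closed unfolding colon_def by auto
next
  fix y z assume "y \<in> colon I x" "z \<in> colon I x"
  then show "y + z \<in> colon I x"
    using ideal_add[OF I] add_closed unfolding colon_def by (simp add: distrib_left)
next
  fix c y assume "c \<in> C" "y \<in> colon I x"
  then show "c * y \<in> colon I x"
    using ideal_mult[OF I, of c "x * y"] mult_closed unfolding colon_def by (simp add: mult.left_commute)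
qed

primrec adjoin_upto :: "'b set \<Rightarrow> (nat \<Rightarrow> 'b) \<Rightarrow> nat \<Rightarrow> 'b set" where
  "adjoin_upto I f 0 = I"
| "adjoin_upto I f (Suc r) = adjoin (adjoin_upto I f r) (f r)"

text \<open>Regularity of \<open>f 0, \<dots>, f (r - 1)\<close> on the quotient by \<open>I\<close>, without the requirement
  that the sequence generates a proper ideal.\<close>

definition regular :: "'b set \<Rightarrow> (nat \<Rightarrow> 'b) \<Rightarrow> nat \<Rightarrow> bool" where
  "regular I f r \<longleftrightarrow> (\<forall>i<r. \<forall>x\<in>C. f i * x \<in> adjoin_upto I f i \<longrightarrow> x \<in> adjoin_upto I f i)"

lemma is_ideal_adjoin_upto: "is_ideal I \<Longrightarrow> (\<And>i. f i \<in> C) \<Longrightarrow> is_ideal (adjoin_upto I f r)"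
  by (induction r) (auto intro: is_ideal_adjoin)

lemma adjoin_upto_superset:
  assumes "is_ideal I" "\<And>i. f i \<in> C"
  shows "I \<subseteq> adjoin_upto I f r"
proof (induction r)
  case (Suc r)
  then show ?case using adjoin_superset[OF is_ideal_adjoin_upto[OF assms]] by fastforce
qed simp

lemma adjoin_upto_mem: "is_ideal I \<Longrightarrow> (\<And>i. f i \<in> C) \<Longrightarrow> i < r \<Longrightarrow> f i \<in> adjoin_upto I f r"
proof (induction r)
  case (Suc r)
  have J: "is_ideal (adjoin_upto I f r)" using Suc.prems is_ideal_adjoin_upto by blast
  show ?case
  proof (cases "i = r")
    case True
    then show ?thesis using adjoin_mem[OF J one_closed, of "f r"] by simp
  next
    case False
    then show ?thesis using Suc adjoin_superset[OF J, of "f r"] by auto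
  qed
qed simp

lemma adjoin_upto_minimal:
  "is_ideal I \<Longrightarrow> (\<And>i. f i \<in> C) \<Longrightarrow> is_ideal J \<Longrightarrow> I \<subseteq> J \<Longrightarrow> (\<And>i. i < r \<Longrightarrow> f i \<in> J) \<Longrightarrow>
    adjoin_upto I f r \<subseteq> J"
proof (induction r)
  case (Suc r)
  then show ?case using adjoin_minimal[of "adjoin_upto I f r" J "f r"] is_ideal_adjoin_upto by simp
qed simp

lemma adjoin_upto_Suc_shift:
  "adjoin_upto I f (Suc i) = adjoin_upto (adjoin I (f 0)) (\<lambda>i. f (Suc i)) i"
  by (induction i) simp_all

lemma regular_Suc_iff:
  "regular I f (Suc r) \<longleftrightarrow> (\<forall>x\<in>C. f 0 * x \<in> I \<longrightarrow> x \<in> I) \<and> regular (adjoin I (f 0)) (\<lambda>i. f (Suc i)) r"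
proof -
  have "regular I f (Suc r) \<longleftrightarrow> (\<forall>x\<in>C. f 0 * x \<in> I \<longrightarrow> x \<in> I) \<and>
    (\<forall>i<r. \<forall>x\<in>C. f (Suc i) * x \<in> adjoin_upto I f (Suc i) \<longrightarrow> x \<in> adjoin_upto I f (Suc i))"
    unfolding regular_def by (subst All_less_Suc2) simp
  then show ?thesis unfolding adjoin_upto_Suc_shift regular_def by simp
qed

text \<open>This is the exact sequence \<open>0 \<rightarrow> C / (I : x) \<rightarrow> C / I \<rightarrow> C / (I + (x)) \<rightarrow> 0\<close>: if \<open>f 0\<close> is
  regular on both ends, then it is regular in the middle and the sequence stays exact modulo
  \<open>f 0\<close>, that is, \<open>((I + (f 0)) : x) = (I : x) + (f 0)\<close>.\<close>

lemma regular_colon_adjoin: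
  assumes "is_ideal I" "x \<in> C" "\<And>i. f i \<in> C"
    and "regular (colon I x) f r" "regular (adjoin I x) f r"
  shows "regular I f r"
  using assms
proof (induction r arbitrary: I f)
  case 0
  then show ?case by (simp add: regular_def)
next
  case (Suc r)
  note I = \<open>is_ideal I\<close> and x = \<open>x \<in> C\<close>
  let ?f = "f 0"
  have f: "?f \<in> C" using Suc.prems by simp
  have reg_colon: "s \<in> colon I x" if "s \<in> C" "?f * s \<in> colon I x" for s
    using Suc.prems(4) that unfolding regular_Suc_iff by blast
  have reg_adjoin: "s \<in> adjoin I x" if "s \<in> C" "?f * s \<in> adjoin I x" for s
    using Suc.prems(5) that unfolding regular_Suc_iff by blast
  have "s \<in> I" if s: "s \<in> C" "?f * s \<in> I" for s
  proof -
    have "?f * s \<in> adjoin I x" using s(2) adjoin_superset[OF I] by blast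
    then obtain j t where jt: "j \<in> I" "t \<in> C" "s = j + x * t"
      using reg_adjoin[OF s(1)] unfolding adjoin_def by blast
    have "?f * s - ?f * j \<in> I" using s(2) jt(1) f ideal_diff ideal_mult I by blast
    then have "x * (?f * t) \<in> I" unfolding jt(3) by (simp add: algebra_simps)
    then have "?f * t \<in> colon I x" using jt(2) f mult_closed unfolding colon_def by auto
    then have "t \<in> colon I x" using reg_colon jt(2) by blast
    then show ?thesis using jt(1,3) ideal_add[OF I] unfolding colon_def by simp
  qed
  moreover have "regular (adjoin I ?f) (\<lambda>i. f (Suc i)) r"
  proof (rule Suc.IH)
    show "is_ideal (adjoin I ?f)" using is_ideal_adjoin[OF I f] .
    show "x \<in> C" "\<And>i. f (Suc i) \<in> C" using Suc.prems by auto
    have "colon (adjoin I ?f) x = adjoin (colon I x) ?f"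
    proof (intro equalityI subsetI)
      fix s assume s: "s \<in> colon (adjoin I ?f) x"
      then obtain j t where jt: "j \<in> I" "t \<in> C" "x * s = j + ?f * t" "s \<in> C"
        unfolding colon_def adjoin_def by blast
      have "?f * t = - j + x * s" using jt(3) by simp
      then have "?f * t \<in> adjoin I x" using jt(1,4) ideal_uminus[OF I] unfolding adjoin_def by blast
      then obtain i u where iu: "i \<in> I" "u \<in> C" "t = i + x * u"
        using reg_adjoin[OF jt(2)] unfolding adjoin_def by blast
      have "x * (s - ?f * u) = j + ?f * i" using jt(3) iu(3) by (simp add: algebra_simps)
      then have "s - ?f * u \<in> colon I x"
        using jt(1,4) iu(1,2) f ideal_add ideal_mult diff_closed mult_closed I unfolding colon_def by simp
      then have "(s - ?f * u) + ?f * u \<in> adjoin (colon I x) ?f"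
        using iu(2) unfolding adjoin_def by blast
      then show "s \<in> adjoin (colon I x) ?f" by simp
    next
      fix s assume "s \<in> adjoin (colon I x) ?f"
      then obtain j t where jt: "j \<in> C" "x * j \<in> I" "t \<in> C" "s = j + ?f * t"
        unfolding colon_def adjoin_def by blast
      then have "x * s = x * j + ?f * (x * t)" "s \<in> C" "x * t \<in> C"
        using f x add_closed mult_closed by (simp_all add: algebra_simps)
      then show "s \<in> colon (adjoin I ?f) x"
        using jt(2) unfolding colon_def adjoin_def by blast
    qed
    then show "regular (colon (adjoin I ?f) x) (\<lambda>i. f (Suc i)) r"
      using Suc.prems(4) unfolding regular_Suc_iff by simp
    show "regular (adjoin (adjoin I ?f) x) (\<lambda>i. f (Suc i)) r"
      using Suc.prems(5) adjoin_commute unfolding regular_Suc_iff by metis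
  qed
  ultimately show ?case unfolding regular_Suc_iff by blast
qed

definition unit :: "'b \<Rightarrow> bool" where
  "unit u \<longleftrightarrow> u \<in> C \<and> (\<exists>v\<in>C. v * u = 1)"

lemma unit_cancel:
  assumes "is_ideal I" "unit u" "x \<in> C" "u * x \<in> I"
  shows "x \<in> I"
proof -
  obtain v where v: "v \<in> C" "v * u = 1" using assms(2) unfolding unit_def by blast
  have "v * (u * x) \<in> I" using ideal_mult assms v by blast
  then show ?thesis using v(2) by (simp add: mult.assoc[symmetric])
qed


section \<open>Chains of prime ideals\<close>

definition is_prime :: "'b set \<Rightarrow> bool" where
  "is_prime P \<longleftrightarrow> is_ideal P \<and> 1 \<notin> P \<and> (\<forall>x\<in>C. \<forall>y\<in>C. x * y \<in> P \<longrightarrow> x \<in> P \<or> y \<in> P)"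

lemma prime_power: "is_prime P \<Longrightarrow> x \<in> C \<Longrightarrow> x ^ n \<in> P \<Longrightarrow> x \<in> P"
proof (induction n)
  case 0
  then show ?case unfolding is_prime_def by simp
next
  case (Suc n)
  then have "x \<in> P \<or> x ^ n \<in> P" using power_closed unfolding is_prime_def by simp
  then show ?case using Suc by blast
qed

text \<open>Elements that witness the strictness of a chain of primes satisfy no polynomial relation modulo
  the lowest prime with units as coefficients: cancel the largest possible power of \<open>x j\<close> in
  a relation modulo \<open>P j\<close>; modulo \<open>P (j + 1)\<close> only the terms free of \<open>x j\<close>
  survive, and they form a shorter relation.\<close>

lemma prime_chain_independent:
  assumes prime: "\<And>i. i \<le> N \<Longrightarrow> is_prime (P i)"
    and sub: "\<And>i. i < N \<Longrightarrow> P i \<subseteq> P (Suc i)"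
    and x: "\<And>i. i < N \<Longrightarrow> x i \<in> P (Suc i) \<and> x i \<notin> P i"
    and "j \<le> N" "finite T" "T \<noteq> {}"
    and "\<And>a. a \<in> T \<Longrightarrow> unit (k a)"
    and "\<And>a b i. a \<in> T \<Longrightarrow> b \<in> T \<Longrightarrow> i \<notin> {j..<N} \<Longrightarrow> a i = b i"
  shows "(\<Sum>a\<in>T. k a * (\<Prod>i=j..<N. x i ^ a i)) \<notin> P j"
  using assms(4-)
proof (induction "N - j" arbitrary: j T)
  case 0
  then have j: "j = N" by simp
  obtain a where a: "a \<in> T" using 0 by blast
  have "T = {a}" using 0(6) a j by (auto intro!: ext)
  then have "(\<Sum>a\<in>T. k a * (\<Prod>i=j..<N. x i ^ a i)) = k a" using j by simp
  moreover have "k a \<notin> P N"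
  proof
    assume "k a \<in> P N"
    moreover have "is_prime (P N)" using prime by simp
    ultimately have "1 \<in> P N"
      using unit_cancel[of "P N" "k a" 1] 0(5)[OF a] one_closed unfolding is_prime_def by simp
    then show False using \<open>is_prime (P N)\<close> unfolding is_prime_def by simp
  qed
  ultimately show ?case using j by simp
next
  case (Suc d)
  then have jN: "j < N" by simp
  have Pj: "is_prime (P j)" "is_ideal (P j)" and PS: "is_ideal (P (Suc j))"
    using prime jN unfolding is_prime_def by auto
  have xC: "x i \<in> C" if "i < N" for i
    using x[OF that] prime[of "Suc i"] that ideal_closed unfolding is_prime_def by auto
  have xj: "x j \<in> P (Suc j)" "x j \<notin> P j" "x j \<in> C" using x jN xC by auto
  \<comment> \<open>the power of \<open>x j\<close> that can be cancelled\<close>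
  define m where "m = Min ((\<lambda>a. a j) ` T)"
  have m: "m \<in> (\<lambda>a. a j) ` T" "\<And>a. a \<in> T \<Longrightarrow> m \<le> a j"
    unfolding m_def using Suc.prems by (auto intro!: Min_in)
  define rest where "rest a = k a * (\<Prod>i=Suc j..<N. x i ^ a i)" for a
  let ?T = "{a \<in> T. a j = m}"
  have restC: "rest a \<in> C" if "a \<in> T" for a
    unfolding rest_def using Suc.prems(4)[OF that] xC
    by (intro mult_closed prod_closed power_closed) (auto simp: unit_def)
  have IH: "sum rest ?T \<notin> P (Suc j)"
    unfolding rest_def
  proof (rule Suc.hyps(1))
    show "d = N - Suc j" using Suc.hyps(2) by simp
    show "Suc j \<le> N" using jN by simp
    show "finite ?T" "?T \<noteq> {}" using Suc.prems(2) m(1) by auto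
    show "unit (k a)" if "a \<in> ?T" for a using that Suc.prems(4) by simp
    show "a i = b i" if "a \<in> ?T" "b \<in> ?T" "i \<notin> {Suc j..<N}" for a b i
      using that Suc.prems(5)[of a b i] by (cases "i = j") auto
  qed
  show ?case
  proof
    assume mem: "(\<Sum>a\<in>T. k a * (\<Prod>i=j..<N. x i ^ a i)) \<in> P j"
    define S where "S = (\<Sum>a\<in>T. x j ^ (a j - m) * rest a)"
    have "(\<Sum>a\<in>T. k a * (\<Prod>i=j..<N. x i ^ a i)) = x j ^ m * S"
      unfolding S_def sum_distrib_left
    proof (rule sum.cong)
      fix a assume "a \<in> T"
      then have "x j ^ a j = x j ^ m * x j ^ (a j - m)"
        using m(2) by (simp add: power_add[symmetric])
      then show "k a * (\<Prod>i=j..<N. x i ^ a i) = x j ^ m * (x j ^ (a j - m) * rest a)"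
        unfolding rest_def using jN by (simp add: prod.atLeast_Suc_lessThan mult_ac)
    qed simp
    moreover have SC: "S \<in> C"
      unfolding S_def using restC xj by (intro sum_closed mult_closed power_closed)
    moreover have "x j ^ m \<notin> P j" using prime_power[OF Pj(1)] xj by blast
    ultimately have "S \<in> P j"
      using mem Pj(1) power_closed xj unfolding is_prime_def by metis
    then have SP: "S \<in> P (Suc j)" using sub jN by blast
    have S: "S = sum rest ?T + (\<Sum>a\<in>T - ?T. x j ^ (a j - m) * rest a)"
    proof -
      have "S = (\<Sum>a\<in>?T. x j ^ (a j - m) * rest a) + (\<Sum>a\<in>T - ?T. x j ^ (a j - m) * rest a)"
        unfolding S_def using Suc.prems(2) by (subst sum.subset_diff[of ?T T]) auto
      then show ?thesis by simp
    qed
    have "(\<Sum>a\<in>T - ?T. x j ^ (a j - m) * rest a) \<in> P (Suc j)"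
    proof (rule ideal_sum[OF PS])
      fix a assume a: "a \<in> T - ?T"
      then have "a j - m = Suc (a j - m - 1)" using m(2)[of a] by auto
      then have "x j ^ (a j - m) * rest a = (x j ^ (a j - m - 1) * rest a) * x j"
        by (metis mult.assoc mult.commute power_Suc)
      then show "x j ^ (a j - m) * rest a \<in> P (Suc j)"
        using ideal_mult[OF PS _ xj(1)] mult_closed power_closed xj(3) restC a by simp
    qed
    then have "sum rest ?T \<in> P (Suc j)" using SP[unfolded S] by (rule ideal_add_cancel[OF PS])
    then show False using IH by contradiction
  qed
qed

end

section \<open>Regular sequences are quasi-regular\<close>

context subring_of
begin

abbreviation "form f r k m \<equiv> \<Sum>a\<in>exponents r k. m a * monomial f r a"

text \<open>For \<open>Q = C\<close> this is \<open>I + J\<^sup>k\<close> and for \<open>Q = J\<close> it is \<open>I + J\<^sup>k\<^sup>+\<^sup>1\<close>, where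
  \<open>J\<close> is generated by \<open>f 0, \<dots>, f (r - 1)\<close>.\<close>

definition forms :: "'b set \<Rightarrow> (nat \<Rightarrow> 'b) \<Rightarrow> nat \<Rightarrow> nat \<Rightarrow> 'b set \<Rightarrow> 'b set" where
  "forms I f r k Q = {j + form f r k m | j m. j \<in> I \<and> (\<forall>a. m a \<in> Q)}"

lemma formsI:
  assumes "is_ideal Q" "j \<in> I" "\<And>a. a \<in> exponents r k \<Longrightarrow> m a \<in> Q"
    "x = j + form f r k m"
  shows "x \<in> forms I f r k Q"
proof -
  let ?m = "\<lambda>a. if a \<in> exponents r k then m a else 0"
  have "x = j + (\<Sum>a\<in>exponents r k. ?m a * monomial f r a)" unfolding assms(4) by simp
  moreover have "\<forall>a. ?m a \<in> Q" using assms(3) ideal_zero[OF assms(1)] by simp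
  ultimately show ?thesis
    unfolding forms_def mem_Collect_eq using assms(2) by (intro exI[of _ j] exI[of _ ?m] conjI)
qed

lemma formsE:
  assumes "x \<in> forms I f r k Q"
  obtains j m where "j \<in> I" "\<forall>a. m a \<in> Q" "x = j + form f r k m"
  using assms unfolding forms_def by blast

lemma is_ideal_forms:
  assumes I: "is_ideal I" and Q: "is_ideal Q" and f: "\<And>i. f i \<in> C"
  shows "is_ideal (forms I f r k Q)"
  unfolding is_ideal_def
proof (intro conjI ballI subsetI)
  fix x assume "x \<in> forms I f r k Q"
  then obtain j m where "j \<in> I" "\<forall>a. m a \<in> Q" "x = j + form f r k m"
    by (rule formsE)
  then show "x \<in> C"
    using ideal_closed[OF I] ideal_closed[OF Q] monomial_closed[of f] f
    by (auto intro!: add_closed sum_closed mult_closed)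
next
  show "0 \<in> forms I f r k Q"
    by (rule formsI[OF Q ideal_zero[OF I], of r k "\<lambda>_. 0"]) (simp_all add: ideal_zero[OF Q])
next
  fix x y assume "x \<in> forms I f r k Q" "y \<in> forms I f r k Q"
  then obtain j m j' m' where *: "j \<in> I" "\<forall>a. m a \<in> Q" "j' \<in> I" "\<forall>a. m' a \<in> Q"
    "x = j + form f r k m"
    "y = j' + form f r k m'"
    by (elim formsE) blast
  show "x + y \<in> forms I f r k Q"
  proof (rule formsI[OF Q])
    show "j + j' \<in> I" using * ideal_add[OF I] by blast
    show "m a + m' a \<in> Q" for a using * ideal_add[OF Q] by blast
    show "x + y = j + j' + (\<Sum>a\<in>exponents r k. (m a + m' a) * monomial f r a)"
      unfolding * by (simp add: distrib_right sum.distrib algebra_simps)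
  qed
next
  fix c x assume c: "c \<in> C" and "x \<in> forms I f r k Q"
  then obtain j m where *: "j \<in> I" "\<forall>a. m a \<in> Q"
    "x = j + form f r k m"
    by (elim formsE) blast
  show "c * x \<in> forms I f r k Q"
  proof (rule formsI[OF Q])
    show "c * j \<in> I" using * c ideal_mult[OF I] by blast
    show "c * m a \<in> Q" for a using * c ideal_mult[OF Q] by blast
    show "c * x = c * j + (\<Sum>a\<in>exponents r k. (c * m a) * monomial f r a)"
      unfolding * by (simp add: distrib_left sum_distrib_left mult.assoc)
  qed
qed

lemma forms_superset: "is_ideal Q \<Longrightarrow> I \<subseteq> forms I f r k Q"
  using formsI[of Q _ I r k "\<lambda>_. 0"] ideal_zero[of Q] by auto

lemma monomial_in_forms:
  assumes "is_ideal I" "is_ideal Q" "q \<in> Q" "a \<in> exponents r k"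
  shows "q * monomial f r a \<in> forms I f r k Q"
proof (rule formsI[OF assms(2) ideal_zero[OF assms(1)]])
  show "(if b = a then q else 0) \<in> Q" for b using assms(2,3) ideal_zero by simp
  have "(\<Sum>b\<in>exponents r k. (if b = a then q else 0) * monomial f r b) =
    (\<Sum>b\<in>exponents r k. if b = a then q * monomial f r b else 0)"
    by (rule sum.cong) auto
  then show "q * monomial f r a = 0 + (\<Sum>b\<in>exponents r k. (if b = a then q else 0) * monomial f r b)"
    using assms(4) finite_exponents by (simp add: sum.delta)
qed

lemma forms_subsetI:
  assumes "is_ideal J" "I \<subseteq> J" "\<And>a q. a \<in> exponents r k \<Longrightarrow> q \<in> Q \<Longrightarrow> q * monomial f r a \<in> J"
  shows "forms I f r k Q \<subseteq> J"
proof
  fix x assume "x \<in> forms I f r k Q"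
  then obtain j m where "j \<in> I" "\<forall>a. m a \<in> Q" "x = j + form f r k m"
    by (rule formsE)
  then show "x \<in> J" using assms by (auto intro!: ideal_add[OF assms(1)] ideal_sum[OF assms(1)])
qed

text \<open>In other words \<open>J \<cdot> J\<^sup>k = J\<^sup>k\<^sup>+\<^sup>1\<close> modulo \<open>I\<close>.\<close>

lemma forms_Suc:
  assumes I: "is_ideal I" and f: "\<And>i. f i \<in> C"
  shows "forms I f r k (adjoin_upto I f r) = forms I f r (Suc k) C"
proof
  let ?J = "adjoin_upto I f r"
  have J: "is_ideal ?J" by (rule is_ideal_adjoin_upto[where f = f, OF I f])
  have F: "is_ideal (forms I f r (Suc k) C)" by (rule is_ideal_forms[where f = f, OF I is_ideal_carrier f])
  have FJ: "is_ideal (forms I f r k ?J)" by (rule is_ideal_forms[where f = f, OF I J f])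
  show "forms I f r k ?J \<subseteq> forms I f r (Suc k) C"
  proof (rule forms_subsetI[OF F forms_superset[OF is_ideal_carrier]])
    fix a q assume a: "a \<in> exponents r k" and q: "q \<in> ?J"
    let ?K = "colon (forms I f r (Suc k) C) (monomial f r a)"
    have "?J \<subseteq> ?K"
    proof (rule adjoin_upto_minimal[where f = f, OF I f])
      show "is_ideal ?K" by (rule is_ideal_colon[OF F monomial_closed[where f = f, OF f]])
      show "I \<subseteq> ?K"
      proof
        fix i assume "i \<in> I"
        then have "i \<in> C" "monomial f r a * i \<in> I"
          using ideal_closed[OF I] ideal_mult[OF I monomial_closed[where f = f, OF f]] by auto
        then show "i \<in> ?K" using forms_superset[OF is_ideal_carrier] unfolding colon_def by blast
      qed
      fix i assume "i < r"
      then have "1 * monomial f r (a(i := Suc (a i))) \<in> forms I f r (Suc k) C"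
        by (intro monomial_in_forms[OF I is_ideal_carrier one_closed] exponents_incr a)
      then have "monomial f r a * f i \<in> forms I f r (Suc k) C"
        using \<open>i < r\<close> by (simp only: monomial_incr mult_1_left mult.commute)
      then show "f i \<in> ?K" using f unfolding colon_def by simp
    qed
    then have "q \<in> ?K" using q by blast
    then show "q * monomial f r a \<in> forms I f r (Suc k) C"
      unfolding colon_def by (simp only: mem_Collect_eq mult.commute)
  qed
  show "forms I f r (Suc k) C \<subseteq> forms I f r k ?J"
  proof (rule forms_subsetI[OF FJ forms_superset[OF J]])
    fix a q assume a: "a \<in> exponents r (Suc k)" and q: "q \<in> C"
    obtain i b where ib: "i < r" "b \<in> exponents r k" "a = b(i := Suc (b i))"
      using exponents_Suc_decr[OF a] by blast
    have "q * f i \<in> ?J" using adjoin_upto_mem[where f = f, OF I f ib(1)] ideal_mult[OF J q] by blast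
    then have "(q * f i) * monomial f r b \<in> forms I f r k ?J"
      by (intro monomial_in_forms[OF I J] ib(2))
    then show "q * monomial f r a \<in> forms I f r k ?J"
      unfolding ib(3) monomial_incr[OF ib(1)] by (simp only: mult.assoc)
  qed
qed

lemma forms_mono: "Q \<subseteq> Q' \<Longrightarrow> forms I f r k Q \<subseteq> forms I f r k Q'"
  unfolding forms_def by blast

lemma forms_zero: "is_ideal I \<Longrightarrow> forms I f r 0 C = C"
proof
  assume I: "is_ideal I"
  show "forms I f r 0 C \<subseteq> C"
    by (rule forms_subsetI[OF is_ideal_carrier]) (use ideal_closed[OF I] in \<open>auto simp: exponents_zero\<close>)
  show "C \<subseteq> forms I f r 0 C"
  proof
    fix x assume "x \<in> C"
    then have "x * monomial f r (\<lambda>_. 0) \<in> forms I f r 0 C"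
      by (intro monomial_in_forms[OF I is_ideal_carrier]) (simp_all add: exponents_zero)
    then show "x \<in> forms I f r 0 C" by simp
  qed
qed

lemma forms_decreasing:
  assumes "is_ideal I" "\<And>i. f i \<in> C"
  shows "forms I f r (Suc k) C \<subseteq> forms I f r k C"
  unfolding forms_Suc[where f = f, OF assms, symmetric]
  by (rule forms_mono) (use is_ideal_adjoin_upto[where f = f, OF assms] in \<open>simp add: is_ideal_def\<close>)

lemma forms_antimono:
  assumes "is_ideal I" "\<And>i. f i \<in> C" "k \<le> l"
  shows "forms I f r l C \<subseteq> forms I f r k C"
  using assms(3) by (induction rule: dec_induct) (use forms_decreasing[where f = f, OF assms(1,2)] in blast)+

text \<open>For all \<open>k\<close> together this says that the associated graded ring of \<open>J\<close> on \<open>C / I\<close>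
  is the polynomial ring in \<open>r\<close> unknowns over \<open>C / (I + J)\<close>.\<close>

definition quasi_regular :: "'b set \<Rightarrow> (nat \<Rightarrow> 'b) \<Rightarrow> nat \<Rightarrow> nat \<Rightarrow> bool" where
  "quasi_regular I f r k \<longleftrightarrow> (\<forall>m. (\<forall>a. m a \<in> C) \<longrightarrow>
     form f r k m \<in> forms I f r (Suc k) C \<longrightarrow>
     (\<forall>a\<in>exponents r k. m a \<in> adjoin_upto I f r))"

lemma quasi_regularD:
  assumes "quasi_regular I f r k" "\<And>a. a \<in> exponents r k \<Longrightarrow> m a \<in> C"
    "form f r k m \<in> forms I f r (Suc k) C" "a \<in> exponents r k"
  shows "m a \<in> adjoin_upto I f r"
proof -
  let ?m = "\<lambda>a. if a \<in> exponents r k then m a else 0"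
  have "(\<Sum>a\<in>exponents r k. ?m a * monomial f r a) = form f r k m"
    by (rule sum.cong) auto
  moreover have "\<forall>a. ?m a \<in> C" using assms(2) zero_closed by simp
  moreover have "(\<forall>a. ?m a \<in> C) \<longrightarrow>
     (\<Sum>a\<in>exponents r k. ?m a * monomial f r a) \<in> forms I f r (Suc k) C \<longrightarrow>
     (\<forall>a\<in>exponents r k. ?m a \<in> adjoin_upto I f r)"
    using assms(1) unfolding quasi_regular_def by (rule spec)
  ultimately have "?m a \<in> adjoin_upto I f r"
    using assms(3,4) by auto
  then show ?thesis using assms(4) by simp
qed

text \<open>Forms with value in \<open>I\<close> suffice: a form of degree \<open>k\<close> with value in
  \<open>I + J\<^sup>k\<^sup>+\<^sup>1\<close> becomes one after subtracting a form with coefficients in \<open>J\<close>.\<close>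

lemma quasi_regularI:
  assumes I: "is_ideal I" and f: "\<And>i. f i \<in> C"
    and rel: "\<And>m. \<forall>a. m a \<in> C \<Longrightarrow> form f r k m \<in> I \<Longrightarrow>
      \<forall>a\<in>exponents r k. m a \<in> adjoin_upto I f r"
  shows "quasi_regular I f r k"
  unfolding quasi_regular_def
proof (intro allI impI ballI)
  fix m a
  assume m: "\<forall>a. m a \<in> C" and s: "form f r k m \<in> forms I f r (Suc k) C"
    and a: "a \<in> exponents r k"
  let ?J = "adjoin_upto I f r"
  have J: "is_ideal ?J" by (rule is_ideal_adjoin_upto[where f = f, OF I f])
  obtain j n where n: "j \<in> I" "\<forall>a. n a \<in> ?J"
    "form f r k m = j + form f r k n"
    using s unfolding forms_Suc[where f = f, OF I f, symmetric] by (rule formsE)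
  have "\<forall>a\<in>exponents r k. m a - n a \<in> ?J"
  proof (rule rel)
    show "\<forall>a. m a - n a \<in> C" using m n(2)[rule_format] ideal_closed[OF J] diff_closed by blast
    have "(\<Sum>a\<in>exponents r k. (m a - n a) * monomial f r a) = j"
      using n(3) by (simp add: left_diff_distrib sum_subtractf)
    then show "(\<Sum>a\<in>exponents r k. (m a - n a) * monomial f r a) \<in> I" using n(1) by simp
  qed
  then have "m a - n a \<in> ?J" using a by blast
  then have "m a - n a + n a \<in> ?J" using n(2) ideal_add[OF J] by blast
  then show "m a \<in> ?J" by simp
qed

text \<open>Induction on \<open>k\<close>: write \<open>z\<close> as a form of degree \<open>k\<close>; by quasi-regularity
  \<open>g\<close> times its coefficients lie in \<open>J\<close>, hence so do the coefficients.\<close>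

lemma regular_mod_powers:
  assumes I: "is_ideal I" and f: "\<And>i. f i \<in> C"
    and qr: "\<And>k. quasi_regular I f r k"
    and nzd: "\<And>x. x \<in> C \<Longrightarrow> g * x \<in> adjoin_upto I f r \<Longrightarrow> x \<in> adjoin_upto I f r"
    and g: "g \<in> C" and z: "z \<in> C" "g * z \<in> forms I f r k C"
  shows "z \<in> forms I f r k C"
  using z(2)
proof (induction k)
  case 0
  then show ?case using forms_zero[OF I] z by simp
next
  case (Suc k)
  have F: "is_ideal (forms I f r (Suc k) C)" by (rule is_ideal_forms[where f = f, OF I is_ideal_carrier f])
  have "z \<in> forms I f r k C" using Suc forms_decreasing[where f = f, OF I f] by blast
  then obtain j m where m: "j \<in> I" "\<forall>a. m a \<in> C" "z = j + form f r k m"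
    by (rule formsE)
  have "(\<Sum>a\<in>exponents r k. (g * m a) * monomial f r a) = g * z - g * j"
    unfolding m(3) by (simp add: distrib_left sum_distrib_left mult.assoc)
  moreover have "g * j \<in> forms I f r (Suc k) C"
    using ideal_mult[OF I g m(1)] forms_superset[OF is_ideal_carrier] by blast
  ultimately have "(\<Sum>a\<in>exponents r k. (g * m a) * monomial f r a) \<in> forms I f r (Suc k) C"
    using ideal_diff[OF F Suc.prems] by simp
  then have "m a \<in> adjoin_upto I f r" if "a \<in> exponents r k" for a
    using nzd[OF m(2)[rule_format]] quasi_regularD[OF qr, of k "\<lambda>a. g * m a" a] mult_closed[OF g m(2)[rule_format]] that by blast
  then have "z \<in> forms I f r k (adjoin_upto I f r)"
    by (rule formsI[OF is_ideal_adjoin_upto[where f = f, OF I f] m(1) _ m(3)])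
  then show ?case unfolding forms_Suc[where f = f, OF I f] .
qed

text \<open>Induction on \<open>r\<close> and, inside, on the degree. Splitting a form as \<open>G + f\<^sub>r H\<close>, the
  element \<open>f\<^sub>r H\<close> lies, like \<open>G\<close>, in a power of the ideal of the first \<open>r\<close>
  elements, hence so does \<open>H\<close>. The inner hypothesis then handles the coefficients of \<open>H\<close>, and
  rewriting \<open>H\<close> as a form in the first \<open>r\<close> elements lets the outer hypothesis handle
  those of \<open>G\<close>.\<close>

lemma regular_imp_quasi_regular:
  assumes I: "is_ideal I" and f: "\<And>i. f i \<in> C" and "regular I f r"
  shows "quasi_regular I f r k"
  using assms(3)
proof (induction r arbitrary: k)
  case (0 k)
  show ?case
  proof (rule quasi_regularI[where f = f, OF I f], goal_cases)
    case (1 m)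
    note m = 1(2)
    show ?case
    proof
      fix a assume a: "a \<in> exponents 0 k"
      then have "k = 0" unfolding exponents_def by simp
      then show "m a \<in> adjoin_upto I f 0"
        using m a by (simp add: exponents_zero monomial_def)
    qed
  qed
next
  case (Suc r k)
  let ?J = "adjoin_upto I f r" and ?J' = "adjoin_upto I f (Suc r)"
  have J: "is_ideal ?J" and J': "is_ideal ?J'" by (rule is_ideal_adjoin_upto[where f = f, OF I f])+
  have JJ': "?J \<subseteq> ?J'" using adjoin_superset[OF J] by simp
  have reg: "regular I f r" using Suc.prems unfolding regular_def by simp
  have nzd: "x \<in> ?J" if "x \<in> C" "f r * x \<in> ?J" for x
    using Suc.prems that unfolding regular_def by blast
  have qr: "quasi_regular I f r k" for k using Suc.IH[OF reg] .
  show ?case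
  proof (induction k)
    case 0
    show ?case
    proof (rule quasi_regularI[where f = f, OF I f], goal_cases)
      case (1 m)
      then have "\<forall>a\<in>exponents (Suc r) 0. m a \<in> I" by (simp add: exponents_zero)
      then show ?case using adjoin_upto_superset[where f = f, OF I f] by blast
    qed
  next
    case (Suc k)
    show ?case
    proof (rule quasi_regularI[where f = f, OF I f], goal_cases)
      case (1 m)
      note m = 1(1)[rule_format] and s = 1(2)
      let ?inc = "\<lambda>b::nat \<Rightarrow> nat. b(r := Suc (b r))"
      let ?S = "\<Sum>a\<in>exponents (Suc r) (Suc k). m a * monomial f (Suc r) a"
      define G where "G = form f r (Suc k) m"
      define H where "H = (\<Sum>b\<in>exponents (Suc r) k. m (?inc b) * monomial f (Suc r) b)"
      have split: "?S = G + f r * H" unfolding G_def H_def by (rule sum_exponents_Suc_Suc)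
      have F: "is_ideal (forms I f r (Suc k) C)" by (rule is_ideal_forms[where f = f, OF I is_ideal_carrier f])
      have HC: "H \<in> C" unfolding H_def by (intro sum_closed mult_closed m monomial_closed f)
      have "G \<in> forms I f r (Suc k) C"
        by (rule formsI[OF is_ideal_carrier ideal_zero[OF I] m]) (simp add: G_def)
      then have "?S - G \<in> forms I f r (Suc k) C"
        using s forms_superset[OF is_ideal_carrier] ideal_diff[OF F] by blast
      then have frH: "f r * H \<in> forms I f r (Suc k) C" unfolding split by simp
      have Hf: "H \<in> forms I f r (Suc k) C"
        by (rule regular_mod_powers[where f = f and g = "f r", OF I f qr _ f HC frH]) (rule nzd)
      then obtain j h where h: "j \<in> I" "\<forall>a. h a \<in> C" "H = j + form f r (Suc k) h"
        by (rule formsE)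
      have "forms I f r (Suc k) C \<subseteq> forms I f (Suc r) (Suc k) C"
      proof (rule forms_subsetI[OF _ forms_superset[OF is_ideal_carrier]])
        show "is_ideal (forms I f (Suc r) (Suc k) C)" by (rule is_ideal_forms[where f = f, OF I is_ideal_carrier f])
        fix b q assume b: "b \<in> exponents r (Suc k)" and q: "q \<in> C"
        have "monomial f (Suc r) b = monomial f r b" "b \<in> exponents (Suc r) (Suc k)"
          using b unfolding monomial_def exponents_def by auto
        then show "q * monomial f r b \<in> forms I f (Suc r) (Suc k) C"
          using monomial_in_forms[OF I is_ideal_carrier q, of b "Suc r" "Suc k" f] by simp
      qed
      then have "H \<in> forms I f (Suc r) (Suc k) C" using Hf by blast
      then have inc: "m (?inc b) \<in> ?J'" if "b \<in> exponents (Suc r) k" for b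
        using quasi_regularD[OF Suc.IH, of "\<lambda>b. m (?inc b)" b] m that unfolding H_def by blast
      have "(\<Sum>a\<in>exponents r (Suc k). (m a + f r * h a) * monomial f r a) = G + f r * (H - j)"
        unfolding G_def h(3) by (simp add: distrib_right sum.distrib sum_distrib_left mult.assoc)
      also have "\<dots> = ?S - f r * j" unfolding split by (simp add: algebra_simps)
      also have "\<dots> \<in> I" using ideal_diff[OF I s ideal_mult[OF I f h(1)]] .
      finally have "(\<Sum>a\<in>exponents r (Suc k). (m a + f r * h a) * monomial f r a) \<in> forms I f r (Suc (Suc k)) C"
        using forms_superset[OF is_ideal_carrier] by blast
      then have sum: "m a + f r * h a \<in> ?J" if "a \<in> exponents r (Suc k)" for a
        using quasi_regularD[OF qr, of "Suc k" "\<lambda>a. m a + f r * h a" a] that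
          add_closed[OF m mult_closed[OF f h(2)[rule_format]]] by blast
      show ?case
      proof
        fix a assume a: "a \<in> exponents (Suc r) (Suc k)"
        show "m a \<in> ?J'"
        proof (cases "a \<in> exponents r (Suc k)")
          case True
          have "f r * h a \<in> ?J'" using adjoin_mem[OF J h(2)[rule_format]] by simp
          then show ?thesis using ideal_add_cancel[OF J'] sum[OF True] JJ' by blast
        next
          case False
          then obtain b where "b \<in> exponents (Suc r) k" "a = ?inc b"
            using a unfolding exponents_Suc_Suc by blast
          then show ?thesis using inc by blast
        qed
      qed
    qed
  qed
qed

text \<open>Let \<open>k\<close> be maximal such that \<open>z\<close> is a form of degree \<open>k\<close>, and take the terms of
  least degree of the relation. Their product with the leading form of \<open>z\<close> would vanish in
  the associated graded ring; comparing the coefficients of a monomial with a unique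
  representation shows that a coefficient of that form lies in \<open>J\<close>.\<close>

lemma regular_sequence_independent:
  assumes I: "is_ideal I" and f: "\<And>i. f i \<in> C" and reg: "regular I f r"
    and z: "z \<in> C" "z \<notin> forms I f r K C"
    and T: "finite T" "T \<noteq> {}" "\<And>a i. a \<in> T \<Longrightarrow> r \<le> i \<Longrightarrow> a i = 0"
    and \<kappa>: "\<And>a. a \<in> T \<Longrightarrow> unit (\<kappa> a)"
  shows "(\<Sum>a\<in>T. \<kappa> a * monomial f r a) * z \<notin> I"
proof
  assume mem: "(\<Sum>a\<in>T. \<kappa> a * monomial f r a) * z \<in> I"
  let ?J = "adjoin_upto I f r"
  have J: "is_ideal ?J" by (rule is_ideal_adjoin_upto[where f = f, OF I f])
  have F: "is_ideal (forms I f r k C)" for k by (rule is_ideal_forms[where f = f, OF I is_ideal_carrier f])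
  have "z \<in> forms I f r 0 C" using forms_zero[OF I] z by simp
  then obtain k where k: "z \<in> forms I f r k C" "z \<notin> forms I f r (Suc k) C"
    using z(2) by (induction K) auto
  obtain j m where m: "j \<in> I" "\<forall>a. m a \<in> C" "z = j + form f r k m"
    using k(1) by (rule formsE)
  define A where "A = {a \<in> exponents r k. m a \<notin> ?J}"
  have A: "finite A" "A \<subseteq> exponents r k"
    unfolding A_def using finite_exponents by auto
  have rest: "z - (\<Sum>a\<in>A. m a * monomial f r a) \<in> forms I f r (Suc k) C"
    unfolding forms_Suc[where f = f, OF I f, symmetric]
  proof (rule formsI[OF J m(1)])
    show "(if a \<in> A then 0 else m a) \<in> ?J" if "a \<in> exponents r k" for a
      using that ideal_zero[OF J] unfolding A_def by simp
    have "form f r k m = (\<Sum>a\<in>A. m a * monomial f r a) +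
      (\<Sum>a\<in>exponents r k - A. m a * monomial f r a)"
      using sum.subset_diff[OF A(2) finite_exponents] by (simp add: add.commute)
    also have "(\<Sum>a\<in>exponents r k - A. m a * monomial f r a) =
      (\<Sum>a\<in>exponents r k. (if a \<in> A then 0 else m a) * monomial f r a)"
      by (rule sum.mono_neutral_cong_left) (use finite_exponents in auto)
    finally show "z - (\<Sum>a\<in>A. m a * monomial f r a) =
      j + (\<Sum>a\<in>exponents r k. (if a \<in> A then 0 else m a) * monomial f r a)"
      unfolding m(3) by simp
  qed
  have A_ne: "A \<noteq> {}" using rest k(2) by auto
  define deg where "deg a = sum a {..<r}" for a :: "nat \<Rightarrow> nat"
  define l where "l = Min (deg ` T)"
  have l: "l \<in> deg ` T" "\<And>a. a \<in> T \<Longrightarrow> l \<le> deg a"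
    unfolding l_def using T by (auto intro!: Min_in)
  define B where "B = {a \<in> T. deg a = l}"
  have B: "finite B" "B \<noteq> {}" "B \<subseteq> exponents r l"
    using T l(1) unfolding B_def exponents_def deg_def by auto
  have T_exp: "a \<in> exponents r (deg a)" if "a \<in> T" for a
    using T(3)[OF that] unfolding exponents_def deg_def by auto
  have prod: "x * monomial f r a \<in> forms I f r (d + e) C"
    if "x \<in> forms I f r d C" "a \<in> exponents r e" for x a d e
  proof -
    let ?K = "colon (forms I f r (d + e) C) (monomial f r a)"
    have "forms I f r d C \<subseteq> ?K"
    proof (rule forms_subsetI)
      show "is_ideal ?K" by (rule is_ideal_colon[OF F monomial_closed[where f = f, OF f]])
      show "I \<subseteq> ?K"
      proof
        fix i assume "i \<in> I"
        then have "i \<in> C" "monomial f r a * i \<in> I"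
          using ideal_closed[OF I] ideal_mult[OF I monomial_closed[where f = f, OF f]] by auto
        then show "i \<in> ?K" using forms_superset[OF is_ideal_carrier] unfolding colon_def by blast
      qed
      fix b q assume b: "b \<in> exponents r d" and q: "q \<in> C"
      have "q * monomial f r (\<lambda>i. b i + a i) \<in> forms I f r (d + e) C"
        by (rule monomial_in_forms[OF I is_ideal_carrier q exponents_add[OF b that(2)]])
      then show "q * monomial f r b \<in> ?K"
        using mult_closed[OF q monomial_closed[where f = f, OF f]] unfolding colon_def monomial_add
        by (simp add: mult_ac)
    qed
    then show ?thesis using that(1) unfolding colon_def by (auto simp: mult.commute)
  qed
  have \<kappa>C: "\<kappa> a \<in> C" if "a \<in> T" for a using \<kappa>[OF that] unfolding unit_def by blast
  let ?F = "forms I f r (Suc (k + l)) C"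
  have high: "(\<Sum>a\<in>T - B. \<kappa> a * monomial f r a) * z \<in> ?F"
    unfolding sum_distrib_right
  proof (rule ideal_sum[OF F])
    fix a assume a: "a \<in> T - B"
    then have "Suc (k + l) \<le> k + deg a" using l(2)[of a] unfolding B_def by auto
    then have "z * monomial f r a \<in> ?F"
      using prod[OF k(1) T_exp] forms_antimono[where f = f, OF I f] a by blast
    then have "\<kappa> a * (z * monomial f r a) \<in> ?F" using ideal_mult[OF F] \<kappa>C a by blast
    then show "\<kappa> a * monomial f r a * z \<in> ?F" by (simp add: mult_ac)
  qed
  have low: "(\<Sum>b\<in>B. \<kappa> b * monomial f r b) * (z - (\<Sum>a\<in>A. m a * monomial f r a)) \<in> ?F"
    unfolding sum_distrib_right
  proof (rule ideal_sum[OF F])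
    fix b assume b: "b \<in> B"
    have "(z - (\<Sum>a\<in>A. m a * monomial f r a)) * monomial f r b \<in> ?F"
      using prod[OF rest, of b l] b B(3) by auto
    then have "\<kappa> b * ((z - (\<Sum>a\<in>A. m a * monomial f r a)) * monomial f r b) \<in> ?F"
      using ideal_mult[OF F] \<kappa>C b unfolding B_def by blast
    then show "\<kappa> b * monomial f r b * (z - (\<Sum>a\<in>A. m a * monomial f r a)) \<in> ?F"
      by (simp add: mult_ac)
  qed
  have "(\<Sum>a\<in>T. \<kappa> a * monomial f r a) = (\<Sum>a\<in>T - B. \<kappa> a * monomial f r a) + (\<Sum>b\<in>B. \<kappa> b * monomial f r b)"
    by (rule sum.subset_diff) (use T in \<open>auto simp: B_def\<close>)
  then have "(\<Sum>b\<in>B. \<kappa> b * monomial f r b) * (\<Sum>a\<in>A. m a * monomial f r a) =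
    (\<Sum>a\<in>T. \<kappa> a * monomial f r a) * z - (\<Sum>a\<in>T - B. \<kappa> a * monomial f r a) * z -
    (\<Sum>b\<in>B. \<kappa> b * monomial f r b) * (z - (\<Sum>a\<in>A. m a * monomial f r a))"
    by (simp add: algebra_simps)
  moreover have "(\<Sum>a\<in>T. \<kappa> a * monomial f r a) * z \<in> ?F"
    using mem forms_superset[OF is_ideal_carrier] by blast
  ultimately have main: "(\<Sum>b\<in>B. \<kappa> b * monomial f r b) * (\<Sum>a\<in>A. m a * monomial f r a) \<in> ?F"
    using ideal_diff[OF F ideal_diff[OF F _ high] low] by simp
  \<comment> \<open>the coefficient at the exponent \<open>e\<close> of the product of the two forms\<close>
  define c where "c e = (\<Sum>(b, a)\<in>{(b, a) \<in> B \<times> A. (\<lambda>i. b i + a i) = e}. \<kappa> b * m a)" for e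
  have "(\<Sum>b\<in>B. \<kappa> b * monomial f r b) * (\<Sum>a\<in>A. m a * monomial f r a) =
    (\<Sum>(b, a)\<in>B \<times> A. \<kappa> b * m a * monomial f r (\<lambda>i. b i + a i))"
    unfolding sum_product sum.cartesian_product monomial_add by (rule sum.cong) (auto simp: mult_ac)
  also have "\<dots> = (\<Sum>e\<in>exponents r (k + l). \<Sum>p\<in>{p \<in> B \<times> A. (case p of (b, a) \<Rightarrow> (\<lambda>i. b i + a i)) = e}.
      case p of (b, a) \<Rightarrow> \<kappa> b * m a * monomial f r (\<lambda>i. b i + a i))"
  proof (rule sum.group[symmetric])
    show "finite (B \<times> A)" "finite (exponents r (k + l))" using A B finite_exponents by auto
    show "(\<lambda>p. case p of (b, a) \<Rightarrow> (\<lambda>i. b i + a i)) ` (B \<times> A) \<subseteq> exponents r (k + l)"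
      using exponents_add[of _ r l _ k] A(2) B(3) by (auto simp: add.commute)
  qed
  also have "\<dots> = (\<Sum>e\<in>exponents r (k + l). c e * monomial f r e)"
    unfolding c_def sum_distrib_right by (intro sum.cong) (auto split: prod.splits)
  finally have sum: "(\<Sum>e\<in>exponents r (k + l). c e * monomial f r e) \<in> ?F" using main by simp
  have cC: "c e \<in> C" for e
    unfolding c_def by (rule sum_closed) (auto intro!: mult_closed \<kappa>C m(2)[rule_format] simp: B_def)
  have vanish: "a i = 0" if "a \<in> A \<union> B" "i \<notin> {..<r}" for a i
    using that A(2) B(3) unfolding exponents_def by auto
  have "\<exists>b\<in>B. \<exists>a\<in>A. \<forall>b'\<in>B. \<forall>a'\<in>A. (\<forall>i. b' i + a' i = b i + a i) \<longrightarrow> b' = b \<and> a' = a"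
    by (rule sums_with_unique_representation[of "{..<r}"])
      (use A B A_ne in \<open>simp_all add: vanish\<close>)
  then obtain a b where ab: "b \<in> B" "a \<in> A"
    "\<And>b' a'. b' \<in> B \<Longrightarrow> a' \<in> A \<Longrightarrow> (\<forall>i. b' i + a' i = b i + a i) \<Longrightarrow> b' = b \<and> a' = a"
    by blast
  let ?e = "\<lambda>i. b i + a i"
  have "{(b, a) \<in> B \<times> A. (\<lambda>i. b i + a i) = ?e} = {(b, a)}"
  proof (intro equalityI subsetI)
    fix p assume "p \<in> {(b, a) \<in> B \<times> A. (\<lambda>i. b i + a i) = ?e}"
    then obtain b' a' where p: "p = (b', a')" "b' \<in> B" "a' \<in> A" "(\<lambda>i. b' i + a' i) = ?e" by blast
    then show "p \<in> {(b, a)}" using ab(3)[OF p(2,3)] fun_cong[OF p(4)] by simp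
  qed (use ab(1,2) in simp)
  then have "c ?e = \<kappa> b * m a" unfolding c_def by simp
  moreover have "?e \<in> exponents r (k + l)"
    using exponents_add[of b r l a k] ab(1,2) A(2) B(3) by (auto simp: add.commute)
  then have "c ?e \<in> ?J"
    using quasi_regularD[OF regular_imp_quasi_regular[where f = f, OF I f reg] cC sum] by blast
  moreover have "unit (\<kappa> b)" using \<kappa> ab(1) unfolding B_def by blast
  ultimately have "m a \<in> ?J"
    using unit_cancel[OF J, of "\<kappa> b" "m a"] m(2) by simp
  then show False using ab(2) unfolding A_def by simp
qed

end

section \<open>Polynomials and their monomials\<close>

abbreviation "lookup \<equiv> Poly_Mapping.lookup"
abbreviation "keys \<equiv> Poly_Mapping.keys"
abbreviation "single \<equiv> Poly_Mapping.single"

type_synonym ('a, 'k) mpoly = "('a \<Rightarrow>\<^sub>0 nat) \<Rightarrow>\<^sub>0 'k"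

lemma poly_eq_sum_single: "f = (\<Sum>t\<in>keys f. single t (lookup f t))"
proof (rule poly_mapping_eqI)
  fix k
  have "lookup (\<Sum>t\<in>keys f. single t (lookup f t)) k =
    (\<Sum>t\<in>keys f. if t = k then lookup f t else 0)"
    unfolding lookup_sum by (rule sum.cong) (auto simp: lookup_single when_def)
  also have "\<dots> = lookup f k" by (simp add: in_keys_iff)
  finally show "lookup f k = lookup (\<Sum>t\<in>keys f. single t (lookup f t)) k" by simp
qed

lemma lookup_times_eq_sum:
  fixes f g :: "('b::comm_monoid_add) \<Rightarrow>\<^sub>0 ('k::comm_semiring_1)"
  shows "lookup (f * g) m =
    (\<Sum>(s, t)\<in>keys f \<times> keys g. if s + t = m then lookup f s * lookup g t else 0)"
proof -
  have "f * g = (\<Sum>s\<in>keys f. \<Sum>t\<in>keys g.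
      single (s + t) (lookup f s * lookup g t))"
    by (subst (1) poly_eq_sum_single[of f], subst (1) poly_eq_sum_single[of g])
      (simp only: sum_product mult_single)
  then have "lookup (f * g) m = (\<Sum>s\<in>keys f. \<Sum>t\<in>keys g.
      if s + t = m then lookup f s * lookup g t else 0)"
    by (simp add: lookup_sum lookup_single when_def)
  then show ?thesis by (simp add: sum.cartesian_product)
qed

lemma lookup_single_times:
  fixes f :: "('b::cancel_comm_monoid_add) \<Rightarrow>\<^sub>0 ('k::comm_semiring_1)"
  shows "lookup (single s c * f) (s + t) = c * lookup f t"
proof (cases "c = 0")
  case False
  have "lookup (single s c * f) (s + t) =
    (\<Sum>t'\<in>keys f. if t' = t then c * lookup f t' else 0)"
    unfolding lookup_times_eq_sum sum.cartesian_product[symmetric] using False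
    by (auto intro!: sum.cong)
  then show ?thesis by (simp add: in_keys_iff)
qed simp

lemma keys_plus_nat: "keys (s + t) = keys s \<union> keys (t :: 'a \<Rightarrow>\<^sub>0 nat)"
  by (auto simp: in_keys_iff lookup_add)

lemma keys_single_times:
  fixes f :: "('a, 'k::field) mpoly"
  shows "keys (single s 1 * f) = (\<lambda>t. s + t) ` keys f"
proof (intro equalityI subsetI)
  fix u assume "u \<in> keys (single s 1 * f)"
  then obtain t where "u = s + t"
    using keys_mult[of "single s 1" f] by auto
  then show "u \<in> (\<lambda>t. s + t) ` keys f"
    using \<open>u \<in> _\<close> lookup_single_times[of s 1 f t] by (auto simp: in_keys_iff)
next
  fix u assume "u \<in> (\<lambda>t. s + t) ` keys f"
  then show "u \<in> keys (single s 1 * f)"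
    using lookup_single_times[of s 1 f] by (auto simp: in_keys_iff)
qed

definition polys :: "'a set \<Rightarrow> ('a, 'k::field) mpoly set" where
  "polys V = {f. \<forall>t\<in>keys f. keys t \<subseteq> V}"

lemma polys_single: "keys t \<subseteq> V \<Longrightarrow> single t c \<in> polys V"
  unfolding polys_def by (simp add: in_keys_iff lookup_single when_def)

lemma subring_of_polys: "subring_of (polys V :: ('a, 'k::field) mpoly set)"
proof
  show "0 \<in> (polys V :: ('a, 'k) mpoly set)" "1 \<in> (polys V :: ('a, 'k) mpoly set)" unfolding polys_def by auto
  show "-1 \<in> (polys V :: ('a, 'k::field) mpoly set)"
    using polys_single[of 0 V "-1"] by (simp add: single_uminus)
  show "x + y \<in> polys V" if "x \<in> polys V" "y \<in> polys V" for x y :: "('a, 'k) mpoly"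
    using that keys_add[of x y] unfolding polys_def by blast
  show "x * y \<in> polys V" if xy: "x \<in> polys V" "y \<in> polys V" for x y :: "('a, 'k) mpoly"
    unfolding polys_def
  proof (intro CollectI ballI)
    fix t assume "t \<in> keys (x * y)"
    then obtain a b where "a \<in> keys x" "b \<in> keys y" "t = a + b"
      using keys_mult[of x y] by blast
    then show "keys t \<subseteq> V" using xy unfolding polys_def by (auto simp: keys_plus_nat)
  qed
qed

interpretation polys: subring_of "polys V :: ('a, 'k::field) mpoly set" for V :: "'a set"
  by (rule subring_of_polys)

lemma var_in_polys: "v \<in> V \<Longrightarrow> var v \<in> polys V"
  unfolding var_def by (rule polys_single) simp

text \<open>Membership in an ideal is checked on monomials, which is how all face ideals are handled.\<close>

lemma polys_mem_ideal:
  assumes "polys.is_ideal V J"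
    and "\<And>t. t \<in> keys f \<Longrightarrow> single t (lookup f t) \<in> J"
  shows "f \<in> J"
  by (subst poly_eq_sum_single) (rule polys.ideal_sum[OF assms])

lemma single_in_ideal:
  assumes J: "polys.is_ideal V J" and v: "var v \<in> J" "v \<in> keys t" "keys t \<subseteq> V"
  shows "single t (c::'k::field) \<in> J"
proof -
  define s where "s = t - single v 1"
  have t: "t = single v 1 + s"
    using v(2) unfolding s_def
    by (intro poly_mapping_eqI) (auto simp: lookup_add lookup_minus lookup_single when_def in_keys_iff)
  then have "keys s \<subseteq> V" using v(3) by (simp add: keys_plus_nat)
  then have "var v * single s c \<in> J" by (intro polys.ideal_mult'[OF J _ v(1)] polys_single)
  then show ?thesis unfolding var_def using t by (simp add: mult_single)
qed

lemma unit_const: "c \<noteq> 0 \<Longrightarrow> polys.unit V (single 0 (c::'k::field))"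
  unfolding polys.unit_def
  by (intro conjI bexI[of _ "single 0 (1 / c)"] polys_single) (simp_all add: mult_single)


section \<open>Face ideals\<close>

text \<open>The Stanley-Reisner ideal of \<open>\<Delta>\<close>: it is spanned by the monomials whose support is not a
  face.\<close>

definition face_ideal :: "'a set \<Rightarrow> 'a set set \<Rightarrow> ('a, 'k::field) mpoly set" where
  "face_ideal V \<Delta> = {f \<in> polys V. \<forall>t\<in>keys f. keys t \<notin> \<Delta>}"

lemma is_ideal_face_ideal:
  assumes down: "\<And>\<sigma> \<tau>. \<sigma> \<in> \<Delta> \<Longrightarrow> \<tau> \<subseteq> \<sigma> \<Longrightarrow> \<tau> \<in> \<Delta>"
  shows "polys.is_ideal V (face_ideal V \<Delta> :: ('a, 'k::field) mpoly set)"
  unfolding polys.is_ideal_def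
proof (intro conjI ballI)
  show "face_ideal V \<Delta> \<subseteq> polys V" "0 \<in> face_ideal V \<Delta>"
    unfolding face_ideal_def by (auto simp: polys.zero_closed)
next
  fix x y :: "('a, 'k) mpoly" assume "x \<in> face_ideal V \<Delta>" "y \<in> face_ideal V \<Delta>"
  then show "x + y \<in> face_ideal V \<Delta>"
    using keys_add[of x y] polys.add_closed unfolding face_ideal_def by blast
next
  fix c x :: "('a, 'k) mpoly" assume c: "c \<in> polys V" and x: "x \<in> face_ideal V \<Delta>"
  have "keys t \<notin> \<Delta>" if "t \<in> keys (c * x)" for t
  proof -
    obtain a b where "b \<in> keys x" "t = a + b"
      using keys_mult[of c x] \<open>t \<in> _\<close> by blast
    then show ?thesis using x down[of "keys t" "keys b"]
      unfolding face_ideal_def by (auto simp: keys_plus_nat)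
  qed
  then show "c * x \<in> face_ideal V \<Delta>"
    using c x polys.mult_closed unfolding face_ideal_def by blast
qed

lemma single_times_in_face_ideal:
  assumes "keys s \<subseteq> V" "f \<in> polys V"
  shows "single s 1 * f \<in> face_ideal V \<Delta> \<longleftrightarrow>
    (\<forall>t\<in>keys f. keys s \<union> keys t \<notin> \<Delta>)"
  using polys.mult_closed[OF polys_single[OF assms(1)] assms(2), of 1]
  unfolding face_ideal_def by (simp add: keys_single_times keys_plus_nat)

text \<open>The faces on the right form the star of \<open>v\<close>.\<close>

lemma colon_face_ideal_var:
  assumes "v \<in> V"
  shows "polys.colon V (face_ideal V \<Delta>) (var v) = face_ideal V {\<sigma>. insert v \<sigma> \<in> \<Delta>}"
proof -
  have "var v * f \<in> face_ideal V \<Delta> \<longleftrightarrow> f \<in> face_ideal V {\<sigma>. insert v \<sigma> \<in> \<Delta>}" if "f \<in> polys V" for f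
    unfolding var_def using single_times_in_face_ideal[of "single v 1" V f \<Delta>] assms that
    by (simp add: face_ideal_def)
  then show ?thesis unfolding polys.colon_def by (auto simp: face_ideal_def)
qed

lemma adjoin_face_ideal_var:
  fixes V :: "'a set"
  assumes v: "v \<in> V" and down: "\<And>\<sigma> \<tau>. \<sigma> \<in> \<Delta> \<Longrightarrow> \<tau> \<subseteq> \<sigma> \<Longrightarrow> \<tau> \<in> \<Delta>"
  shows "polys.adjoin V (face_ideal V \<Delta>) (var v) =
    (face_ideal V (deletion \<Delta> v) :: ('a, 'k::field) mpoly set)"
proof
  have I: "polys.is_ideal V (face_ideal V \<Delta> :: ('a, 'k) mpoly set)" using is_ideal_face_ideal down by metis
  have D: "polys.is_ideal V (face_ideal V (deletion \<Delta> v) :: ('a, 'k) mpoly set)"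
    by (rule is_ideal_face_ideal) (use down in \<open>auto simp: deletion_def\<close>)
  have A: "polys.is_ideal V (polys.adjoin V (face_ideal V \<Delta>) (var v) :: ('a, 'k) mpoly set)"
    by (rule polys.is_ideal_adjoin[OF I var_in_polys[OF v]])
  show "polys.adjoin V (face_ideal V \<Delta>) (var v) \<subseteq> (face_ideal V (deletion \<Delta> v) :: ('a, 'k) mpoly set)"
  proof (rule polys.adjoin_minimal[OF I D])
    show "face_ideal V \<Delta> \<subseteq> face_ideal V (deletion \<Delta> v)"
      unfolding face_ideal_def deletion_def by auto
    show "var v \<in> face_ideal V (deletion \<Delta> v)"
      using var_in_polys[OF v] unfolding face_ideal_def deletion_def var_def by simp
  qed
  show "(face_ideal V (deletion \<Delta> v) :: ('a, 'k) mpoly set) \<subseteq> polys.adjoin V (face_ideal V \<Delta>) (var v)"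
  proof
    fix f :: "('a, 'k) mpoly" assume f: "f \<in> face_ideal V (deletion \<Delta> v)"
    show "f \<in> polys.adjoin V (face_ideal V \<Delta>) (var v)"
    proof (rule polys_mem_ideal[OF A])
      fix t assume t: "t \<in> keys f"
      then have tV: "keys t \<subseteq> V" and td: "keys t \<notin> deletion \<Delta> v"
        using f unfolding face_ideal_def polys_def by auto
      show "single t (lookup f t) \<in> polys.adjoin V (face_ideal V \<Delta>) (var v)"
      proof (cases "v \<in> keys t")
        case True
        then show ?thesis
          using single_in_ideal[OF A _ True tV] polys.adjoin_mem[OF I polys.one_closed, of "var v"] by simp
      next
        case False
        moreover have "lookup f t \<noteq> 0" using t by (simp add: in_keys_iff)
        ultimately have "single t (lookup f t) \<in> face_ideal V \<Delta>"
          using td polys_single[OF tV, of "lookup f t"] unfolding face_ideal_def deletion_def by simp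
        then show ?thesis using polys.adjoin_superset[OF I] by blast
      qed
    qed
  qed
qed

lemma unique_sum_of_monomials:
  fixes A B :: "('a \<Rightarrow>\<^sub>0 nat) set"
  assumes "finite U" "finite A" "finite B" "A \<noteq> {}" "B \<noteq> {}"
    and "\<And>t. t \<in> A \<union> B \<Longrightarrow> keys t \<subseteq> U"
  shows "\<exists>a\<in>A. \<exists>b\<in>B. \<forall>a'\<in>A. \<forall>b'\<in>B. a' + b' = a + b \<longrightarrow> a' = a \<and> b' = b"
proof -
  have zero: "lookup t i = 0" if "t \<in> A \<union> B" "i \<notin> U" for t i
    using assms(6)[OF that(1)] that(2) by (auto simp: in_keys_iff)
  have "\<exists>a\<in>lookup ` A. \<exists>b\<in>lookup ` B. \<forall>a'\<in>lookup ` A. \<forall>b'\<in>lookup ` B.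
      (\<forall>i. a' i + b' i = a i + b i) \<longrightarrow> a' = a \<and> b' = b"
    by (rule sums_with_unique_representation[of U]) (use assms zero in \<open>simp_all, force+\<close>)
  then obtain a b where ab: "a \<in> A" "b \<in> B"
    "\<And>a' b'. a' \<in> A \<Longrightarrow> b' \<in> B \<Longrightarrow> (\<forall>i. lookup a' i + lookup b' i = lookup a i + lookup b i) \<Longrightarrow>
      lookup a' = lookup a \<and> lookup b' = lookup b"
    by blast
  have "a' = a \<and> b' = b" if "a' \<in> A" "b' \<in> B" "a' + b' = a + b" for a' b'
    using ab(3)[OF that(1,2)] that(3) by (metis lookup_add lookup_inject)
  then show ?thesis using ab(1,2) by blast
qed

text \<open>The quotient is the polynomial ring in the variables from \<open>U\<close>. A monomial of the product
  with a unique representation shows that it is a domain without ordering the variables.\<close>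

lemma is_prime_face_ideal_Pow:
  assumes U: "finite U" "U \<subseteq> V"
  shows "polys.is_prime V (face_ideal V (Pow U) :: ('a, 'k::field) mpoly set)"
  unfolding polys.is_prime_def
proof (intro conjI ballI impI)
  show "polys.is_ideal V (face_ideal V (Pow U) :: ('a, 'k) mpoly set)"
    by (rule is_ideal_face_ideal) auto
  show "1 \<notin> (face_ideal V (Pow U) :: ('a, 'k) mpoly set)"
    unfolding face_ideal_def by simp
  fix f g :: "('a, 'k) mpoly"
  assume f: "f \<in> polys V" and g: "g \<in> polys V" and fg: "f * g \<in> face_ideal V (Pow U)"
  show "f \<in> face_ideal V (Pow U) \<or> g \<in> face_ideal V (Pow U)"
  proof (rule ccontr)
    assume no: "\<not> (f \<in> face_ideal V (Pow U) \<or> g \<in> face_ideal V (Pow U))"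
    let ?A = "{t \<in> keys f. keys t \<subseteq> U}"
    let ?B = "{t \<in> keys g. keys t \<subseteq> U}"
    have "?A \<noteq> {}" "?B \<noteq> {}" using no f g unfolding face_ideal_def by auto
    then have "\<exists>a\<in>?A. \<exists>b\<in>?B. \<forall>a'\<in>?A. \<forall>b'\<in>?B. a' + b' = a + b \<longrightarrow> a' = a \<and> b' = b"
      by (intro unique_sum_of_monomials[OF U(1)]) auto
    then obtain a b where ab: "a \<in> ?A" "b \<in> ?B"
      "\<And>a' b'. a' \<in> ?A \<Longrightarrow> b' \<in> ?B \<Longrightarrow> a' + b' = a + b \<Longrightarrow> a' = a \<and> b' = b"
      by blast
    have "lookup (f * g) (a + b) = (\<Sum>p\<in>{(a, b)}. lookup f (fst p) * lookup g (snd p))"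
      unfolding lookup_times_eq_sum
    proof (rule sum.mono_neutral_cong_right)
      show "{(a, b)} \<subseteq> keys f \<times> keys g" using ab by auto
      show "\<forall>p\<in>keys f \<times> keys g - {(a, b)}.
        (case p of (s, t) \<Rightarrow> if s + t = a + b then lookup f s * lookup g t else 0) = 0"
      proof
        fix p assume p: "p \<in> keys f \<times> keys g - {(a, b)}"
        obtain s t where st: "p = (s, t)" by (cases p)
        have "s + t \<noteq> a + b"
        proof
          assume eq: "s + t = a + b"
          have "keys (s + t) \<subseteq> U" unfolding eq keys_plus_nat using ab(1,2) by auto
          then have "s \<in> ?A" "t \<in> ?B" using p st by (auto simp: keys_plus_nat)
          then show False using ab(3) eq p st by blast
        qed
        then show "(case p of (s, t) \<Rightarrow> if s + t = a + b then lookup f s * lookup g t else 0) = 0"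
          using st by simp
      qed
    qed auto
    also have "\<dots> \<noteq> 0" using ab by (simp add: in_keys_iff)
    finally have "a + b \<in> keys (f * g)" by (simp add: in_keys_iff)
    moreover have "keys (a + b) \<in> Pow U" using ab by (auto simp: keys_plus_nat)
    ultimately show False using fg unfolding face_ideal_def by blast
  qed
qed


section \<open>Algebraic relations between more polynomials than variables\<close>

text \<open>Gaussian elimination: a row \<open>y\<close> with a nonzero entry at \<open>x0\<close> is used to eliminate the
  unknown at \<open>x0\<close>.\<close>

lemma homogeneous_system_nontrivial_solution:
  fixes M :: "'x \<Rightarrow> 'y \<Rightarrow> 'k::field"
  assumes "finite Y" "finite X" "card Y < card X"
  shows "\<exists>c. (\<exists>x\<in>X. c x \<noteq> 0) \<and> (\<forall>y\<in>Y. (\<Sum>x\<in>X. c x * M x y) = 0)"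
  using assms
proof (induction Y arbitrary: X M rule: finite_induct)
  case empty
  then have "X \<noteq> {}" by auto
  then show ?case by (intro exI[of _ "\<lambda>_. 1"]) auto
next
  case (insert y Y)
  show ?case
  proof (cases "\<forall>x\<in>X. M x y = 0")
    case True
    have "card Y < card X" using insert by simp
    then obtain c where "\<exists>x\<in>X. c x \<noteq> 0" "\<forall>y\<in>Y. (\<Sum>x\<in>X. c x * M x y) = 0"
      using insert.IH[OF insert.prems(1)] by blast
    then show ?thesis using True by (intro exI[of _ c]) simp
  next
    case False
    then obtain x0 where x0: "x0 \<in> X" "M x0 y \<noteq> 0" by blast
    let ?X = "X - {x0}"
    define N where "N x z = M x z - M x y / M x0 y * M x0 z" for x z
    have "card Y < card ?X" "finite ?X" using insert x0 by auto
    then obtain c where c: "\<exists>x\<in>?X. c x \<noteq> 0" "\<forall>z\<in>Y. (\<Sum>x\<in>?X. c x * N x z) = 0"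
      using insert.IH by blast
    define c' where "c' x = (if x = x0 then - (\<Sum>x\<in>?X. c x * M x y) / M x0 y else c x)" for x
    have sum: "(\<Sum>x\<in>X. c' x * M x z) = (\<Sum>x\<in>?X. c x * N x z)" for z
    proof -
      have "(\<Sum>x\<in>X. c' x * M x z) = c' x0 * M x0 z + (\<Sum>x\<in>?X. c' x * M x z)"
        using insert.prems(1) x0(1) by (rule sum.remove)
      also have "(\<Sum>x\<in>?X. c' x * M x z) = (\<Sum>x\<in>?X. c x * M x z)"
        by (rule sum.cong) (auto simp: c'_def)
      also have "c' x0 * M x0 z = - (\<Sum>x\<in>?X. c x * (M x y / M x0 y * M x0 z))"
      proof -
        have "(\<Sum>x\<in>?X. c x * (M x y / M x0 y * M x0 z)) = (\<Sum>x\<in>?X. c x * M x y) * (M x0 z / M x0 y)"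
          unfolding sum_distrib_right by (rule sum.cong) simp_all
        then show ?thesis unfolding c'_def by simp
      qed
      finally show ?thesis
        unfolding N_def by (simp add: right_diff_distrib sum_subtractf)
    qed
    have "N x y = 0" for x using x0(2) unfolding N_def by simp
    then have "\<forall>z\<in>insert y Y. (\<Sum>x\<in>X. c' x * M x z) = 0" unfolding sum using c(2) by simp
    moreover have "\<exists>x\<in>X. c' x \<noteq> 0" using c(1) unfolding c'_def by auto
    ultimately show ?thesis by blast
  qed
qed

definition exponents_le :: "nat \<Rightarrow> ('a, 'k::field) mpoly \<Rightarrow> bool" where
  "exponents_le n f \<longleftrightarrow> (\<forall>t\<in>keys f. \<forall>v. lookup t v \<le> n)"

lemma exponents_le_mult: "exponents_le m f \<Longrightarrow> exponents_le n g \<Longrightarrow> exponents_le (m + n) (f * g)"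
  unfolding exponents_le_def
proof (intro ballI allI)
  fix t v assume fg: "\<forall>t\<in>keys f. \<forall>v. lookup t v \<le> m"
    "\<forall>t\<in>keys g. \<forall>v. lookup t v \<le> n" and "t \<in> keys (f * g)"
  then obtain a b where "a \<in> keys f" "b \<in> keys g" "t = a + b"
    using keys_mult[of f g] by blast
  then show "lookup t v \<le> m + n" using fg by (simp add: lookup_add add_mono)
qed

lemma exponents_le_one: "exponents_le n 1"
  unfolding exponents_le_def by simp

lemma exponents_le_mono: "exponents_le m f \<Longrightarrow> m \<le> n \<Longrightarrow> exponents_le n f"
  unfolding exponents_le_def using order_trans by blast

lemma exponents_le_power: "exponents_le m f \<Longrightarrow> exponents_le (k * m) (f ^ k)"
  by (induction k) (auto simp: exponents_le_one intro: exponents_le_mult)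

lemma exponents_le_monomial:
  assumes "\<And>i. i < r \<Longrightarrow> exponents_le e (f i)" "\<And>i. i < r \<Longrightarrow> a i \<le> s"
  shows "exponents_le (r * (s * e)) (monomial f r a)"
  using assms
proof (induction r)
  case 0
  then show ?case by (simp add: monomial_def exponents_le_one)
next
  case (Suc r)
  have "exponents_le (a r * e) (f r ^ a r)" using Suc.prems by (intro exponents_le_power) simp
  then have "exponents_le (s * e) (f r ^ a r)"
    using Suc.prems(2)[of r] by (elim exponents_le_mono) simp
  moreover have "exponents_le (r * (s * e)) (monomial f r a)" using Suc by simp
  ultimately have "exponents_le (r * (s * e) + s * e) (monomial f r a * f r ^ a r)"
    by (intro exponents_le_mult)
  then show ?case by (simp add: monomial_def add.commute)
qed

lemma ex_exponents_le:
  fixes f :: "nat \<Rightarrow> ('a, 'k::field) mpoly"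
  shows "\<exists>e. \<forall>i<r. exponents_le e (f i)"
proof (induction r)
  case (Suc r)
  then obtain e where e: "\<forall>i<r. exponents_le e (f i)" by blast
  let ?S = "\<Union>t\<in>keys (f r). lookup t ` keys t"
  have fin: "finite (insert e ?S)" by simp
  have "exponents_le (Max (insert e ?S)) (f i)" if "i < Suc r" for i
  proof (cases "i < r")
    case True
    then show ?thesis using e fin by (meson Max_ge exponents_le_mono insertI1)
  next
    case False
    then have i: "i = r" using that by simp
    show ?thesis
      unfolding exponents_le_def i
    proof (intro ballI allI)
      fix t v assume t: "t \<in> keys (f r)"
      show "lookup t v \<le> Max (insert e ?S)"
      proof (cases "v \<in> keys t")
        case True
        then have "lookup t v \<in> insert e ?S" using t by blast
        then show ?thesis using Max_ge[OF fin] by blast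
      qed (simp add: in_keys_iff)
    qed
  qed
  then show ?case by blast
qed simp

lemma card_monomials_le:
  assumes "finite U"
  shows "finite {t :: 'a \<Rightarrow>\<^sub>0 nat. keys t \<subseteq> U \<and> (\<forall>v. lookup t v \<le> D)}" (is "finite ?Y")
    and "card {t :: 'a \<Rightarrow>\<^sub>0 nat. keys t \<subseteq> U \<and> (\<forall>v. lookup t v \<le> D)} \<le> (D + 1) ^ card U"
proof -
  let ?r = "\<lambda>t :: 'a \<Rightarrow>\<^sub>0 nat. restrict (lookup t) U"
  have inj: "inj_on ?r ?Y"
  proof (rule inj_onI, rule poly_mapping_eqI)
    fix s t v assume st: "s \<in> ?Y" "t \<in> ?Y" "?r s = ?r t"
    show "lookup s v = lookup t v"
    proof (cases "v \<in> U")
      case True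
      then show ?thesis using fun_cong[OF st(3), of v] by simp
    next
      case False
      then have "v \<notin> keys s" "v \<notin> keys t" using st(1,2) by blast+
      then show ?thesis by (simp add: in_keys_iff)
    qed
  qed
  have im: "?r ` ?Y \<subseteq> U \<rightarrow>\<^sub>E {..D}" by auto
  have fin: "finite (U \<rightarrow>\<^sub>E {..D})" using assms by (simp add: finite_PiE)
  show "finite ?Y" using inj im fin by (meson finite_imageD finite_subset)
  have "card ?Y \<le> card (U \<rightarrow>\<^sub>E {..D})" using card_inj_on_le[OF inj im fin] .
  also have "\<dots> = (D + 1) ^ card U" using assms by (simp add: card_PiE)
  finally show "card ?Y \<le> (D + 1) ^ card U" .
qed

lemma card_exponent_box:
  fixes r s :: nat
  defines "X \<equiv> {a :: nat \<Rightarrow> nat. (\<forall>i<r. a i \<le> s) \<and> (\<forall>i\<ge>r. a i = 0)}"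
  shows "finite X" "card X = (s + 1) ^ r"
proof -
  let ?g = "\<lambda>a i. if i < r then a i else 0 :: nat"
  have "X = ?g ` ({..<r} \<rightarrow>\<^sub>E {..s})"
  proof (intro equalityI subsetI)
    fix a assume a: "a \<in> X"
    then have "a = ?g (restrict a {..<r})" unfolding X_def by (auto simp: fun_eq_iff)
    moreover have "restrict a {..<r} \<in> {..<r} \<rightarrow>\<^sub>E {..s}" using a unfolding X_def by auto
    ultimately show "a \<in> ?g ` ({..<r} \<rightarrow>\<^sub>E {..s})" by blast
  next
    fix a assume "a \<in> ?g ` ({..<r} \<rightarrow>\<^sub>E {..s})"
    then obtain b where "b \<in> {..<r} \<rightarrow>\<^sub>E {..s}" "a = ?g b" by blast
    then show "a \<in> X" unfolding X_def using PiE_mem[of b "{..<r}" "\<lambda>_. {..s}"] by simp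
  qed
  moreover have "inj_on ?g ({..<r} \<rightarrow>\<^sub>E {..s})"
  proof (rule inj_onI)
    fix a b assume ab: "a \<in> {..<r} \<rightarrow>\<^sub>E {..s}" "b \<in> {..<r} \<rightarrow>\<^sub>E {..s}" and eq: "?g a = ?g b"
    have "a i = b i" if "i \<in> {..<r}" for i using fun_cong[OF eq, of i] that by simp
    then show "a = b" using ab by (intro PiE_ext)
  qed
  moreover have "finite ({..<r} \<rightarrow>\<^sub>E {..s})" by (simp add: finite_PiE)
  moreover have "card ({..<r} \<rightarrow>\<^sub>E {..s}) = (s + 1) ^ r" by (simp add: card_PiE)
  ultimately show "finite X" "card X = (s + 1) ^ r" by (simp_all add: card_image)
qed

text \<open>For \<open>s = (r * e + 1) ^ d\<close> the left-hand side is at most \<open>s * (s + 1) ^ d\<close>.\<close>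

lemma polynomial_growth:
  fixes d r e :: nat
  assumes "d < r"
  shows "\<exists>s. (r * (s * e) + 1) ^ d < (s + 1) ^ r"
proof -
  define m where "m = r * e + 1"
  define s where "s = m ^ d"
  have "r * (s * e) + 1 \<le> m * (s + 1)" unfolding m_def by (simp add: algebra_simps)
  then have "(r * (s * e) + 1) ^ d \<le> (m * (s + 1)) ^ d" by (rule power_mono) simp
  also have "\<dots> = m ^ d * (s + 1) ^ d" by (rule power_mult_distrib)
  also have "\<dots> = s * (s + 1) ^ d" unfolding s_def ..
  also have "\<dots> < (s + 1) ^ Suc d" by simp
  also have "\<dots> \<le> (s + 1) ^ r" using assms by (intro power_increasing) auto
  finally show ?thesis by blast
qed

text \<open>The \<open>(s + 1)\<^sup>r\<close> monomials in the \<open>f i\<close> with exponents at most \<open>s\<close> involve, after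
  removing all variables outside \<open>U\<close>, only monomials whose exponents are linear in
  \<open>s\<close>. For large \<open>s\<close> these are fewer, so there is a linear dependence.\<close>

lemma ex_algebraic_relation:
  fixes f :: "nat \<Rightarrow> ('a, 'k::field) mpoly"
  assumes U: "finite U" "card U < r" and f: "\<And>i. f i \<in> polys V"
  shows "\<exists>T \<kappa>. finite T \<and> T \<noteq> {} \<and> (\<forall>a\<in>T. \<forall>i\<ge>r. a i = 0) \<and> (\<forall>a\<in>T. \<kappa> a \<noteq> 0) \<and>
    (\<Sum>a\<in>T. single 0 (\<kappa> a) * monomial f r a) \<in> face_ideal V (Pow U)"
proof -
  obtain e where e: "\<forall>i<r. exponents_le e (f i)" using ex_exponents_le by blast
  obtain s where s: "(r * (s * e) + 1) ^ card U < (s + 1) ^ r"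
    using polynomial_growth[OF U(2)] by blast
  define D where "D = r * (s * e)"
  define X where "X = {a :: nat \<Rightarrow> nat. (\<forall>i<r. a i \<le> s) \<and> (\<forall>i\<ge>r. a i = 0)}"
  define Y where "Y = {t :: 'a \<Rightarrow>\<^sub>0 nat. keys t \<subseteq> U \<and> (\<forall>v. lookup t v \<le> D)}"
  have X: "finite X" "card X = (s + 1) ^ r" unfolding X_def by (rule card_exponent_box)+
  have Y: "finite Y" "card Y \<le> (D + 1) ^ card U" unfolding Y_def by (rule card_monomials_le[OF U(1)])+
  have "card Y < card X" using Y(2) s X(2) unfolding D_def by simp
  then obtain c where c: "\<exists>a\<in>X. c a \<noteq> 0" "\<forall>t\<in>Y. (\<Sum>a\<in>X. c a * lookup (monomial f r a) t) = 0"
    using homogeneous_system_nontrivial_solution[OF Y(1) X(1), of "\<lambda>a t. lookup (monomial f r a) t"] by blast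
  define T where "T = {a \<in> X. c a \<noteq> 0}"
  define g where "g = (\<Sum>a\<in>T. single 0 (c a) * monomial f r a)"
  have look: "lookup g t = (\<Sum>a\<in>X. c a * lookup (monomial f r a) t)" for t
  proof -
    have "lookup g t = (\<Sum>a\<in>T. c a * lookup (monomial f r a) t)"
      unfolding g_def lookup_sum
      by (rule sum.cong) (use lookup_single_times[of 0 _ _ t] in simp_all)
    also have "\<dots> = (\<Sum>a\<in>X. c a * lookup (monomial f r a) t)"
      by (rule sum.mono_neutral_left) (use X in \<open>auto simp: T_def\<close>)
    finally show ?thesis .
  qed
  have "keys t \<notin> Pow U" if t: "t \<in> keys g" for t
  proof
    assume tU: "keys t \<in> Pow U"
    have "lookup g t \<noteq> 0" using t by (simp add: in_keys_iff)
    then have "\<exists>a\<in>X. c a * lookup (monomial f r a) t \<noteq> 0"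
      unfolding look by (meson sum.neutral)
    then obtain a where a: "a \<in> X" "t \<in> keys (monomial f r a)"
      by (auto simp: in_keys_iff)
    have "exponents_le D (monomial f r a)"
      unfolding D_def by (rule exponents_le_monomial) (use e a in \<open>auto simp: X_def\<close>)
    then have "t \<in> Y" using tU a(2) unfolding exponents_le_def Y_def by blast
    then show False using \<open>lookup g t \<noteq> 0\<close> c(2) unfolding look by blast
  qed
  moreover have "g \<in> polys V"
    unfolding g_def
    by (intro polys.sum_closed polys.mult_closed polys.monomial_closed f polys_single) simp
  ultimately have "g \<in> face_ideal V (Pow U)" unfolding face_ideal_def by blast
  moreover have "finite T" using X(1) unfolding T_def by simp
  moreover have "T \<noteq> {}" "\<forall>a\<in>T. \<forall>i\<ge>r. a i = 0" "\<forall>a\<in>T. c a \<noteq> 0"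
    using c(1) unfolding T_def X_def by auto
  ultimately show ?thesis unfolding g_def by blast
qed

section \<open>Ideals of quotient rings\<close>

lemma Quot_image_mem_iff:
  fixes R (structure)
  assumes "ring R" "ideal I R" "ideal J R" "I \<subseteq> J" "a \<in> carrier R"
  shows "I +>\<^bsub>R\<^esub> a \<in> (+>\<^bsub>R\<^esub>) I ` J \<longleftrightarrow> a \<in> J"
proof -
  interpret ring R by fact
  have "ideal ((+>) I ` J) (R Quot I)" by (rule ring_ideal_imp_quot_ideal[OF assms(2,3)])
  then have "(+>) I ` J \<subseteq> carrier (R Quot I)"
    by (rule additive_subgroup.a_subset[OF ideal.axioms(1)])
  then have "a \<in> \<Union> ((+>) I ` J) \<longleftrightarrow> I +> a \<in> (+>) I ` J"
    by (rule canonical_proj_vimage_mem_iff[OF assms(2) _ assms(5)])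
  moreover have "\<Union> ((+>) I ` J) = J" using ideal_incl_iff[OF assms(2,3)] assms(4) by simp
  ultimately show ?thesis by simp
qed

lemma genideal_Quot_mem_iff:
  fixes R (structure)
  assumes "ring R" "ideal I R" "X \<subseteq> carrier R" "a \<in> carrier R"
  shows "I +>\<^bsub>R\<^esub> a \<in> genideal (R Quot I) ((+>\<^bsub>R\<^esub>) I ` X) \<longleftrightarrow> a \<in> genideal R (I \<union> X)"
proof -
  interpret ring R by fact
  interpret I: ideal I R by fact
  interpret Q: ring "R Quot I" by (rule I.quotient_is_ring)
  interpret h: ring_hom_ring R "R Quot I" "(+>) I" by (rule I.rcos_ring_hom_ring)
  let ?G = "genideal (R Quot I) ((+>) I ` X)" and ?H = "genideal R (I \<union> X)"
  have X: "(+>) I ` X \<subseteq> carrier (R Quot I)" using assms(3) h.hom_closed by blast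
  have G: "ideal ?G (R Quot I)" by (rule Q.genideal_ideal[OF X])
  have IX: "I \<union> X \<subseteq> carrier R" using assms(3) I.a_subset by blast
  have H: "ideal ?H R" "I \<subseteq> ?H" "X \<subseteq> ?H"
    using genideal_ideal[OF IX] genideal_self[OF IX] by auto
  have "?H \<subseteq> {r \<in> carrier R. I +> r \<in> ?G}"
  proof (rule genideal_minimal[OF h.ideal_vimage[OF G]])
    have "I +> r \<in> ?G" if "r \<in> I" for r
    proof -
      have "I +> r = \<zero>\<^bsub>R Quot I\<^esub>" using I.a_rcos_const[OF that] unfolding FactRing_def by simp
      then show ?thesis using additive_subgroup.zero_closed[OF ideal.axioms(1)[OF G]] by simp
    qed
    moreover have "I +> r \<in> ?G" if "r \<in> X" for r using Q.genideal_self[OF X] that by blast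
    ultimately show "I \<union> X \<subseteq> {r \<in> carrier R. I +> r \<in> ?G}" using IX by blast
  qed
  moreover have "?G \<subseteq> (+>) I ` ?H"
    by (rule Q.genideal_minimal[OF ring_ideal_imp_quot_ideal[OF assms(2) H(1)]]) (use H(3) in blast)
  ultimately show ?thesis
    using Quot_image_mem_iff[OF assms(1,2) H(1,2) assms(4)] assms(4) by blast
qed

lemma carrier_Quot: "carrier (R Quot I) = (+>\<^bsub>R\<^esub>) I ` carrier R"
  unfolding FactRing_def A_RCOSETS_def' by auto

lemma primeideal_Quot_image:
  fixes R (structure)
  assumes "cring R" "ideal I R" "primeideal J R" "I \<subseteq> J"
  shows "primeideal ((+>\<^bsub>R\<^esub>) I ` J) (R Quot I)"
proof -
  interpret cring R by fact
  interpret I: ideal I R by fact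
  interpret J: primeideal J R by fact
  interpret h: ring_hom_ring R "R Quot I" "(+>) I" by (rule I.rcos_ring_hom_ring)
  note mem = Quot_image_mem_iff[OF ring_axioms assms(2) J.is_ideal assms(4)]
  show ?thesis
  proof (rule primeidealI)
    show "ideal ((+>) I ` J) (R Quot I)" by (rule ring_ideal_imp_quot_ideal[OF assms(2) J.is_ideal])
    show "cring (R Quot I)" by (rule I.quotient_is_cring[OF assms(1)])
    show "carrier (R Quot I) \<noteq> (+>) I ` J"
    proof
      assume eq: "carrier (R Quot I) = (+>) I ` J"
      have "carrier R \<subseteq> J"
      proof
        fix r assume r: "r \<in> carrier R"
        then have "I +> r \<in> (+>) I ` J" using h.hom_closed eq by simp
        then show "r \<in> J" using mem[OF r] by (rule iffD1[rotated])
      qed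
      then show False using J.I_notcarr J.a_subset by blast
    qed
    fix a b assume "a \<in> carrier (R Quot I)" "b \<in> carrier (R Quot I)" and ab: "a \<otimes>\<^bsub>R Quot I\<^esub> b \<in> (+>) I ` J"
    then obtain x y where xy: "x \<in> carrier R" "y \<in> carrier R" "a = I +> x" "b = I +> y"
      unfolding carrier_Quot by blast
    then have "I +> (x \<otimes> y) \<in> (+>) I ` J" using ab h.hom_mult by simp
    then have "x \<otimes> y \<in> J" using mem[OF m_closed[OF xy(1,2)]] by (rule iffD1[rotated])
    then have "x \<in> J \<or> y \<in> J" using J.I_prime xy by blast
    then show "a \<in> (+>) I ` J \<or> b \<in> (+>) I ` J" using xy by blast
  qed
qed


section \<open>The ring of polynomials and its ideals\<close>

lemma poly_ring_simps [simp]: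
  "carrier (poly_ring V) = polys V" "x \<otimes>\<^bsub>poly_ring V\<^esub> y = x * y" "x \<oplus>\<^bsub>poly_ring V\<^esub> y = x + y"
  "\<one>\<^bsub>poly_ring V\<^esub> = 1" "\<zero>\<^bsub>poly_ring V\<^esub> = 0"
  unfolding poly_ring_def polys_def by simp_all

lemma cring_poly_ring: "cring (poly_ring V :: ('a, 'k::field) mpoly ring)"
proof (rule cringI)
  show "abelian_group (poly_ring V :: ('a, 'k) mpoly ring)"
  proof (rule abelian_groupI)
    fix x :: "('a, 'k) mpoly" assume "x \<in> carrier (poly_ring V)"
    then show "\<exists>y\<in>carrier (poly_ring V). y \<oplus>\<^bsub>poly_ring V\<^esub> x = \<zero>\<^bsub>poly_ring V\<^esub>"
      by (intro bexI[of _ "- x"]) (simp_all add: polys.uminus_closed)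
  qed (simp_all add: polys.add_closed polys.zero_closed algebra_simps)
  show "comm_monoid (poly_ring V :: ('a, 'k) mpoly ring)"
    by (rule comm_monoidI) (simp_all add: polys.mult_closed polys.one_closed algebra_simps)
qed (simp add: algebra_simps)

lemma a_inv_poly_ring: "x \<in> polys V \<Longrightarrow> \<ominus>\<^bsub>poly_ring V\<^esub> x = - (x :: ('a, 'k::field) mpoly)"
proof -
  interpret cring "poly_ring V :: ('a, 'k) mpoly ring" by (rule cring_poly_ring)
  show "x \<in> polys V \<Longrightarrow> \<ominus>\<^bsub>poly_ring V\<^esub> x = - x"
    using minus_equality[of "- x" x] by (simp add: polys.uminus_closed)
qed

lemma ideal_poly_ring_iff:
  "ideal J (poly_ring V :: ('a, 'k::field) mpoly ring) \<longleftrightarrow> polys.is_ideal V J"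
proof
  assume "ideal J (poly_ring V :: ('a, 'k) mpoly ring)"
  then interpret ideal J "poly_ring V :: ('a, 'k) mpoly ring" .
  show "polys.is_ideal V J"
    unfolding polys.is_ideal_def
    using a_subset I_l_closed additive_subgroup.zero_closed[OF additive_subgroup_axioms]
      additive_subgroup.a_closed[OF additive_subgroup_axioms] by auto
next
  assume J: "polys.is_ideal V J"
  interpret cring "poly_ring V :: ('a, 'k) mpoly ring" by (rule cring_poly_ring)
  show "ideal J (poly_ring V :: ('a, 'k) mpoly ring)"
  proof (rule idealI)
    show "subgroup J (add_monoid (poly_ring V :: ('a, 'k) mpoly ring))"
    proof
      show "inv\<^bsub>add_monoid (poly_ring V)\<^esub> x \<in> J" if "x \<in> J" for x
        using a_inv_poly_ring[OF polys.ideal_closed[OF J that]] polys.ideal_uminus[OF J that]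
        unfolding a_inv_def by simp
    qed (use polys.ideal_closed[OF J] polys.ideal_add[OF J] polys.ideal_zero[OF J] in auto)
  qed (use polys.ideal_mult[OF J] polys.ideal_mult'[OF J] ring_axioms in auto)
qed

lemma primeideal_poly_ring_iff:
  "primeideal P (poly_ring V :: ('a, 'k::field) mpoly ring) \<longleftrightarrow> polys.is_prime V P"
proof
  assume "primeideal P (poly_ring V :: ('a, 'k) mpoly ring)"
  then interpret primeideal P "poly_ring V :: ('a, 'k) mpoly ring" .
  have "1 \<notin> P" using one_imp_carrier I_notcarr by auto
  then show "polys.is_prime V P"
    using is_ideal I_prime unfolding polys.is_prime_def ideal_poly_ring_iff by auto
next
  assume P: "polys.is_prime V P"
  show "primeideal P (poly_ring V :: ('a, 'k) mpoly ring)"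
  proof (rule primeidealI)
    show "ideal P (poly_ring V)" using P unfolding ideal_poly_ring_iff polys.is_prime_def by blast
    show "cring (poly_ring V :: ('a, 'k) mpoly ring)" by (rule cring_poly_ring)
    show "carrier (poly_ring V) \<noteq> P" using P polys.one_closed[of V] unfolding polys.is_prime_def by auto
  qed (use P in \<open>auto simp: polys.is_prime_def\<close>)
qed

lemma genideal_poly_ring_eqI:
  assumes "polys.is_ideal V J" "X \<subseteq> J"
    and "\<And>J'. polys.is_ideal V J' \<Longrightarrow> X \<subseteq> J' \<Longrightarrow> J \<subseteq> J'"
  shows "genideal (poly_ring V :: ('a, 'k::field) mpoly ring) X = J"
  using assms unfolding genideal_def ideal_poly_ring_iff by blast

text \<open>A support that is not independent contains both ends of an edge, so the monomial is divisible by
  a generator.\<close>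

lemma edge_ideal_eq_face_ideal:
  assumes simple: "simple_graph V E"
  shows "edge_ideal V E = (face_ideal V (independent_sets V E) :: ('a, 'k::field) mpoly set)"
  unfolding edge_ideal_def
proof (rule genideal_poly_ring_eqI)
  show "polys.is_ideal V (face_ideal V (independent_sets V E) :: ('a, 'k) mpoly set)"
    by (rule is_ideal_face_ideal) (rule independent_sets_subset)
  show "{var u * var v |u v. {u, v} \<in> E} \<subseteq> (face_ideal V (independent_sets V E) :: ('a, 'k) mpoly set)"
  proof
    fix f :: "('a, 'k) mpoly" assume "f \<in> {var u * var v |u v. {u, v} \<in> E}"
    then obtain u v where uv: "f = var u * var v" "{u, v} \<in> E" by blast
    then have "u \<in> V" "v \<in> V" using simple unfolding simple_graph_def by auto
    then have "f \<in> polys V" unfolding uv(1) by (intro polys.mult_closed var_in_polys)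
    moreover have "keys f = {single u 1 + single v 1}"
      unfolding uv(1) var_def by (simp add: mult_single)
    ultimately show "f \<in> face_ideal V (independent_sets V E)"
      using uv(2) unfolding face_ideal_def independent_sets_def by (auto simp: keys_plus_nat)
  qed
  fix J :: "('a, 'k) mpoly set"
  assume J: "polys.is_ideal V J" and X: "{var u * var v |u v. {u, v} \<in> E} \<subseteq> J"
  show "face_ideal V (independent_sets V E) \<subseteq> J"
  proof
    fix f :: "('a, 'k) mpoly" assume f: "f \<in> face_ideal V (independent_sets V E)"
    show "f \<in> J"
    proof (rule polys_mem_ideal[OF J])
      fix t assume t: "t \<in> keys f"
      then have tV: "keys t \<subseteq> V" and "keys t \<notin> independent_sets V E"
        using f unfolding face_ideal_def polys_def by auto
      then obtain u v where uv: "u \<in> keys t" "v \<in> keys t" "{u, v} \<in> E"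
        unfolding independent_sets_def by blast
      have "u \<noteq> v" using simple uv(3) unfolding simple_graph_def by fastforce
      define s where "s = t - (single u 1 + single v 1)"
      have ts: "t = (single u 1 + single v 1) + s"
        using uv(1,2) \<open>u \<noteq> v\<close> unfolding s_def
        by (intro poly_mapping_eqI) (auto simp: lookup_add lookup_minus lookup_single when_def in_keys_iff)
      then have "keys s \<subseteq> V" using tV by (simp add: keys_plus_nat)
      then have "single s (lookup f t) \<in> polys V" by (rule polys_single)
      moreover have "var u * var v \<in> J" using X uv(3) by blast
      ultimately have "single s (lookup f t) * (var u * var v) \<in> J" by (rule polys.ideal_mult[OF J])
      then show "single t (lookup f t) \<in> J"
        unfolding var_def ts[symmetric] by (subst ts) (simp add: mult_single ac_simps)
    qed
  qed
qed

lemma genideal_adjoin_upto: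
  assumes I: "polys.is_ideal V I" and f: "\<And>i. f i \<in> polys V"
  shows "genideal (poly_ring V :: ('a, 'k::field) mpoly ring) (I \<union> f ` {..<r}) = polys.adjoin_upto V I f r"
proof (rule genideal_poly_ring_eqI)
  show "polys.is_ideal V (polys.adjoin_upto V I f r)" by (rule polys.is_ideal_adjoin_upto[OF I f])
  show "I \<union> f ` {..<r} \<subseteq> polys.adjoin_upto V I f r"
    using polys.adjoin_upto_superset[where f = f, OF I f] polys.adjoin_upto_mem[where f = f, OF I f] by blast
  show "polys.adjoin_upto V I f r \<subseteq> J" if "polys.is_ideal V J" "I \<union> f ` {..<r} \<subseteq> J" for J
    by (rule polys.adjoin_upto_minimal[OF I f that(1)]) (use that(2) in auto)
qed

text \<open>The translation of regular sequences of cosets into the language of the previous sections.\<close>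

lemma regular_sequence_Quot_iff:
  fixes I :: "('a, 'k::field) mpoly set"
  assumes I: "polys.is_ideal V I" and f: "\<And>i. f i \<in> polys V"
  shows "regular_sequence (poly_ring V Quot I) (map (\<lambda>i. I +>\<^bsub>poly_ring V\<^esub> f i) [0..<r]) \<longleftrightarrow>
    1 \<notin> polys.adjoin_upto V I f r \<and> polys.regular V I f r"
proof -
  interpret cring "poly_ring V :: ('a, 'k) mpoly ring" by (rule cring_poly_ring)
  have iI: "ideal I (poly_ring V)" using I unfolding ideal_poly_ring_iff .
  interpret I: ideal I "poly_ring V" by (rule iI)
  interpret h: ring_hom_ring "poly_ring V" "poly_ring V Quot I" "(+>\<^bsub>poly_ring V\<^esub>) I"
    by (rule I.rcos_ring_hom_ring)
  let ?Q = "poly_ring V Quot I" and ?h = "(+>\<^bsub>poly_ring V\<^esub>) I"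
  let ?fs = "map (\<lambda>i. ?h (f i)) [0..<r]"
  have gen: "?h x \<in> genideal ?Q (set (take i ?fs)) \<longleftrightarrow> x \<in> polys.adjoin_upto V I f i"
    if "i \<le> r" "x \<in> polys V" for i x
  proof -
    have "set (take i ?fs) = ?h ` (f ` {..<i})"
      using that(1) by (simp add: take_map image_image atLeast0LessThan)
    then show ?thesis
      using genideal_Quot_mem_iff[OF ring_axioms iI, of "f ` {..<i}" x] f that(2)
      by (simp add: genideal_adjoin_upto[OF I f] image_subset_iff)
  qed
  have sub: "set ?fs \<subseteq> carrier ?Q" using f h.hom_closed by auto
  have "\<one>\<^bsub>?Q\<^esub> \<in> carrier ?Q" using h.hom_closed[of 1] h.hom_one polys.one_closed by simp
  then have "genideal ?Q (set ?fs) \<noteq> carrier ?Q \<longleftrightarrow> \<one>\<^bsub>?Q\<^esub> \<notin> genideal ?Q (set ?fs)"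
    using ideal.one_imp_carrier[OF ring.genideal_ideal[OF I.quotient_is_ring sub]] by metis
  also have "\<dots> \<longleftrightarrow> 1 \<notin> polys.adjoin_upto V I f r"
    using gen[of r 1] polys.one_closed[of V] h.hom_one by simp
  finally have 1: "genideal ?Q (set ?fs) \<noteq> carrier ?Q \<longleftrightarrow> 1 \<notin> polys.adjoin_upto V I f r" .
  have "(\<forall>y\<in>carrier ?Q. ?fs ! i \<otimes>\<^bsub>?Q\<^esub> y \<in> genideal ?Q (set (take i ?fs)) \<longrightarrow> y \<in> genideal ?Q (set (take i ?fs)))
    \<longleftrightarrow> (\<forall>x\<in>polys V. f i * x \<in> polys.adjoin_upto V I f i \<longrightarrow> x \<in> polys.adjoin_upto V I f i)"
    if i: "i < r" for i
  proof -
    have "?fs ! i \<otimes>\<^bsub>?Q\<^esub> ?h x = ?h (f i * x)" if "x \<in> polys V" for x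
      using i that f h.hom_mult[of "f i" x] by simp
    moreover have "f i * x \<in> polys V" if "x \<in> polys V" for x using that f polys.mult_closed by blast
    ultimately show ?thesis
      using gen[of i] i unfolding carrier_Quot by simp
  qed
  then show ?thesis
    unfolding regular_sequence_def polys.regular_def using 1 sub by simp
qed


section \<open>The Krull dimension of an edge ring\<close>

text \<open>The variables outside \<open>U\<close> generate a prime containing the edge ideal, and adding the
  variables from \<open>U\<close> one at a time gives a chain of the required length.\<close>

lemma independent_set_le_krull_dim:
  assumes simple: "simple_graph V E" and U: "U \<in> independent_sets V E"
  shows "enat (card U) \<le> krull_dim (edge_ring V E :: ('a, 'k::field) mpoly set ring)"
proof -
  let ?R = "poly_ring V :: ('a, 'k) mpoly ring"
  let ?I = "edge_ideal V E :: ('a, 'k) mpoly set"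
  have UV: "U \<subseteq> V" "finite U"
    using U simple finite_subset unfolding independent_sets_def simple_graph_def by auto
  obtain us where us: "set us = U" "distinct us" using finite_distinct_list[OF UV(2)] by blast
  have n: "length us = card U" using us distinct_card by metis
  define J where "J i = (face_ideal V (Pow (set (drop i us))) :: ('a, 'k) mpoly set)" for i
  have sub: "set (drop i us) \<subseteq> U" for i using us(1) set_drop_subset by metis
  have I: "polys.is_ideal V ?I" "?I = face_ideal V (independent_sets V E)"
    unfolding edge_ideal_eq_face_ideal[OF simple]
    using is_ideal_face_ideal[OF independent_sets_subset] by auto
  have prime: "primeideal (J i) ?R" for i
    unfolding J_def primeideal_poly_ring_iff
    by (rule is_prime_face_ideal_Pow) (use sub UV in auto)
  have IJ: "?I \<subseteq> J i" for i
    using independent_sets_subset[OF _ U] sub[of i] unfolding I(2) J_def face_ideal_def by blast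
  let ?h = "(+>\<^bsub>?R\<^esub>) ?I"
  have iI: "ideal ?I ?R" using I(1) unfolding ideal_poly_ring_iff .
  have mem: "?h a \<in> ?h ` J i \<longleftrightarrow> a \<in> J i" if "a \<in> polys V" for a i
    using Quot_image_mem_iff[OF cring.axioms(1)[OF cring_poly_ring] iI primeideal.axioms(1)[OF prime] IJ] that
    by simp
  have strict: "?h ` J i \<subset> ?h ` J (Suc i)" if i: "i < card U" for i
  proof
    have dr: "drop i us = us ! i # drop (Suc i) us" using i n by (simp add: Cons_nth_drop_Suc)
    then have "J i \<subseteq> J (Suc i)" unfolding J_def face_ideal_def by auto
    then show "?h ` J i \<subseteq> ?h ` J (Suc i)" by (rule image_mono)
    have v: "us ! i \<in> V" using i n us(1) UV(1) nth_mem by (metis subsetD)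
    have "us ! i \<notin> set (drop (Suc i) us)"
      using us(2) dr by (metis distinct.simps(2) distinct_drop)
    then have var: "var (us ! i) \<in> J (Suc i)" "var (us ! i) \<notin> J i"
      using dr var_in_polys[OF v, where 'b = 'k] unfolding J_def face_ideal_def var_def by auto
    have "?h (var (us ! i)) \<in> ?h ` J (Suc i)" using var(1) by (rule imageI)
    moreover have "?h (var (us ! i)) \<notin> ?h ` J i" using mem[OF var_in_polys[OF v]] var(2) by simp
    ultimately show "?h ` J i \<noteq> ?h ` J (Suc i)" by metis
  qed
  define P where "P i = ?h ` J i" for i
  have "primeideal (P i) (edge_ring V E)" for i
    unfolding edge_ring_def P_def by (rule primeideal_Quot_image[OF cring_poly_ring iI prime IJ])
  moreover have "P i \<subset> P (Suc i)" if "i < card U" for i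
    unfolding P_def by (rule strict[OF that])
  ultimately show ?thesis unfolding krull_dim_def by (intro Sup_upper) blast
qed

lemma face_ideal_Pow_subset_prime:
  assumes P: "polys.is_prime V P" and U: "U \<subseteq> V" and var: "\<And>v. v \<in> V - U \<Longrightarrow> var v \<in> P"
  shows "face_ideal V (Pow U) \<subseteq> (P :: ('a, 'k::field) mpoly set)"
proof
  fix f :: "('a, 'k) mpoly" assume f: "f \<in> face_ideal V (Pow U)"
  have J: "polys.is_ideal V P" using P unfolding polys.is_prime_def by blast
  show "f \<in> P"
  proof (rule polys_mem_ideal[OF J])
    fix t assume "t \<in> keys f"
    then have t: "keys t \<subseteq> V" "\<not> keys t \<subseteq> U" using f unfolding face_ideal_def polys_def by auto
    then obtain v where v: "v \<in> keys t" "v \<in> V - U" by blast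
    show "single t (lookup f t) \<in> P" by (rule single_in_ideal[OF J var[OF v(2)] v(1) t(1)])
  qed
qed

text \<open>The lowest prime of a chain contains one end of every edge, so the vertices whose variables it
  does not contain form an independent set \<open>U\<close>. More than \<open>card U\<close> witnesses of the
  strictness of the chain would satisfy a relation modulo that prime.\<close>

lemma krull_dim_le_independent_set:
  assumes simple: "simple_graph V E" and n: "\<And>U. U \<in> independent_sets V E \<Longrightarrow> card U \<le> n"
  shows "krull_dim (edge_ring V E :: ('a, 'k::field) mpoly set ring) \<le> enat n"
  unfolding krull_dim_def
proof (rule Sup_least)
  let ?R = "poly_ring V :: ('a, 'k) mpoly ring"
  let ?I = "edge_ideal V E :: ('a, 'k) mpoly set"
  let ?h = "(+>\<^bsub>?R\<^esub>) ?I"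
  have finV: "finite V" using simple unfolding simple_graph_def by blast
  have I: "polys.is_ideal V ?I" "?I = face_ideal V (independent_sets V E)"
    unfolding edge_ideal_eq_face_ideal[OF simple]
    using is_ideal_face_ideal[OF independent_sets_subset] by auto
  interpret I: ideal ?I ?R using I(1) unfolding ideal_poly_ring_iff .
  interpret h: ring_hom_ring ?R "?R Quot ?I" ?h by (rule I.rcos_ring_hom_ring)
  fix x assume "x \<in> {enat n |n. \<exists>P. (\<forall>i\<le>n. primeideal (P i) (edge_ring V E :: ('a, 'k) mpoly set ring)) \<and>
    (\<forall>i<n. P i \<subset> P (Suc i))}"
  then obtain N P where x: "x = enat N"
    and P: "\<And>i. i \<le> N \<Longrightarrow> primeideal (P i) (?R Quot ?I)" "\<And>i. i < N \<Longrightarrow> P i \<subset> P (Suc i)"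
    unfolding edge_ring_def by blast
  define J where "J i = {r \<in> polys V. ?h r \<in> P i}" for i
  have prime: "polys.is_prime V (J i)" if "i \<le> N" for i
    using h.primeideal_vimage[OF cring_poly_ring P(1)[OF that]] unfolding J_def primeideal_poly_ring_iff[symmetric]
    by simp
  have J_sub: "J i \<subseteq> J (Suc i)" if "i < N" for i using P(2)[OF that] unfolding J_def by blast
  have "\<exists>y. y \<in> J (Suc i) \<and> y \<notin> J i" if i: "i < N" for i
  proof -
    obtain q where q: "q \<in> P (Suc i)" "q \<notin> P i" using P(2)[OF i] by blast
    have "P (Suc i) \<subseteq> carrier (?R Quot ?I)"
      using P(1)[of "Suc i"] i additive_subgroup.a_subset[OF ideal.axioms(1)[OF primeideal.axioms(1)]] by simp
    then obtain y where "y \<in> polys V" "q = ?h y" using q(1) unfolding carrier_Quot by auto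
    then show ?thesis using q unfolding J_def by blast
  qed
  then obtain y where y: "\<And>i. i < N \<Longrightarrow> y i \<in> J (Suc i) \<and> y i \<notin> J i" by metis
  have IJ: "?I \<subseteq> J 0"
  proof
    fix r assume r: "r \<in> ?I"
    have "?h r = \<zero>\<^bsub>?R Quot ?I\<^esub>" using I.a_rcos_const[OF r] unfolding FactRing_def by simp
    moreover have "\<zero>\<^bsub>?R Quot ?I\<^esub> \<in> P 0"
      using additive_subgroup.zero_closed[OF ideal.axioms(1)[OF primeideal.axioms(1)[OF P(1)]]] by simp
    ultimately show "r \<in> J 0" using polys.ideal_closed[OF I(1) r] unfolding J_def by simp
  qed
  define U where "U = {v \<in> V. var v \<notin> J 0}"
  have "{u, v} \<notin> E" if "u \<in> U" "v \<in> U" for u v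
  proof
    assume "{u, v} \<in> E"
    then have "(var u * var v :: ('a, 'k) mpoly) \<in> ?I"
      unfolding edge_ideal_def genideal_def by blast
    then have "(var u * var v :: ('a, 'k) mpoly) \<in> J 0" using IJ by blast
    then show False
      using prime[of 0] that var_in_polys[where V = V] unfolding polys.is_prime_def U_def by blast
  qed
  then have "U \<in> independent_sets V E" unfolding independent_sets_def U_def by blast
  then have cU: "card U \<le> n" by (rule n)
  have FJ: "face_ideal V (Pow U) \<subseteq> J 0"
    by (rule face_ideal_Pow_subset_prime[OF prime]) (auto simp: U_def)
  have "N \<le> card U"
  proof (rule ccontr)
    assume "\<not> N \<le> card U"
    then have less: "card U < N" by simp
    define z where "z i = (if i < N then y i else 0)" for i
    have "z i \<in> polys V" for i
      using y[of i] polys.zero_closed[of V] unfolding z_def J_def by auto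
    then obtain T \<kappa> where T: "finite T" "T \<noteq> {}" "\<forall>a\<in>T. \<forall>i\<ge>N. a i = 0" "\<forall>a\<in>T. \<kappa> a \<noteq> (0::'k)"
      "(\<Sum>a\<in>T. single 0 (\<kappa> a) * monomial z N a) \<in> face_ideal V (Pow U)"
      using ex_algebraic_relation[of U N z V] less finV unfolding U_def by auto
    have "(\<Sum>a\<in>T. single 0 (\<kappa> a) * (\<Prod>i=0..<N. z i ^ a i)) \<notin> J 0"
    proof (rule polys.prime_chain_independent[where P = J and x = z])
      show "z i \<in> J (Suc i) \<and> z i \<notin> J i" if "i < N" for i using y[OF that] that unfolding z_def by simp
      show "polys.unit V (single 0 (\<kappa> a))" if "a \<in> T" for a using unit_const T(4) that by blast
      show "a i = b i" if "a \<in> T" "b \<in> T" "i \<notin> {0..<N}" for a b i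
        using T(3) that by (metis atLeastLessThan_iff le0 not_le)
    qed (use prime J_sub T(1,2) in auto)
    then show False
      using T(5) FJ unfolding monomial_def atLeast0LessThan by blast
  qed
  then show "x \<le> enat n" using cU x by simp
qed

section \<open>The depth of an edge ring\<close>

definition order_ge :: "'a set \<Rightarrow> nat \<Rightarrow> ('a, 'k::field) mpoly \<Rightarrow> bool" where
  "order_ge V n f \<longleftrightarrow> (\<forall>t\<in>keys f. n \<le> (\<Sum>v\<in>V. lookup t v))"

lemma order_ge_mult: "order_ge V m f \<Longrightarrow> order_ge V n g \<Longrightarrow> order_ge V (m + n) (f * g)"
  unfolding order_ge_def
proof
  fix t assume fg: "\<forall>t\<in>keys f. m \<le> (\<Sum>v\<in>V. lookup t v)" "\<forall>t\<in>keys g. n \<le> (\<Sum>v\<in>V. lookup t v)"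
    and "t \<in> keys (f * g)"
  then obtain a b where "a \<in> keys f" "b \<in> keys g" "t = a + b"
    using keys_mult[of f g] by blast
  then show "m + n \<le> (\<Sum>v\<in>V. lookup t v)" using fg by (simp add: lookup_add sum.distrib add_mono)
qed

lemma order_ge_monomial:
  assumes f: "\<And>i. i < r \<Longrightarrow> order_ge V 1 (f i)"
  shows "a \<in> exponents r k \<Longrightarrow> order_ge V k (monomial f r a)"
proof (induction k arbitrary: a)
  case 0
  then show ?case by (simp add: order_ge_def)
next
  case (Suc k)
  obtain i b where ib: "i < r" "b \<in> exponents r k" "a = b(i := Suc (b i))"
    using exponents_Suc_decr[OF Suc.prems] by blast
  then have "monomial f r a = f i * monomial f r b" by (simp only: monomial_incr)
  then show ?case using order_ge_mult[OF f[OF ib(1)] Suc.IH[OF ib(2)]] by simp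
qed

lemma is_ideal_no_constant_term: "polys.is_ideal V {f \<in> polys V. 0 \<notin> keys (f :: ('a, 'k::field) mpoly)}"
proof -
  have "{f \<in> polys V. 0 \<notin> keys f} = (face_ideal V {{}} :: ('a, 'k) mpoly set)"
    unfolding face_ideal_def by auto
  then show ?thesis using is_ideal_face_ideal[of "{{}}" V] by simp
qed

lemma maximal_ideal_no_constant_term:
  "genideal (poly_ring V) (var ` V) \<subseteq> {f \<in> polys V. 0 \<notin> keys (f :: ('a, 'k::field) mpoly)}"
proof -
  interpret cring "poly_ring V :: ('a, 'k) mpoly ring" by (rule cring_poly_ring)
  show ?thesis
  proof (rule genideal_minimal)
    show "ideal {f \<in> polys V. 0 \<notin> keys f} (poly_ring V :: ('a, 'k) mpoly ring)"
      unfolding ideal_poly_ring_iff by (rule is_ideal_no_constant_term)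
    show "var ` V \<subseteq> {f \<in> polys V. 0 \<notin> keys (f :: ('a, 'k) mpoly)}"
    proof
      fix f :: "('a, 'k) mpoly" assume "f \<in> var ` V"
      then obtain v where v: "v \<in> V" "f = var v" by blast
      have "single v (1::nat) \<noteq> 0" by (metis lookup_single_eq lookup_zero one_neq_zero)
      then show "f \<in> {f \<in> polys V. 0 \<notin> keys f}" using var_in_polys[OF v(1)] v(2) by (auto simp: var_def)
    qed
  qed
qed

text \<open>The product \<open>z\<close> of the variables in \<open>F\<close> is annihilated by all variables outside
  \<open>F\<close>, hence by the algebraic relation that more than \<open>card F\<close> polynomials satisfy
  modulo these variables. A degree count shows that \<open>z\<close> does not lie in a high power of the
  ideal generated by polynomials without constant term.\<close>

lemma regular_length_le_facet:
  fixes f :: "nat \<Rightarrow> ('a, 'k::field) mpoly"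
  assumes simple: "simple_graph V E" and F: "F \<in> facets (independent_sets V E)"
    and f: "\<And>i. f i \<in> polys V" "\<And>i. 0 \<notin> keys (f i)"
    and reg: "polys.regular V (face_ideal V (independent_sets V E)) f r"
  shows "r \<le> card F"
proof (rule ccontr)
  assume "\<not> r \<le> card F"
  let ?\<Delta> = "independent_sets V E"
  let ?I = "face_ideal V ?\<Delta> :: ('a, 'k) mpoly set"
  have finV: "finite V" using simple unfolding simple_graph_def by blast
  have FV: "F \<in> ?\<Delta>" "F \<subseteq> V" using F unfolding facets_def independent_sets_def by auto
  have finF: "finite F" using FV(2) finV finite_subset by blast
  have I: "polys.is_ideal V ?I" by (rule is_ideal_face_ideal) (rule independent_sets_subset)
  obtain T \<kappa> where T: "finite T" "T \<noteq> {}" "\<forall>a\<in>T. \<forall>i\<ge>r. a i = 0" "\<forall>a\<in>T. \<kappa> a \<noteq> (0::'k)"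
    "(\<Sum>a\<in>T. single 0 (\<kappa> a) * monomial f r a) \<in> face_ideal V (Pow F)"
    using ex_algebraic_relation[of F r f V] finF \<open>\<not> r \<le> card F\<close> f(1) by auto
  define t where "t = (\<Sum>v\<in>F. single v (1::nat))"
  define z where "z = single t (1::'k)"
  have look: "lookup t u = (if u \<in> F then 1 else 0)" for u
  proof -
    have "lookup t u = (\<Sum>v\<in>F. if v = u then 1 else 0)"
      unfolding t_def lookup_sum by (rule sum.cong) (auto simp: lookup_single when_def)
    then show ?thesis using finF by simp
  qed
  have keys_t: "keys t = F" by (auto simp: in_keys_iff look split: if_splits)
  have "z * (\<Sum>a\<in>T. single 0 (\<kappa> a) * monomial f r a) \<in> ?I"
  proof -
    have "F \<union> keys u \<notin> ?\<Delta>" if "\<not> keys u \<subseteq> F" for u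
      using F that unfolding facets_def by blast
    then show ?thesis
      unfolding z_def using T(5) FV(2) single_times_in_face_ideal[of t V _ ?\<Delta>, unfolded keys_t]
      unfolding face_ideal_def[of V "Pow F"] by blast
  qed
  then have mem: "(\<Sum>a\<in>T. single 0 (\<kappa> a) * monomial f r a) * z \<in> ?I" by (simp add: mult.commute)
  \<comment> \<open>modulo the edge ideal, the polynomials of order greater than \<open>card F\<close>\<close>
  define H :: "('a, 'k) mpoly set" where "H = {g \<in> polys V. \<forall>u\<in>keys g. keys u \<in> ?\<Delta> \<longrightarrow> Suc (card F) \<le> (\<Sum>v\<in>V. lookup u v)}"
  have H: "polys.is_ideal V (H :: ('a, 'k) mpoly set)"
    unfolding polys.is_ideal_def
  proof (intro conjI ballI)
    show "H \<subseteq> polys V" "(0 :: ('a, 'k) mpoly) \<in> H" unfolding H_def by (auto simp: polys.zero_closed)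
  next
    fix x y :: "('a, 'k) mpoly" assume "x \<in> H" "y \<in> H"
    then show "x + y \<in> H" using keys_add[of x y] polys.add_closed unfolding H_def by blast
  next
    fix c x :: "('a, 'k) mpoly" assume c: "c \<in> polys V" and x: "x \<in> H"
    have "Suc (card F) \<le> (\<Sum>v\<in>V. lookup u v)" if u: "u \<in> keys (c * x)" "keys u \<in> ?\<Delta>" for u
    proof -
      obtain a b where ab: "b \<in> keys x" "u = a + b" using keys_mult[of c x] u(1) by blast
      then have "keys b \<in> ?\<Delta>" using u(2) independent_sets_subset[of "keys b" "keys u"] by (simp add: keys_plus_nat)
      then have "Suc (card F) \<le> (\<Sum>v\<in>V. lookup b v)" using x ab unfolding H_def by blast
      then show ?thesis unfolding ab(2) by (simp add: lookup_add sum.distrib)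
    qed
    then show "c * x \<in> H" using c x polys.mult_closed unfolding H_def by blast
  qed
  have f1: "order_ge V 1 (f i)" for i
    unfolding order_ge_def
  proof
    fix u assume u: "u \<in> keys (f i)"
    then have "u \<noteq> 0" using f(2)[of i] by auto
    then obtain v where "v \<in> keys u" by fastforce
    moreover have "keys u \<subseteq> V" using u f(1)[of i] unfolding polys_def by blast
    ultimately have "lookup u v \<noteq> 0" "v \<in> V" by (auto simp: in_keys_iff)
    then have "1 \<le> lookup u v" "lookup u v \<le> (\<Sum>v\<in>V. lookup u v)"
      using finV by (auto intro: member_le_sum)
    then show "1 \<le> (\<Sum>v\<in>V. lookup u v)" by linarith
  qed
  have "polys.forms ?I f r (Suc (card F)) (polys V) \<subseteq> H"
  proof (rule polys.forms_subsetI[OF H])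
    show "?I \<subseteq> H" unfolding H_def face_ideal_def by blast
    fix a and q :: "('a, 'k) mpoly"
    assume "a \<in> exponents r (Suc (card F))" and q: "q \<in> polys V"
    then have "order_ge V (Suc (card F)) (monomial f r a)" by (intro order_ge_monomial f1)
    then have "monomial f r a \<in> H"
      using polys.monomial_closed[of f V r a] f(1) unfolding H_def order_ge_def by blast
    then show "q * monomial f r a \<in> H" by (rule polys.ideal_mult[OF H q])
  qed
  moreover have "z \<notin> H"
  proof
    assume "z \<in> H"
    then have "Suc (card F) \<le> (\<Sum>v\<in>V. lookup t v)"
      using keys_t FV(1) unfolding H_def z_def by simp
    also have "\<dots> = card F"
      unfolding look using finV FV(2) by (simp add: sum.If_cases Int_absorb1)
    finally show False by simp
  qed
  ultimately have "z \<notin> polys.forms ?I f r (Suc (card F)) (polys V)" by blast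
  moreover have "z \<in> polys V" unfolding z_def by (rule polys_single) (simp add: keys_t FV(2))
  moreover have "polys.unit V (single 0 (\<kappa> a))" if "a \<in> T" for a using unit_const T(4) that by blast
  ultimately have "(\<Sum>a\<in>T. single 0 (\<kappa> a) * monomial f r a) * z \<notin> ?I"
    by (intro polys.regular_sequence_independent[OF I _ reg]) (use f(1) T(1,2,3) in auto)
  then show False using mem by contradiction
qed

lemma depth_le_facet:
  assumes simple: "simple_graph V E" and F: "F \<in> facets (independent_sets V E)"
  shows "depth (edge_ring V E :: ('a, 'k::field) mpoly set ring) (graded_maximal_ideal V E) \<le> enat (card F)"
  unfolding depth_def
proof (rule Sup_least)
  let ?R = "poly_ring V :: ('a, 'k) mpoly ring"
  let ?I = "edge_ideal V E :: ('a, 'k) mpoly set"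
  fix x assume "x \<in> {enat (length fs) |fs. set fs \<subseteq> graded_maximal_ideal V E \<and>
    regular_sequence (edge_ring V E :: ('a, 'k) mpoly set ring) fs}"
  then obtain fs where x: "x = enat (length fs)" and fs: "set fs \<subseteq> graded_maximal_ideal V E"
    and reg: "regular_sequence (?R Quot ?I) fs"
    unfolding edge_ring_def by blast
  have "\<exists>g. g \<in> genideal ?R (var ` V) \<and> fs ! i = ?I +>\<^bsub>?R\<^esub> g" if "i < length fs" for i
    using fs nth_mem[OF that] unfolding graded_maximal_ideal_def by blast
  then obtain g where g: "\<And>i. i < length fs \<Longrightarrow> g i \<in> genideal ?R (var ` V) \<and> fs ! i = ?I +>\<^bsub>?R\<^esub> g i"
    by metis
  define f where "f i = (if i < length fs then g i else 0)" for i
  have f: "f i \<in> polys V" "0 \<notin> keys (f i)" for i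
    using g[of i] maximal_ideal_no_constant_term[of V, where 'k = 'k] polys.zero_closed[of V]
    unfolding f_def by auto
  have "fs = map (\<lambda>i. ?I +>\<^bsub>?R\<^esub> f i) [0..<length fs]"
    by (rule nth_equalityI) (use g in \<open>simp_all add: f_def\<close>)
  then have "regular_sequence (?R Quot ?I) (map (\<lambda>i. ?I +>\<^bsub>?R\<^esub> f i) [0..<length fs])" using reg by simp
  moreover have I: "polys.is_ideal V ?I"
    unfolding edge_ideal_eq_face_ideal[OF simple]
    by (rule is_ideal_face_ideal) (rule independent_sets_subset)
  ultimately have "polys.regular V ?I f (length fs)"
    using regular_sequence_Quot_iff[where f = f, OF I f(1)] by simp
  then have "polys.regular V (face_ideal V (independent_sets V E)) f (length fs)"
    unfolding edge_ideal_eq_face_ideal[OF simple] .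
  then have "length fs \<le> card F"
    by (rule regular_length_le_facet[where f = f, OF simple F f])
  then show "x \<le> enat (card F)" using x by simp
qed

section \<open>A system of parameters from a colouring\<close>

definition colour_sum :: "'a set \<Rightarrow> ('a \<Rightarrow> nat) \<Rightarrow> nat \<Rightarrow> ('a, 'k::field) mpoly" where
  "colour_sum V col i = (\<Sum>v\<in>{v \<in> V. col v = i}. var v)"

lemma colour_sum_in_polys: "colour_sum V col i \<in> polys V"
  unfolding colour_sum_def by (rule polys.sum_closed) (simp add: var_in_polys)

text \<open>Removing the neighbours of \<open>v\<close> leaves \<open>v\<close> as the only vertex of its colour, and
  isolated; no colour is lost.\<close>

lemma clique_whiskered_star:
  assumes cw: "clique_whiskered col W E" and v: "v \<in> W" and loop: "{v} \<notin> E"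
  shows "clique_whiskered col {u \<in> W. {u, v} \<notin> E} E" "col ` {u \<in> W. {u, v} \<notin> E} = col ` W"
proof -
  let ?W = "{u \<in> W. {u, v} \<notin> E}"
  have ex: "\<exists>d\<in>?W. col d = col w \<and> (\<forall>u\<in>?W. {u, d} \<in> E \<longrightarrow> col u = col w)" if w: "w \<in> W" for w
  proof (cases "col w = col v")
    case True
    then show ?thesis using v loop by (intro bexI[of _ v]) auto
  next
    case False
    obtain d where d: "d \<in> W" "col d = col w" "\<forall>u\<in>W. {u, d} \<in> E \<longrightarrow> col u = col w"
      using cw w unfolding clique_whiskered_def by blast
    have "{d, v} \<notin> E" using d(3) v False by (metis insert_commute)
    then show ?thesis using d by (intro bexI[of _ d]) auto
  qed
  have "\<forall>u\<in>?W. \<forall>w\<in>?W. u \<noteq> w \<and> col u = col w \<longrightarrow> {u, w} \<in> E"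
    using cw unfolding clique_whiskered_def by blast
  then show "clique_whiskered col ?W E" unfolding clique_whiskered_def using ex by blast
  show "col ` ?W = col ` W"
  proof
    show "col ` W \<subseteq> col ` ?W"
    proof
      fix c assume "c \<in> col ` W"
      then obtain w where w: "w \<in> W" "c = col w" by blast
      obtain d where "d \<in> ?W" "col d = c" using ex[OF w(1)] w(2) by blast
      then show "c \<in> col ` ?W" by blast
    qed
  qed blast
qed

lemma star_independent_sets:
  assumes "v \<in> W" "{v} \<notin> E"
  shows "{\<sigma>. insert v \<sigma> \<in> independent_sets W E} = independent_sets {u \<in> W. {u, v} \<notin> E} E"
proof -
  have sym: "{v, u} \<in> E \<longleftrightarrow> {u, v} \<in> E" for u by (simp add: insert_commute)
  have "insert v \<sigma> \<in> independent_sets W E \<longleftrightarrow> \<sigma> \<in> independent_sets {u \<in> W. {u, v} \<notin> E} E" for \<sigma>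
  proof
    assume s: "insert v \<sigma> \<in> independent_sets W E"
    then have "\<forall>a\<in>\<sigma>. a \<in> W \<and> {a, v} \<notin> E" "\<forall>a\<in>\<sigma>. \<forall>b\<in>\<sigma>. {a, b} \<notin> E"
      unfolding independent_sets_def by blast+
    then show "\<sigma> \<in> independent_sets {u \<in> W. {u, v} \<notin> E} E" unfolding independent_sets_def by blast
  next
    assume s: "\<sigma> \<in> independent_sets {u \<in> W. {u, v} \<notin> E} E"
    then have "\<forall>a\<in>\<sigma>. {a, v} \<notin> E" "\<forall>a\<in>\<sigma>. \<forall>b\<in>\<sigma>. {a, b} \<notin> E" "\<sigma> \<subseteq> W"
      unfolding independent_sets_def by blast+
    then show "insert v \<sigma> \<in> independent_sets W E"
      using sym assms unfolding independent_sets_def by simp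
  qed
  then show ?thesis by blast
qed

text \<open>If the colours of \<open>W\<close> are distinct, then modulo the face ideal a colour sum is the variable
  of the only vertex of \<open>W\<close> with that colour.\<close>

lemma adjoin_upto_colour_sum:
  fixes V :: "'a set"
  assumes V: "finite V" and W: "W \<subseteq> V" "inj_on col W"
  shows "polys.adjoin_upto V (face_ideal V (Pow W)) (colour_sum V col) i =
    (face_ideal V (Pow {w \<in> W. i \<le> col w}) :: ('a, 'k::field) mpoly set)"
proof (induction i)
  case 0
  then show ?case by simp
next
  case (Suc i)
  let ?W = "{w \<in> W. i \<le> col w}" and ?W' = "{w \<in> W. Suc i \<le> col w}"
  let ?J = "face_ideal V (Pow ?W) :: ('a, 'k) mpoly set"
  let ?J' = "face_ideal V (Pow ?W') :: ('a, 'k) mpoly set"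
  let ?\<theta> = "colour_sum V col i :: ('a, 'k) mpoly"
  have J: "polys.is_ideal V ?J" "polys.is_ideal V ?J'" by (rule is_ideal_face_ideal, blast)+
  have A: "polys.is_ideal V (polys.adjoin V ?J ?\<theta>)" by (rule polys.is_ideal_adjoin[OF J(1) colour_sum_in_polys])
  have var_mem: "var v \<in> (face_ideal V (Pow X) :: ('a, 'k) mpoly set)" if "v \<in> V" "v \<notin> X" for v X
    using var_in_polys[OF that(1), where 'b = 'k] that(2) unfolding face_ideal_def var_def by simp
  have "polys.adjoin V ?J ?\<theta> = ?J'"
  proof
    show "polys.adjoin V ?J ?\<theta> \<subseteq> ?J'"
    proof (rule polys.adjoin_minimal[OF J])
      have "?W' \<subseteq> ?W" by auto
      then show "?J \<subseteq> ?J'" unfolding face_ideal_def by blast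
      show "?\<theta> \<in> ?J'"
        unfolding colour_sum_def by (rule polys.ideal_sum[OF J(2)]) (auto intro: var_mem)
    qed
    show "?J' \<subseteq> polys.adjoin V ?J ?\<theta>"
    proof
      fix g :: "('a, 'k) mpoly" assume g: "g \<in> ?J'"
      show "g \<in> polys.adjoin V ?J ?\<theta>"
      proof (rule polys_mem_ideal[OF A])
        fix t assume t: "t \<in> keys g"
        then have tV: "keys t \<subseteq> V" "\<not> keys t \<subseteq> ?W'" using g unfolding face_ideal_def polys_def by auto
        have lt: "lookup g t \<noteq> 0" using t by (simp add: in_keys_iff)
        show "single t (lookup g t) \<in> polys.adjoin V ?J ?\<theta>"
        proof (cases "keys t \<subseteq> ?W")
          case False
          then have "single t (lookup g t) \<in> ?J"
            using polys_single[OF tV(1), of "lookup g t"] lt unfolding face_ideal_def by simp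
          then show ?thesis using polys.adjoin_superset[OF J(1)] by blast
        next
          case True
          then obtain w where w: "w \<in> keys t" "w \<in> W" "col w = i"
          proof -
            obtain w where w: "w \<in> keys t" "w \<notin> ?W'" using tV(2) by blast
            then have "w \<in> W" "col w = i" using True by auto
            then show thesis using that w(1) by blast
          qed
          have wV: "w \<in> {v \<in> V. col v = i}" using w W(1) by blast
          have "?\<theta> - var w = (\<Sum>v\<in>{v \<in> V. col v = i} - {w}. var v)"
            unfolding colour_sum_def using V wV by (simp add: sum.remove)
          also have "\<dots> \<in> ?J"
          proof (rule polys.ideal_sum[OF J(1)])
            fix v assume v: "v \<in> {v \<in> V. col v = i} - {w}"
            then have "v \<notin> W" using W(2) w(2,3) by (auto dest: inj_onD)
            then show "var v \<in> ?J" using v by (intro var_mem) auto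
          qed
          finally have "?\<theta> - var w \<in> polys.adjoin V ?J ?\<theta>" using polys.adjoin_superset[OF J(1)] by blast
          moreover have "?\<theta> \<in> polys.adjoin V ?J ?\<theta>"
            using polys.adjoin_mem[OF J(1) polys.one_closed, of ?\<theta>] by simp
          ultimately have "var w \<in> polys.adjoin V ?J ?\<theta>"
            using polys.ideal_diff[OF A, of ?\<theta> "?\<theta> - var w"] by simp
          then show ?thesis by (rule single_in_ideal[OF A _ w(1) tV(1)])
        qed
      qed
    qed
  qed
  then show ?case using Suc.IH by simp
qed

lemma regular_colour_sums_simplex:
  fixes V :: "'a set"
  assumes V: "finite V" and W: "W \<subseteq> V" "inj_on col W" "col ` W = {..<r}"
  shows "polys.regular V (face_ideal V (Pow W) :: ('a, 'k::field) mpoly set) (colour_sum V col) r"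
  unfolding polys.regular_def adjoin_upto_colour_sum[OF V W(1,2)]
proof (intro allI impI ballI)
  fix i and x :: "('a, 'k) mpoly"
  let ?W = "{w \<in> W. i \<le> col w}"
  let ?J = "face_ideal V (Pow ?W) :: ('a, 'k) mpoly set"
  assume i: "i < r" and x: "x \<in> polys V" and mem: "colour_sum V col i * x \<in> ?J"
  have J: "polys.is_ideal V ?J" by (rule is_ideal_face_ideal) blast
  have "i \<in> col ` W" using i W(3) by simp
  then obtain w where w: "w \<in> W" "col w = i" by blast
  have wV: "w \<in> {v \<in> V. col v = i}" using w W(1) by blast
  have split: "colour_sum V col i = var w + ((\<Sum>v\<in>{v \<in> V. col v = i} - {w}. var v) :: ('a, 'k) mpoly)"
    unfolding colour_sum_def using V wV by (simp add: sum.remove)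
  have "(\<Sum>v\<in>{v \<in> V. col v = i} - {w}. var v) \<in> ?J"
  proof (rule polys.ideal_sum[OF J])
    fix v assume v: "v \<in> {v \<in> V. col v = i} - {w}"
    then have "v \<notin> W" using W(2) w by (auto dest: inj_onD)
    then show "var v \<in> ?J" using v var_in_polys[of v V, where 'b = 'k] unfolding face_ideal_def var_def by simp
  qed
  then have "(\<Sum>v\<in>{v \<in> V. col v = i} - {w}. var v) * x \<in> ?J" by (rule polys.ideal_mult'[OF J x])
  moreover have "var w * x + (\<Sum>v\<in>{v \<in> V. col v = i} - {w}. var v) * x \<in> ?J"
    using mem unfolding split distrib_right .
  ultimately have "var w * x \<in> ?J" by (rule polys.ideal_add_cancel[OF J])
  then have "\<forall>t\<in>keys x. insert w (keys t) \<notin> Pow ?W"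
    using single_times_in_face_ideal[of "single w 1" V x "Pow ?W"] wV x unfolding var_def by simp
  then have "\<forall>t\<in>keys x. keys t \<notin> Pow ?W" using w by auto
  then show "x \<in> ?J" using x unfolding face_ideal_def by blast
qed

text \<open>Along \<open>clique_whiskered_cases\<close>: the colon ideal and the sum with a variable are the face
  ideals of the star and of the deletion, which belong to smaller clique-whiskered graphs with the
  same colours. In the end the quotient is a polynomial ring and the colour sums are its
  variables.\<close>

lemma regular_colour_sums:
  fixes V :: "'a set"
  assumes V: "finite V" and loop: "\<And>v. {v} \<notin> E"
    and "W \<subseteq> V" "clique_whiskered col W E" "col ` W = {..<r}"
  shows "polys.regular V (face_ideal V (independent_sets W E) :: ('a, 'k::field) mpoly set) (colour_sum V col) r"
  using assms(3-)
proof (induction "card W" arbitrary: W rule: less_induct)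
  case less
  have finW: "finite W" using less.prems(1) V finite_subset by blast
  from less.prems(2) loop show ?case
  proof (cases rule: clique_whiskered_cases)
    case no_edges
    then show ?thesis using regular_colour_sums_simplex[OF V less.prems(1) no_edges(1) less.prems(3)] by simp
  next
    case (remove v d)
    let ?I = "face_ideal V (independent_sets W E) :: ('a, 'k) mpoly set"
    let ?S = "{u \<in> W. {u, v} \<notin> E}"
    have vV: "v \<in> V" using remove(1) less.prems(1) by blast
    have down: "\<tau> \<in> independent_sets W E" if "\<sigma> \<in> independent_sets W E" "\<tau> \<subseteq> \<sigma>" for \<sigma> \<tau>
      using independent_sets_subset that by blast
    have I: "polys.is_ideal V ?I" by (rule is_ideal_face_ideal) (rule down)
    have dv: "{d, v} \<in> E" using less.prems(2) remove unfolding clique_whiskered_def by blast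
    show ?thesis
    proof (rule polys.regular_colon_adjoin[OF I var_in_polys[OF vV] colour_sum_in_polys])
      have "?S \<subset> W" using dv remove(2) by blast
      then have "card ?S < card W" by (rule psubset_card_mono[OF finW])
      moreover have "?S \<subseteq> V" using less.prems(1) by blast
      ultimately have "polys.regular V (face_ideal V (independent_sets ?S E) :: ('a, 'k) mpoly set) (colour_sum V col) r"
        using clique_whiskered_star[OF less.prems(2) remove(1) loop] less.prems(3) by (intro less.hyps) simp_all
      then show "polys.regular V (polys.colon V ?I (var v)) (colour_sum V col) r"
        unfolding colon_face_ideal_var[OF vV] star_independent_sets[OF remove(1) loop] .
      have "col ` (W - {v}) = col ` W"
      proof
        show "col ` W \<subseteq> col ` (W - {v})"
        proof
          fix c assume "c \<in> col ` W"
          then obtain w where "w \<in> W" "c = col w" by blast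
          then show "c \<in> col ` (W - {v})" using remove(2,3,4) by (cases "w = v") (metis Diff_iff empty_iff image_eqI insert_iff, blast)
        qed
      qed blast
      moreover have "card (W - {v}) < card W" using finW remove(1) by (rule card_Diff1_less)
      moreover have "W - {v} \<subseteq> V" using less.prems(1) by blast
      ultimately have "polys.regular V (face_ideal V (independent_sets (W - {v}) E) :: ('a, 'k) mpoly set) (colour_sum V col) r"
        using clique_whiskered_delete[OF less.prems(2) remove(2-5)] less.prems(3) by (intro less.hyps) simp_all
      moreover have "polys.adjoin V ?I (var v) = face_ideal V (independent_sets (W - {v}) E)"
        unfolding deletion_independent_sets[symmetric] by (rule adjoin_face_ideal_var[OF vV]) (rule down)
      ultimately show "polys.regular V (polys.adjoin V ?I (var v)) (colour_sum V col) r" by simp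
    qed
  qed
qed

lemma clique_whiskered_le_depth:
  fixes V :: "'a set"
  assumes simple: "simple_graph V E" and cw: "clique_whiskered col V E" "col ` V = {..<r}"
  shows "enat r \<le> depth (edge_ring V E :: ('a, 'k::field) mpoly set ring) (graded_maximal_ideal V E)"
proof -
  let ?R = "poly_ring V :: ('a, 'k) mpoly ring"
  let ?I = "edge_ideal V E :: ('a, 'k) mpoly set"
  let ?\<theta> = "colour_sum V col :: nat \<Rightarrow> ('a, 'k) mpoly"
  interpret cring ?R by (rule cring_poly_ring)
  have finV: "finite V" using simple unfolding simple_graph_def by blast
  have I: "polys.is_ideal V ?I" "?I = face_ideal V (independent_sets V E)"
    unfolding edge_ideal_eq_face_ideal[OF simple]
    using is_ideal_face_ideal[OF independent_sets_subset] by auto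
  have V: "var ` V \<subseteq> carrier ?R" using var_in_polys by auto
  have M: "polys.is_ideal V (genideal ?R (var ` V))"
    using genideal_ideal[OF V] unfolding ideal_poly_ring_iff .
  have \<theta>M: "?\<theta> i \<in> genideal ?R (var ` V)" for i
    unfolding colour_sum_def
    by (rule polys.ideal_sum[OF M]) (use genideal_self[OF V] in blast)
  let ?N = "{f \<in> polys V. 0 \<notin> keys (f :: ('a, 'k) mpoly)}"
  have "polys.adjoin_upto V ?I ?\<theta> r \<subseteq> ?N"
  proof (rule polys.adjoin_upto_minimal[OF I(1) colour_sum_in_polys is_ideal_no_constant_term])
    show "?I \<subseteq> ?N"
    proof
      fix g assume "g \<in> ?I"
      then have "g \<in> polys V" "\<forall>t\<in>keys g. keys t \<notin> independent_sets V E"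
        unfolding I(2) face_ideal_def by auto
      moreover have "{} \<in> independent_sets V E" unfolding independent_sets_def by simp
      ultimately show "g \<in> ?N" by (auto dest: bspec[of _ _ 0])
    qed
    show "?\<theta> i \<in> ?N" for i using \<theta>M maximal_ideal_no_constant_term by blast
  qed
  then have "1 \<notin> polys.adjoin_upto V ?I ?\<theta> r" by auto
  moreover have "polys.regular V ?I ?\<theta> r"
    unfolding I(2) by (rule regular_colour_sums[OF finV singleton_not_edge[OF simple] subset_refl cw])
  ultimately have "regular_sequence (edge_ring V E) (map (\<lambda>i. ?I +>\<^bsub>?R\<^esub> ?\<theta> i) [0..<r])"
    unfolding edge_ring_def using regular_sequence_Quot_iff[where f = ?\<theta>, OF I(1) colour_sum_in_polys] by simp
  moreover have "set (map (\<lambda>i. ?I +>\<^bsub>?R\<^esub> ?\<theta> i) [0..<r]) \<subseteq> graded_maximal_ideal V E"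
    unfolding graded_maximal_ideal_def using \<theta>M by auto
  moreover have "enat r = enat (length (map (\<lambda>i. ?I +>\<^bsub>?R\<^esub> ?\<theta> i) [0..<r]))" by simp
  ultimately show ?thesis unfolding depth_def by (intro Sup_upper) blast
qed

section \<open>The equivalences\<close>

text \<open>The colour of a leaf or of a new triangle vertex is the vertex to which it is attached. The leaf
  \<open>l i\<close> and the vertex \<open>p j\<close> are the simplicial vertices.\<close>

lemma bipartite_with_leaves_and_triangles_clique_whiskered:
  assumes "bipartite_with_leaves_and_triangles V E"
  obtains col :: "'a \<Rightarrow> 'a" where "clique_whiskered col (V :: 'a set) E"
proof -
  obtain A B F l p q where
    bip: "bipartite_graph A B F"
    and inj: "inj_on l A" "inj_on p B" "inj_on q B"
    and disj: "(A \<union> B) \<inter> (l ` A \<union> p ` B \<union> q ` B) = {}" "l ` A \<inter> (p ` B \<union> q ` B) = {}"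
      "p ` B \<inter> q ` B = {}"
    and V: "V = A \<union> B \<union> l ` A \<union> p ` B \<union> q ` B"
    and E: "E = F \<union> (\<Union>i\<in>A. {{i, l i}}) \<union> (\<Union>j\<in>B. {{j, p j}, {j, q j}, {p j, q j}})"
    using assms unfolding bipartite_with_leaves_and_triangles_def by blast
  have AB: "A \<inter> B = {}" and F: "\<And>e. e \<in> F \<Longrightarrow> e \<subseteq> A \<union> B"
    using bip unfolding bipartite_graph_def by auto
  define col where "col x = (if x \<in> l ` A then inv_into A l x else if x \<in> p ` B then inv_into B p x
    else if x \<in> q ` B then inv_into B q x else x)" for x
  have col_core: "col x = x" if "x \<in> A \<union> B" for x
    using that disj(1) unfolding col_def by auto
  have col_l: "col (l i) = i" if "i \<in> A" for i
    using that inj(1) unfolding col_def by simp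
  have col_p: "col (p j) = j" if j: "j \<in> B" for j
  proof -
    have "p j \<notin> l ` A" using disj(2) j by blast
    then show ?thesis using j inj(2) unfolding col_def by simp
  qed
  have col_q: "col (q j) = j" if j: "j \<in> B" for j
  proof -
    have "q j \<notin> l ` A" "q j \<notin> p ` B" using disj(2,3) j by blast+
    then show ?thesis using j inj(3) unfolding col_def by simp
  qed
  have cases: "(\<exists>i\<in>A. col x = i \<and> (x = i \<or> x = l i)) \<or> (\<exists>j\<in>B. col x = j \<and> (x = j \<or> x = p j \<or> x = q j))"
    if x: "x \<in> V" for x
    using x col_core col_l col_p col_q unfolding V by auto
  have clique: "{u, v} \<in> E" if uv: "u \<in> V" "v \<in> V" "u \<noteq> v" "col u = col v" for u v
  proof -
    let ?c = "col u"
    have "(?c \<in> A \<and> (u = ?c \<or> u = l ?c)) \<or> (?c \<in> B \<and> (u = ?c \<or> u = p ?c \<or> u = q ?c))"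
      using cases[OF uv(1)] by metis
    moreover have "(?c \<in> A \<and> (v = ?c \<or> v = l ?c)) \<or> (?c \<in> B \<and> (v = ?c \<or> v = p ?c \<or> v = q ?c))"
      using cases[OF uv(2)] uv(4) by metis
    ultimately consider "?c \<in> A" "u = ?c \<or> u = l ?c" "v = ?c \<or> v = l ?c"
      | "?c \<in> B" "u = ?c \<or> u = p ?c \<or> u = q ?c" "v = ?c \<or> v = p ?c \<or> v = q ?c"
      using AB by blast
    then show ?thesis
    proof cases
      case 1
      then have "{u, v} = {?c, l ?c}" using uv(3) by auto
      then show ?thesis using 1(1) unfolding E by blast
    next
      case 2
      then have "{u, v} \<in> {{?c, p ?c}, {?c, q ?c}, {p ?c, q ?c}}"
        using uv(3) by (elim disjE) (simp_all add: insert_commute)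
      then show ?thesis using 2(1) unfolding E by blast
    qed
  qed
  have simplicial: "col u = col d" if d: "d \<in> l ` A \<union> p ` B" and e: "{u, d} \<in> E" for u d
  proof -
    have "d \<notin> A \<union> B" using d disj(1) by blast
    then have "{u, d} \<notin> F" using F by blast
    then consider i where "i \<in> A" "{u, d} = {i, l i}"
      | j where "j \<in> B" "{u, d} = {j, p j} \<or> {u, d} = {j, q j} \<or> {u, d} = {p j, q j}"
      using e unfolding E by blast
    then show ?thesis
    proof cases
      case 1
      then show ?thesis using col_core[of i] col_l[of i] by (auto simp: doubleton_eq_iff)
    next
      case 2
      then show ?thesis using col_core[of j] col_p[of j] col_q[of j] by (auto simp: doubleton_eq_iff)
    qed
  qed
  have "\<exists>d\<in>V. col d = col v \<and> (\<forall>u\<in>V. {u, d} \<in> E \<longrightarrow> col u = col v)" if v: "v \<in> V" for v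
  proof -
    obtain d where d: "d \<in> l ` A \<union> p ` B" "col d = col v"
      using cases[OF v] col_l col_p by blast
    moreover have "d \<in> V" using d(1) unfolding V by blast
    ultimately show ?thesis using simplicial by metis
  qed
  then have "clique_whiskered col V E"
    unfolding clique_whiskered_def using clique by blast
  then show thesis by (rule that)
qed

lemma clique_whiskered_comp:
  assumes "clique_whiskered col W E" and h: "inj_on h (col ` W)"
  shows "clique_whiskered (h \<circ> col) W E"
proof -
  have "(h \<circ> col) u = (h \<circ> col) v \<longleftrightarrow> col u = col v" if "u \<in> W" "v \<in> W" for u v
    using inj_on_eq_iff[OF h, of "col u" "col v"] that by simp
  then show ?thesis using assms(1) unfolding clique_whiskered_def by (metis (no_types, lifting))
qed

text \<open>The sizes of two maximal independent sets are separated by the common value of depth and Krull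
  dimension, in both orders.\<close>

lemma cohen_macaulay_imp_unmixed:
  fixes V :: "'a set"
  assumes simple: "simple_graph V E" and cm: "cohen_macaulay_graph TYPE('k::field) V E"
  shows "unmixed V E"
proof -
  have le: "card F \<le> card G"
    if F: "F \<in> facets (independent_sets V E)" and G: "G \<in> facets (independent_sets V E)" for F G
  proof -
    let ?R = "edge_ring V E :: ('a, 'k) mpoly set ring"
    have "F \<in> independent_sets V E" using F unfolding facets_def by blast
    then have "enat (card F) \<le> krull_dim ?R" by (rule independent_set_le_krull_dim[OF simple])
    also have "\<dots> = depth ?R (graded_maximal_ideal V E)"
      using cm unfolding cohen_macaulay_graph_def Let_def by simp
    also have "\<dots> \<le> enat (card G)" by (rule depth_le_facet[OF simple G])
    finally show ?thesis by simp
  qed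
  then show ?thesis
    unfolding unmixed_iff_facets[OF simple] by (blast intro: antisym)
qed

text \<open>Depth and Krull dimension are both squeezed to the number of colours.\<close>

lemma clique_whiskered_cohen_macaulay:
  fixes V :: "'a set"
  assumes simple: "simple_graph V E" and cw: "clique_whiskered col V E"
  shows "cohen_macaulay_graph TYPE('k::field) V E"
proof -
  let ?R = "edge_ring V E :: ('a, 'k) mpoly set ring"
  let ?m = "graded_maximal_ideal V E :: ('a, 'k) mpoly set set"
  define r where "r = card (col ` V)"
  have finV: "finite V" using simple unfolding simple_graph_def by blast
  obtain h where h: "bij_betw h (col ` V) {..<r}"
    using ex_bij_betw_finite_nat[of "col ` V"] finV unfolding r_def atLeast0LessThan by auto
  have "clique_whiskered (h \<circ> col) V E"
    by (rule clique_whiskered_comp[OF cw bij_betw_imp_inj_on[OF h]])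
  moreover have "(h \<circ> col) ` V = {..<r}"
    using h unfolding bij_betw_def image_comp[symmetric] by simp
  ultimately have lower: "enat r \<le> depth ?R ?m" by (rule clique_whiskered_le_depth[OF simple])
  have facet: "card F = r" if "F \<in> facets (independent_sets V E)" for F
    using clique_whiskered_facet_card[OF cw singleton_not_edge[OF simple] that] unfolding r_def .
  have "{} \<in> independent_sets V E" unfolding independent_sets_def by simp
  then obtain F where F: "F \<in> facets (independent_sets V E)"
    using obtain_facet[OF finite_independent_sets[OF finV]] by blast
  then have FI: "F \<in> independent_sets V E" unfolding facets_def by blast
  have "card U \<le> r" if "U \<in> independent_sets V E" for U
  proof -
    obtain G where G: "G \<in> facets (independent_sets V E)" "U \<subseteq> G"
      using obtain_facet[OF finite_independent_sets[OF finV] \<open>U \<in> _\<close>] by blast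
    then have "finite G" using finV finite_subset unfolding facets_def independent_sets_def by blast
    then show ?thesis using card_mono[OF _ G(2)] facet[OF G(1)] by simp
  qed
  then have "krull_dim ?R \<le> enat r" by (rule krull_dim_le_independent_set[OF simple])
  moreover have "enat r \<le> krull_dim ?R"
    using independent_set_le_krull_dim[OF simple FI, where 'k = 'k] facet[OF F] by simp
  moreover have "depth ?R ?m \<le> enat r"
    using depth_le_facet[OF simple F, where 'k = 'k] facet[OF F] by simp
  ultimately show ?thesis
    using lower unfolding cohen_macaulay_graph_def Let_def by (metis antisym)
qed

theorem theorem1p3:
  fixes V :: "'a set" and E :: "'a set set"
  assumes "cameron_walker V E"
  shows "(unmixed V E \<longleftrightarrow> cohen_macaulay_graph TYPE('k::field) V E) \<and>
    (unmixed V E \<longleftrightarrow> unmixed V E \<and> shellable_graph V E) \<and>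
    (unmixed V E \<longleftrightarrow> unmixed V E \<and> vertex_decomposable_graph V E) \<and>
    (unmixed V E \<longleftrightarrow> bipartite_with_leaves_and_triangles V E)"
proof -
  have simple: "simple_graph V E" using assms unfolding cameron_walker_def by blast
  have finV: "finite V" using simple unfolding simple_graph_def by blast
  have structure_imp: "unmixed V E \<and> cohen_macaulay_graph TYPE('k) V E \<and> shellable_graph V E \<and>
    vertex_decomposable_graph V E" if "bipartite_with_leaves_and_triangles V E"
  proof -
    obtain col :: "'a \<Rightarrow> 'a" where cw: "clique_whiskered col V E"
      using bipartite_with_leaves_and_triangles_clique_whiskered[OF \<open>bipartite_with_leaves_and_triangles V E\<close>]
      by blast
    have vd: "vertex_decomposable (independent_sets V E)"
      by (rule clique_whiskered_vertex_decomposable[OF finV cw singleton_not_edge[OF simple]])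
    have "finite \<sigma>" if "\<sigma> \<in> independent_sets V E" for \<sigma>
      using that finV finite_subset unfolding independent_sets_def by blast
    then have "simplicial_complex (independent_sets V E)"
      unfolding simplicial_complex_def
      using finite_independent_sets[OF finV] independent_sets_subset by blast
    then have "shellable (independent_sets V E)"
      by (rule vertex_decomposable_imp_shellable[OF vd])
    moreover have "unmixed V E"
      unfolding unmixed_iff_facets[OF simple]
      using clique_whiskered_facet_card[OF cw singleton_not_edge[OF simple]] by metis
    ultimately show ?thesis
      using vd clique_whiskered_cohen_macaulay[OF simple cw]
      unfolding shellable_graph_def vertex_decomposable_graph_def independence_complex_eq[OF simple]
      by blast
  qed
  have "bipartite_with_leaves_and_triangles V E" if "unmixed V E"
    by (rule unmixed_cameron_walker_bipartite_structure[OF assms that])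
  moreover have "unmixed V E" if "cohen_macaulay_graph TYPE('k) V E"
    by (rule cohen_macaulay_imp_unmixed[OF simple that])
  ultimately show ?thesis using structure_imp by blast
qed

end
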